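(* Let $\Omega$ be a bounded domain of $\mathbb{R}^n$, let $1<p<2$ and $\sigma>0$. Let $\bm{a}:\Omega\times\mathbb{R}^n\to\mathbb{R}^n$ be a Carathéodory function (measurable in $x$, continuous in $\xi$) such that there is $\gamma>0$ with $$(\bm{a}(x,\xi)-\bm{a}(x,\eta))\cdot(\xi-\eta)\ge\gamma\,(1+|\xi|+|\eta|)^{p-2}|\xi-\eta|^2$$ for all $x\in\Omega$, $\xi,\eta\in\mathbb{R}^n$. Let $f,g:\Omega\times\mathbb{R}\to\mathbb{R}$ be continuous, with $f(x,t)$ and $g(x,t)$ non-decreasing in $t\in\mathbb{R}$ for every $x\in\Omega$. Suppose $u,v\in W^{1,\infty}_{loc}(\Omega)$ and one of the following holds: ($\widetilde{A}_1$) $0<\sigma<1$ and $f$ is increasing in $t$; ($\widetilde{A}_2$) $1\le\sigma$. If $Q^*u\le Q^*v$ in $\Omega$ and $u\le v$ on $\partial\Omega$, then $u\le v$ in $\Omega$.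
   Context: Here $Q^*u:=-\operatorname{div}(\bm{a}(x,\nabla u))+f(x,u)+g(x,u)|\nabla u|^\sigma$. "Increasing in $t$" means strictly increasing in $t$ for every $x\in\Omega$. The inequality $Q^*u\le Q^*v$ in $\Omega$ means $$\int_\Omega(\bm{a}(x,\nabla u)-\bm{a}(x,\nabla v))\cdot\nabla\varphi\le\int_\Omega\big(f(x,v)+g(x,v)|\nabla v|^\sigma-f(x,u)-g(x,u)|\nabla u|^\sigma\big)\varphi$$ for all $\varphi\in C^1_c(\Omega)$ with $\varphi\ge0$; whenever this is used it is understood that $|\bm{a}(x,\nabla u)|,|\bm{a}(x,\nabla v)|,f(x,u),f(x,v)\in L^1_{loc}(\Omega)$, so that the integrals are well defined and the inequality may be used with non-negative test functions $\varphi\in W^{1,p}(\Omega)$ of compact support in $\Omega$. "$u\le v$ in $\Omega$" means a.e.; "$u\le v$ on $\partial\Omega$" means $\limsup_{x\to\partial\Omega}(u(x)-v(x))\le0$. *)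

theory Defs
  imports "HOL-Analysis.Analysis"
begin

definition test_fn :: "('a::euclidean_space) set \<Rightarrow> ('a \<Rightarrow> real) \<Rightarrow> ('a \<Rightarrow> 'a) \<Rightarrow> bool" where
  "test_fn \<Omega> \<phi> D\<phi> \<longleftrightarrow>
     continuous_on UNIV D\<phi> \<and>
     (\<forall>x. (\<phi> has_derivative (\<lambda>h. D\<phi> x \<bullet> h)) (at x)) \<and>
     compact (closure {x. \<phi> x \<noteq> 0}) \<and> closure {x. \<phi> x \<noteq> 0} \<subseteq> \<Omega>"

definition loc_ess_bdd :: "('a::euclidean_space) set \<Rightarrow> ('a \<Rightarrow> 'b::euclidean_space) \<Rightarrow> bool" where
  "loc_ess_bdd \<Omega> u \<longleftrightarrow>
     u \<in> borel_measurable (lebesgue_on \<Omega>) \<and>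
     (\<forall>K. compact K \<and> K \<subseteq> \<Omega> \<longrightarrow> (\<exists>C. AE x in lebesgue. x \<in> K \<longrightarrow> norm (u x) \<le> C))"

definition weak_grad :: "('a::euclidean_space) set \<Rightarrow> ('a \<Rightarrow> real) \<Rightarrow> ('a \<Rightarrow> 'a) \<Rightarrow> bool" where
  "weak_grad \<Omega> u Du \<longleftrightarrow>
     (\<forall>\<phi> D\<phi>. test_fn \<Omega> \<phi> D\<phi> \<longrightarrow>
        (LINT x|lebesgue. u x *\<^sub>R D\<phi> x) = - (LINT x|lebesgue. \<phi> x *\<^sub>R Du x))"

definition W1inf_loc :: "('a::euclidean_space) set \<Rightarrow> ('a \<Rightarrow> real) \<Rightarrow> ('a \<Rightarrow> 'a) \<Rightarrow> bool" where
  "W1inf_loc \<Omega> u Du \<longleftrightarrow> loc_ess_bdd \<Omega> u \<and> loc_ess_bdd \<Omega> Du \<and> weak_grad \<Omega> u Du"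

definition loc_integrable :: "('a::euclidean_space) set \<Rightarrow> ('a \<Rightarrow> 'b::euclidean_space) \<Rightarrow> bool" where
  "loc_integrable \<Omega> w \<longleftrightarrow> (\<forall>K. compact K \<and> K \<subseteq> \<Omega> \<longrightarrow> set_integrable lebesgue K w)"

definition Qstar_le ::
  "('a::euclidean_space) set \<Rightarrow> ('a \<Rightarrow> 'a \<Rightarrow> 'a) \<Rightarrow> ('a \<Rightarrow> real \<Rightarrow> real) \<Rightarrow> ('a \<Rightarrow> real \<Rightarrow> real)
    \<Rightarrow> real \<Rightarrow> ('a \<Rightarrow> real) \<Rightarrow> ('a \<Rightarrow> 'a) \<Rightarrow> ('a \<Rightarrow> real) \<Rightarrow> ('a \<Rightarrow> 'a) \<Rightarrow> bool" where
  "Qstar_le \<Omega> a f g \<sigma> u Du v Dv \<longleftrightarrow>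
     loc_integrable \<Omega> (\<lambda>x. norm (a x (Du x))) \<and> loc_integrable \<Omega> (\<lambda>x. norm (a x (Dv x))) \<and>
     loc_integrable \<Omega> (\<lambda>x. f x (u x)) \<and> loc_integrable \<Omega> (\<lambda>x. f x (v x)) \<and>
     (\<forall>\<phi> D\<phi>. test_fn \<Omega> \<phi> D\<phi> \<and> (\<forall>x. 0 \<le> \<phi> x) \<longrightarrow>
        (LINT x|lebesgue. (a x (Du x) - a x (Dv x)) \<bullet> D\<phi> x)
        \<le> (LINT x|lebesgue. (f x (v x) + g x (v x) * norm (Dv x) powr \<sigma>
                              - f x (u x) - g x (u x) * norm (Du x) powr \<sigma>) * \<phi> x))"

text \<open>u \<le> v on the boundary: limsup of (u - v) as x \<rightarrow> boundary of Omega is \<le> 0.\<close>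
definition bdry_le :: "('a::euclidean_space) set \<Rightarrow> ('a \<Rightarrow> real) \<Rightarrow> ('a \<Rightarrow> real) \<Rightarrow> bool" where
  "bdry_le \<Omega> u v \<longleftrightarrow>
     (\<forall>\<epsilon>>0. \<exists>\<delta>>0. \<forall>x\<in>\<Omega>. infdist x (frontier \<Omega>) < \<delta> \<longrightarrow> u x - v x \<le> \<epsilon>)"

end

theory Submission
  imports Defs
begin

text \<open>
  Put \<open>w = u - v\<close>, \<open>W = Du - Dv\<close> and suppose that the essential supremum \<open>M\<close> of \<open>w\<close> is positive.
  For a level \<open>k\<close> slightly below \<open>M\<close> let \<open>s\<close> be the positive part of \<open>w - k\<close>; it has compact
  support because \<open>u \<le> v\<close> on the boundary. Testing with a mollification of \<open>s ^ 3\<close>, and using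
  that the lower order terms are at most \<open>C * norm W\<close> where \<open>w \<ge> k\<close>, gives
  \<open>3 c \<integral> norm W ^ 2 * s ^ 2 \<le> C \<integral> norm W * s ^ 3\<close>. By Young's inequality the function
  \<open>z = s ^ 2\<close>, with gradient \<open>Dz = 2 s W\<close>, satisfies \<open>\<integral> norm Dz ^ 2 \<le> C' \<integral> z ^ 2\<close>, where the
  last integral is over \<open>S = {w > k, W \<noteq> 0}\<close>.

  The energy inequality also forces \<open>W = 0\<close> almost everywhere on \<open>{w = M}\<close>, so the measure of
  \<open>S\<close> tends to \<open>0\<close> as \<open>k\<close> tends to \<open>M\<close>. The contradiction needs no Sobolev embedding: comparing
  \<open>z\<close> with its translates \<open>z (x + h)\<close> and averaging over \<open>h\<close> in a ball of radius \<open>r\<close> bounds the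
  integral of \<open>z ^ 2\<close> over \<open>S\<close> by \<open>2 r ^ 2 \<integral> norm Dz ^ 2\<close> plus a multiple, depending on \<open>r\<close>, of
  the measure of \<open>S\<close> times \<open>\<integral> z ^ 2\<close>, and the last integral is controlled by Poincare's inequality.
\<close>

section \<open>Functional inequalities for test functions\<close>

text \<open>The weight \<open>(1 + norm \<xi> + norm \<eta>) powr (p - 2)\<close> decays for large
  gradients, but on a compact set the gradients are essentially bounded, so there the operator is
  uniformly elliptic. One obstacle is that the inequality admits only C^1 test functions, while
  \<open>s\<close> is a truncation of a Sobolev function. Truncation is therefore applied to
  mollifications of \<open>w\<close>, with a power high enough to stay C^1. Testing with
  \<open>s ^ m\<close> goes together with \<open>z = s ^ ((m + 1) / 2)\<close>, and
  \<open>m = 3\<close> is the first odd exponent for which both are C^1. A second obstacle is that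
  \<open>{w > k}\<close> need not become small as \<open>k\<close> tends to \<open>M\<close>, since
  \<open>w\<close> may equal \<open>M\<close> on a set of positive measure. The bound
  \<open>C * norm W\<close> must therefore carry no additive constant: only then is
  \<open>z ^ 2\<close> integrated over points with \<open>W \<noteq> 0\<close>. For
  \<open>\<sigma> < 1\<close> such a constant does appear, and the strict growth of \<open>f\<close>
  pays for it. Everything is done above a fixed level \<open>k\<^sub>0 > 0\<close>, which fixes one
  compact set and all constants before \<open>k\<close> is chosen; \<open>k\<^sub>0\<close> tends to
  0 only at the very end.\<close>

lemma test_fn_vanishes:
  assumes "test_fn \<Omega> \<phi> D\<phi>" "x \<notin> closure {x. \<phi> x \<noteq> 0}"
  shows "\<phi> x = 0" "D\<phi> x = 0"
proof -
  show "\<phi> x = 0"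
    using assms(2) closure_subset[of "{x. \<phi> x \<noteq> 0}"] by auto
  have "(\<phi> has_derivative (\<lambda>h. D\<phi> x \<bullet> h)) (at x)"
    using assms(1) by (simp add: test_fn_def)
  moreover have "(\<phi> has_derivative (\<lambda>h. 0)) (at x)"
  proof (rule has_derivative_transform_within_open)
    show "((\<lambda>x. 0) has_derivative (\<lambda>h. 0)) (at x)"
      by simp
    show "open (- closure {x. \<phi> x \<noteq> 0})"
      by auto
    show "0 = \<phi> y" if "y \<in> - closure {x. \<phi> x \<noteq> 0}" for y
      using that closure_subset[of "{x. \<phi> x \<noteq> 0}"] by auto
  qed (use assms(2) in auto)
  ultimately have "(\<lambda>h. D\<phi> x \<bullet> h) = (\<lambda>h. 0)"
    by (rule has_derivative_unique)
  from fun_cong[OF this, of "D\<phi> x"] have "D\<phi> x \<bullet> D\<phi> x = 0" .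
  then show "D\<phi> x = 0"
    by simp
qed

lemma test_fn_continuous:
  assumes "test_fn \<Omega> \<phi> D\<phi>"
  shows "continuous_on UNIV \<phi>" "continuous_on UNIV D\<phi>"
  using assms unfolding test_fn_def
  by (auto intro!: continuous_at_imp_continuous_on has_derivative_continuous)

lemma test_fn_measurable:
  assumes "test_fn \<Omega> \<phi> D\<phi>"
  shows "\<phi> \<in> borel_measurable borel" "D\<phi> \<in> borel_measurable borel"
  using test_fn_continuous[OF assms] by (auto intro: borel_measurable_continuous_onI)

lemma nn_integral_lborel_translate:
  fixes h :: "'a::euclidean_space"
  assumes [measurable]: "F \<in> borel_measurable borel"
  shows "(\<integral>\<^sup>+x. F (x + h) \<partial>lborel) = (\<integral>\<^sup>+x. F x \<partial>lborel)"
proof -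
  have "(\<integral>\<^sup>+x. F x \<partial>lborel) = (\<integral>\<^sup>+x. F x \<partial>distr lborel borel ((+) h))"
    by (simp add: lborel_distr_plus)
  also have "\<dots> = (\<integral>\<^sup>+x. F (x + h) \<partial>lborel)"
    by (subst nn_integral_distr) (auto simp: add.commute)
  finally show ?thesis ..
qed

text \<open>The increment is the mean over [0,1] of the derivative \<open>q\<close> along the
  segment, so this is Jensen's inequality for the square followed by Cauchy-Schwarz.\<close>

lemma increment_sq_le_segment_integral:
  fixes h :: "'a::euclidean_space"
  assumes z: "test_fn \<Omega> z Dz"
  shows "ennreal ((z (x + h) - z x)\<^sup>2) \<le>
    (\<integral>\<^sup>+t. indicator {0..1} t * ennreal ((norm h)\<^sup>2 * (norm (Dz (x + t *\<^sub>R h)))\<^sup>2) \<partial>(lborel :: real measure))"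
proof -
  define q where "q t = Dz (x + t *\<^sub>R h) \<bullet> h" for t :: real
  define m where "m = z (x + h) - z x"
  have cont: "continuous_on S q" for S
    unfolding q_def
    by (intro continuous_intros continuous_on_compose2[OF test_fn_continuous(2)[OF z]]) auto
  have "(q has_integral z (x + 1 *\<^sub>R h) - z (x + 0 *\<^sub>R h)) {0..1}"
  proof (rule fundamental_theorem_of_calculus)
    fix t :: real
    have "(z has_derivative (\<lambda>k. Dz (x + t *\<^sub>R h) \<bullet> k)) (at (x + t *\<^sub>R h))"
      using z by (simp add: test_fn_def)
    then have "((\<lambda>t. z (x + t *\<^sub>R h)) has_derivative (\<lambda>k. Dz (x + t *\<^sub>R h) \<bullet> (k *\<^sub>R h))) (at t within {0..1})"
      by (rule has_derivative_compose[rotated]) (auto intro!: derivative_eq_intros)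
    then show "((\<lambda>t. z (x + t *\<^sub>R h)) has_vector_derivative q t) (at t within {0..1})"
      by (simp add: has_vector_derivative_def q_def)
  qed auto
  then have hq: "(q has_integral m) {0..1}"
    by (simp add: m_def)
  have "(\<lambda>t. (q t)\<^sup>2) integrable_on {0..1}"
    by (intro integrable_continuous_real continuous_intros cont)
  then obtain J where J: "((\<lambda>t. (q t)\<^sup>2) has_integral J) {0..1}"
    by blast
  \<comment> \<open>Jensen in elementary form: \<open>(q t - m) ^ 2\<close> is non-negative, and its
    integral is \<open>J - m ^ 2\<close> because \<open>q\<close> has integral
    \<open>m\<close>.\<close>
  have "((\<lambda>t. (q t)\<^sup>2 - 2 * m * q t + m\<^sup>2) has_integral (J - 2 * m * m + m\<^sup>2)) {0..1}"
    using has_integral_const_real[of "m\<^sup>2" 0 1]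
    by (intro has_integral_add has_integral_diff has_integral_mult_right J hq) auto
  then have "0 \<le> J - 2 * m * m + m\<^sup>2"
  proof (rule has_integral_nonneg)
    show "0 \<le> (q t)\<^sup>2 - 2 * m * q t + m\<^sup>2" for t
      using zero_le_power2[of "q t - m"] by (simp add: power2_diff mult.commute mult.left_commute)
  qed
  then have "m\<^sup>2 \<le> J"
    by (simp add: power2_eq_square)
  then have "ennreal (m\<^sup>2) \<le> ennreal J"
    by (rule ennreal_leI)
  also have "ennreal J = (\<integral>\<^sup>+t. indicator {0..1} t * ennreal ((q t)\<^sup>2) \<partial>lborel)"
  proof -
    have "(\<integral>\<^sup>+t. ennreal (indicator {0..1} t * (q t)\<^sup>2) \<partial>lborel) = ennreal J"
      by (rule nn_integral_has_integral_lebesgue) (use J in auto)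
    then show ?thesis
      by (simp add: ennreal_mult' ennreal_indicator)
  qed
  also have "\<dots> \<le> (\<integral>\<^sup>+t. indicator {0..1} t * ennreal ((norm h)\<^sup>2 * (norm (Dz (x + t *\<^sub>R h)))\<^sup>2) \<partial>lborel)"
  proof (intro nn_integral_mono mult_left_mono ennreal_leI)
    fix t
    have "\<bar>q t\<bar> \<le> norm (Dz (x + t *\<^sub>R h)) * norm h"
      unfolding q_def by (rule Cauchy_Schwarz_ineq2)
    then have "(q t)\<^sup>2 \<le> (norm (Dz (x + t *\<^sub>R h)) * norm h)\<^sup>2"
      by (meson abs_le_square_iff abs_ge_self order_trans)
    then show "(q t)\<^sup>2 \<le> (norm h)\<^sup>2 * (norm (Dz (x + t *\<^sub>R h)))\<^sup>2"
      by (simp add: power_mult_distrib mult.commute)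
  qed auto
  finally show ?thesis
    by (simp add: m_def)
qed

text \<open>Integrate the pointwise bound over \<open>x\<close> and exchange the integrals: for each
  \<open>t\<close> the shift by \<open>t *\<^sub>R h\<close> leaves the integral of
  \<open>norm (Dz x) ^ 2\<close> unchanged.\<close>

lemma translation_estimate:
  fixes h :: "'a::euclidean_space"
  assumes z: "test_fn \<Omega> z Dz"
  shows "(\<integral>\<^sup>+x. ennreal ((z (x + h) - z x)\<^sup>2) \<partial>lborel)
     \<le> ennreal ((norm h)\<^sup>2) * (\<integral>\<^sup>+x. ennreal ((norm (Dz x))\<^sup>2) \<partial>lborel)"
proof -
  note [measurable] = test_fn_measurable[OF z]
  have "(\<integral>\<^sup>+x. ennreal ((z (x + h) - z x)\<^sup>2) \<partial>lborel) \<le>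
    (\<integral>\<^sup>+x. (\<integral>\<^sup>+t. indicator {0..1} t * ennreal ((norm h)\<^sup>2 * (norm (Dz (x + t *\<^sub>R h)))\<^sup>2) \<partial>(lborel :: real measure)) \<partial>lborel)"
    by (intro nn_integral_mono increment_sq_le_segment_integral[OF z])
  also have "\<dots> = (\<integral>\<^sup>+t. (\<integral>\<^sup>+x. indicator {0..1} t * ennreal ((norm h)\<^sup>2 * (norm (Dz (x + t *\<^sub>R h)))\<^sup>2) \<partial>lborel) \<partial>(lborel :: real measure))"
    by (rule lborel_pair.Fubini'[symmetric]) simp
  also have "\<dots> = (\<integral>\<^sup>+t. (ennreal ((norm h)\<^sup>2) * (\<integral>\<^sup>+x. ennreal ((norm (Dz x))\<^sup>2) \<partial>lborel)) * indicator {0..1} t \<partial>(lborel :: real measure))"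
  proof (intro nn_integral_cong)
    fix t :: real
    have "(\<integral>\<^sup>+x. ennreal ((norm (Dz (x + t *\<^sub>R h)))\<^sup>2) \<partial>lborel) = (\<integral>\<^sup>+x. ennreal ((norm (Dz x))\<^sup>2) \<partial>lborel)"
      by (rule nn_integral_lborel_translate) simp
    then show "(\<integral>\<^sup>+x. indicator {0..1} t * ennreal ((norm h)\<^sup>2 * (norm (Dz (x + t *\<^sub>R h)))\<^sup>2) \<partial>lborel)
      = (ennreal ((norm h)\<^sup>2) * (\<integral>\<^sup>+x. ennreal ((norm (Dz x))\<^sup>2) \<partial>lborel)) * indicator {0..1} t"
      by (simp add: nn_integral_cmult ennreal_mult' mult.commute)
  qed
  also have "\<dots> = ennreal ((norm h)\<^sup>2) * (\<integral>\<^sup>+x. ennreal ((norm (Dz x))\<^sup>2) \<partial>lborel)"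
    by (subst nn_integral_cmult_indicator) auto
  finally show ?thesis .
qed

text \<open>Translating by more than the diameter of the support separates the two copies of \<open>z\<close>.\<close>

lemma poincare_inequality:
  fixes z :: "'a::euclidean_space \<Rightarrow> real"
  assumes z: "test_fn \<Omega> z Dz" and supp: "\<And>x. z x \<noteq> 0 \<Longrightarrow> norm x \<le> R" and R: "0 < R"
  shows "(\<integral>\<^sup>+x. ennreal ((z x)\<^sup>2) \<partial>lborel)
     \<le> ennreal (9 * R\<^sup>2) * (\<integral>\<^sup>+x. ennreal ((norm (Dz x))\<^sup>2) \<partial>lborel)"
proof -
  note [measurable] = test_fn_measurable[OF z]
  obtain b :: 'a where b: "b \<in> Basis"
    using nonempty_Basis by blast
  define h where "h = (3 * R) *\<^sub>R b"
  have nh: "norm h = 3 * R"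
    using b R by (simp add: h_def)
  have "(\<integral>\<^sup>+x. ennreal ((z x)\<^sup>2) \<partial>lborel) \<le> (\<integral>\<^sup>+x. ennreal ((z (x + h) - z x)\<^sup>2) \<partial>lborel)"
  proof (intro nn_integral_mono ennreal_leI)
    fix x
    show "(z x)\<^sup>2 \<le> (z (x + h) - z x)\<^sup>2"
    proof (cases "z x = 0")
      case False
      have "z (x + h) = 0"
      proof (rule ccontr)
        assume "z (x + h) \<noteq> 0"
        then have "norm (x + h) \<le> R" "norm x \<le> R"
          using supp False by auto
        moreover have "norm h \<le> norm (x + h) + norm x"
          using norm_triangle_ineq4[of "x + h" x] by simp
        ultimately show False
          using nh R by simp
      qed
      then show ?thesis by simp
    qed simp
  qed
  also have "\<dots> \<le> ennreal ((norm h)\<^sup>2) * (\<integral>\<^sup>+x. ennreal ((norm (Dz x))\<^sup>2) \<partial>lborel)"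
    by (rule translation_estimate[OF z])
  finally show ?thesis
    by (simp add: nh power_mult_distrib)
qed

text \<open>A single shift \<open>h\<close> leaves the integral of \<open>z (x + h) ^ 2\<close> over
  \<open>S\<close>, on which nothing is known. Averaging over \<open>h\<close> and exchanging the
  integrals turns it into the measure of \<open>S\<close> times the full integral of
  \<open>z ^ 2\<close>, which is where smallness of \<open>S\<close> begins to count.\<close>

lemma L2_on_set_le_by_averaging:
  fixes z :: "'a::euclidean_space \<Rightarrow> real"
  assumes z: "test_fn \<Omega> z Dz" and S [measurable]: "S \<in> sets borel"
  shows "emeasure lborel (ball 0 r :: 'a set) * (\<integral>\<^sup>+x. indicator S x * ennreal ((z x)\<^sup>2) \<partial>lborel)
     \<le> emeasure lborel (ball 0 r :: 'a set) * (ennreal (2 * r\<^sup>2) * (\<integral>\<^sup>+x. ennreal ((norm (Dz x))\<^sup>2) \<partial>lborel))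
       + 2 * (emeasure lborel S * (\<integral>\<^sup>+x. ennreal ((z x)\<^sup>2) \<partial>lborel))"
proof -
  note [measurable] = test_fn_measurable[OF z]
  let ?B = "ball 0 r :: 'a set"
  let ?I = "\<integral>\<^sup>+x. indicator S x * ennreal ((z x)\<^sup>2) \<partial>lborel"
  let ?D = "\<integral>\<^sup>+x. ennreal ((norm (Dz x))\<^sup>2) \<partial>lborel"
  let ?Z = "\<integral>\<^sup>+x. ennreal ((z x)\<^sup>2) \<partial>lborel"
  have one: "?I \<le> ennreal (2 * r\<^sup>2) * ?D + 2 * (\<integral>\<^sup>+x. indicator S x * ennreal ((z (x + h))\<^sup>2) \<partial>lborel)"
    if h: "h \<in> ?B" for h
  proof -
    have "?I \<le> (\<integral>\<^sup>+x. 2 * ennreal ((z (x + h) - z x)\<^sup>2) + 2 * (indicator S x * ennreal ((z (x + h))\<^sup>2)) \<partial>lborel)"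
    proof (rule nn_integral_mono)
      fix x
      \<comment> \<open>The difference of the two sides is
        \<open>(2 * z (x + h) - z x) ^ 2\<close>.\<close>
      have "(z x)\<^sup>2 \<le> 2 * (z (x + h) - z x)\<^sup>2 + 2 * (z (x + h))\<^sup>2"
        using zero_le_power2[of "2 * z (x + h) - z x"] by (simp add: power2_eq_square algebra_simps)
      then have "ennreal ((z x)\<^sup>2) \<le> 2 * ennreal ((z (x + h) - z x)\<^sup>2) + 2 * ennreal ((z (x + h))\<^sup>2)"
        by (drule_tac ennreal_leI) (simp add: ennreal_mult)
      then show "indicator S x * ennreal ((z x)\<^sup>2) \<le> 2 * ennreal ((z (x + h) - z x)\<^sup>2) + 2 * (indicator S x * ennreal ((z (x + h))\<^sup>2))"
        by (auto split: split_indicator)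
    qed
    also have "\<dots> = 2 * (\<integral>\<^sup>+x. ennreal ((z (x + h) - z x)\<^sup>2) \<partial>lborel) + 2 * (\<integral>\<^sup>+x. indicator S x * ennreal ((z (x + h))\<^sup>2) \<partial>lborel)"
      by (simp add: nn_integral_add nn_integral_cmult)
    also have "2 * (\<integral>\<^sup>+x. ennreal ((z (x + h) - z x)\<^sup>2) \<partial>lborel) \<le> 2 * (ennreal ((norm h)\<^sup>2) * ?D)"
      by (intro mult_left_mono translation_estimate[OF z]) auto
    also have "\<dots> \<le> 2 * (ennreal (r\<^sup>2) * ?D)"
      using h by (intro mult_left_mono mult_right_mono ennreal_leI power_mono) auto
    also have "\<dots> = ennreal (2 * r\<^sup>2) * ?D"
      by (simp add: ennreal_mult mult.assoc)
    finally show ?thesis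
      by (simp add: add_right_mono)
  qed
  have "emeasure lborel ?B * ?I = (\<integral>\<^sup>+h. ?I * indicator ?B h \<partial>lborel)"
    by (subst nn_integral_cmult_indicator) (auto simp: mult.commute)
  \<comment> \<open>Only the first summand keeps the indicator of the ball. In the second the
    integral over \<open>h\<close> is enlarged to the whole space, so that after the exchange it no
    longer depends on \<open>x\<close>.\<close>
  also have "\<dots> \<le> (\<integral>\<^sup>+h. (ennreal (2 * r\<^sup>2) * ?D) * indicator ?B h
      + 2 * (\<integral>\<^sup>+x. indicator S x * ennreal ((z (x + h))\<^sup>2) \<partial>lborel) \<partial>lborel)"
    by (intro nn_integral_mono) (use one in \<open>auto split: split_indicator\<close>)
  also have "\<dots> = emeasure lborel ?B * (ennreal (2 * r\<^sup>2) * ?D)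
      + 2 * (\<integral>\<^sup>+h. (\<integral>\<^sup>+x. indicator S x * ennreal ((z (x + h))\<^sup>2) \<partial>lborel) \<partial>lborel)"
  proof (subst nn_integral_add)
    show "(\<lambda>h. c * indicator ?B h) \<in> borel_measurable lborel" for c :: ennreal
      by (intro borel_measurable_times_ennreal borel_measurable_indicator) auto
  qed (auto simp: nn_integral_cmult nn_integral_cmult_indicator mult.commute[of _ "emeasure lborel ?B"])
  also have "(\<integral>\<^sup>+h. (\<integral>\<^sup>+x. indicator S x * ennreal ((z (x + h))\<^sup>2) \<partial>lborel) \<partial>lborel)
     = (\<integral>\<^sup>+x. (\<integral>\<^sup>+h. indicator S x * ennreal ((z (x + h))\<^sup>2) \<partial>lborel) \<partial>lborel)"
    by (rule lborel_pair.Fubini') simp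
  also have "\<dots> = (\<integral>\<^sup>+x. ?Z * indicator S x \<partial>lborel)"
  proof (rule nn_integral_cong)
    fix x
    have "(\<integral>\<^sup>+h. ennreal ((z (x + h))\<^sup>2) \<partial>lborel) = ?Z"
      using nn_integral_lborel_translate[of "\<lambda>y. ennreal ((z y)\<^sup>2)" x] by (simp add: add.commute)
    then show "(\<integral>\<^sup>+h. indicator S x * ennreal ((z (x + h))\<^sup>2) \<partial>lborel) = ?Z * indicator S x"
      by (simp add: nn_integral_cmult mult.commute)
  qed
  also have "\<dots> = emeasure lborel S * ?Z"
    by (simp add: nn_integral_cmult_indicator mult.commute[of "emeasure lborel S"])
  finally show ?thesis .
qed

text \<open>Averaging combined with Poincare's inequality. The radius \<open>r\<close> makes the
  gradient term at most half of \<open>\<epsilon>\<close>, then \<open>\<kappa>\<close> does the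
  same for the remainder. Since \<open>\<kappa>\<close> is chosen before \<open>S\<close> and
  \<open>z\<close>, it serves all levels and all approximations at once.\<close>

lemma L2_on_small_sets:
  fixes R \<epsilon> :: real
  assumes "0 < R" "0 < \<epsilon>"
  shows "\<exists>\<kappa>>0. \<forall>S \<Omega> (z :: 'a::euclidean_space \<Rightarrow> real) Dz.
      S \<in> sets borel \<and> emeasure lborel S \<le> ennreal \<kappa> \<and> test_fn \<Omega> z Dz \<and> (\<forall>x. z x \<noteq> 0 \<longrightarrow> norm x \<le> R) \<longrightarrow>
       (\<integral>\<^sup>+x. indicator S x * ennreal ((z x)\<^sup>2) \<partial>lborel)
         \<le> ennreal \<epsilon> * (\<integral>\<^sup>+x. ennreal ((norm (Dz x))\<^sup>2) \<partial>lborel)"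
proof -
  define r where "r = sqrt (\<epsilon> / 4)"
  have r: "0 < r" "2 * r\<^sup>2 = \<epsilon> / 2"
    using assms by (auto simp: r_def)
  define b where "b = measure lborel (ball 0 r :: 'a set)"
  have eb: "emeasure lborel (ball 0 r :: 'a set) = ennreal b"
    unfolding b_def using emeasure_lborel_ball_finite[of "0::'a" r]
    by (intro emeasure_eq_ennreal_measure) auto
  have b: "0 < b"
    unfolding b_def using r content_ball_pos by (simp add: measure_def)
  \<comment> \<open>Solves \<open>2 * \<kappa> * (9 * R ^ 2) = b * \<epsilon> / 2\<close>, where
    \<open>9 * R ^ 2\<close> is the Poincare constant.\<close>
  define \<kappa> where "\<kappa> = b * \<epsilon> / (36 * R\<^sup>2)"
  have \<kappa>: "0 < \<kappa>"
    using b assms by (simp add: \<kappa>_def)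
  show ?thesis
  proof (intro exI[of _ \<kappa>] conjI \<kappa> allI impI)
    fix S :: "'a set" and \<Omega> and z :: "'a \<Rightarrow> real" and Dz
    assume "S \<in> sets borel \<and> emeasure lborel S \<le> ennreal \<kappa> \<and> test_fn \<Omega> z Dz \<and> (\<forall>x. z x \<noteq> 0 \<longrightarrow> norm x \<le> R)"
    then have S: "S \<in> sets borel" "emeasure lborel S \<le> ennreal \<kappa>" and z: "test_fn \<Omega> z Dz"
      and supp: "\<And>x. z x \<noteq> 0 \<Longrightarrow> norm x \<le> R"
      by auto
    let ?I = "\<integral>\<^sup>+x. indicator S x * ennreal ((z x)\<^sup>2) \<partial>lborel"
    let ?D = "\<integral>\<^sup>+x. ennreal ((norm (Dz x))\<^sup>2) \<partial>lborel"
    let ?Z = "\<integral>\<^sup>+x. ennreal ((z x)\<^sup>2) \<partial>lborel"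
    have "ennreal b * ?I \<le> ennreal b * (ennreal (2 * r\<^sup>2) * ?D) + 2 * (emeasure lborel S * ?Z)"
      using L2_on_set_le_by_averaging[OF z S(1), of r] by (simp add: eb)
    also have "2 * (emeasure lborel S * ?Z) \<le> 2 * (ennreal \<kappa> * (ennreal (9 * R\<^sup>2) * ?D))"
      by (intro mult_left_mono mult_mono S poincare_inequality[OF z supp \<open>0 < R\<close>]) auto
    also have "\<dots> = ennreal (2 * (\<kappa> * (9 * R\<^sup>2))) * ?D"
      using \<kappa> by (subst ennreal_mult, simp, simp, subst ennreal_mult) (auto simp: mult.assoc)
    also have "2 * (\<kappa> * (9 * R\<^sup>2)) = b * (\<epsilon> / 2)"
      using assms by (simp add: \<kappa>_def)
    also have "ennreal b * (ennreal (2 * r\<^sup>2) * ?D) + ennreal (b * (\<epsilon> / 2)) * ?D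
       = ennreal b * (ennreal (\<epsilon> / 2) * ?D) + ennreal b * (ennreal (\<epsilon> / 2) * ?D)"
      unfolding r(2) using b assms by (subst ennreal_mult[of b "\<epsilon> / 2"]) (auto simp: mult.assoc)
    also have "\<dots> = ennreal b * ((ennreal (\<epsilon> / 2) + ennreal (\<epsilon> / 2)) * ?D)"
      by (simp only: distrib_left distrib_right)
    also have "ennreal (\<epsilon> / 2) + ennreal (\<epsilon> / 2) = ennreal \<epsilon>"
      using assms by (subst ennreal_plus[symmetric]) auto
    finally have "ennreal b * ?I \<le> ennreal b * (ennreal \<epsilon> * ?D)"
      by (simp add: add_left_mono)
    then show "?I \<le> ennreal \<epsilon> * ?D"
      using b by (simp add: ennreal_mult_le_mult_iff)
  qed
qed

section \<open>Mollification\<close>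

lemma integrable_continuous_compact_support:
  fixes F :: "'a::euclidean_space \<Rightarrow> 'b::{banach, second_countable_topology}"
  assumes "continuous_on UNIV F" "compact K" "\<And>x. x \<notin> K \<Longrightarrow> F x = 0"
  shows "integrable lborel F"
proof -
  have "integrable lborel (\<lambda>x. indicator K x *\<^sub>R F x)"
    by (intro borel_integrable_compact assms continuous_on_subset[OF assms(1)]) auto
  moreover have "(\<lambda>x. indicator K x *\<^sub>R F x) = F"
    using assms(3) by (auto simp: fun_eq_iff indicator_def)
  ultimately show ?thesis by simp
qed

lemma test_fn_bounded:
  assumes \<phi>: "test_fn \<Omega> \<phi> D\<phi>"
  obtains C where "0 < C" "\<And>x. \<bar>\<phi> x\<bar> \<le> C" "\<And>x. norm (D\<phi> x) \<le> C"
proof -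
  let ?K = "closure {x. \<phi> x \<noteq> 0}"
  have K: "compact ?K"
    using \<phi> by (simp add: test_fn_def)
  have "bounded (\<phi> ` ?K)" "bounded (D\<phi> ` ?K)"
    by (intro compact_imp_bounded compact_continuous_image K continuous_on_subset[OF test_fn_continuous(1)[OF \<phi>]]
          continuous_on_subset[OF test_fn_continuous(2)[OF \<phi>]]; simp)+
  then obtain A B where A: "\<And>x. x \<in> ?K \<Longrightarrow> norm (\<phi> x) \<le> A" and B: "\<And>x. x \<in> ?K \<Longrightarrow> norm (D\<phi> x) \<le> B"
    by (auto simp: bounded_iff)
  show ?thesis
  proof (rule that[of "max 1 (max A B)"])
    fix x
    show "\<bar>\<phi> x\<bar> \<le> max 1 (max A B)"
      using A[of x] test_fn_vanishes(1)[OF \<phi>, of x] by (cases "x \<in> ?K") auto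
    show "norm (D\<phi> x) \<le> max 1 (max A B)"
      using B[of x] test_fn_vanishes(2)[OF \<phi>, of x] by (cases "x \<in> ?K") auto
  qed auto
qed

text \<open>Exponents from 2 upwards are the natural ones for which the power of the positive part
  is C^1 across 0. Exponent 2 serves the mollifier kernel and \<open>z\<close>, exponent 3 the test
  function in the weak inequality.\<close>

lemma has_real_derivative_max_0_power:
  "((\<lambda>t::real. max 0 t ^ Suc (Suc n)) has_real_derivative real (Suc (Suc n)) * max 0 t ^ Suc n) (at t)"
proof -
  consider "t > 0" | "t < 0" | "t = 0" by linarith
  then show ?thesis
  proof cases
    case 1
    have "((\<lambda>t::real. t ^ Suc (Suc n)) has_real_derivative real (Suc (Suc n)) * max 0 t ^ Suc n) (at t)"
      using DERIV_pow[of "Suc (Suc n)" t UNIV] 1 by (simp add: max_def del: power_Suc)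
    then show ?thesis
      by (rule has_field_derivative_transform_within_open[where S="{0<..}"]) (use 1 in auto)
  next
    case 2
    have "((\<lambda>t::real. 0) has_real_derivative real (Suc (Suc n)) * max 0 t ^ Suc n) (at t)"
      using 2 by (simp add: max_def)
    then show ?thesis
      by (rule has_field_derivative_transform_within_open[where S="{..<0}"]) (use 2 in auto)
  next
    case 3
    have "((\<lambda>h::real. max 0 h ^ Suc (Suc n) / h) \<longlongrightarrow> 0) (at 0)"
    proof (rule Lim_null_comparison)
      show "\<forall>\<^sub>F h::real in at 0. norm (max 0 h ^ Suc (Suc n) / h) \<le> \<bar>h\<bar> ^ Suc n"
        by (intro always_eventually) (auto simp: max_def mult_nonpos_nonneg)
      show "((\<lambda>h::real. \<bar>h\<bar> ^ Suc n) \<longlongrightarrow> 0) (at 0)"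
        by (rule tendsto_eq_intros refl | simp)+
    qed
    then show ?thesis
      using 3 by (simp add: DERIV_def)
  qed
qed

section \<open>Continuity and differentiation under the integral sign\<close>

lemma continuous_on_integral_parameter:
  fixes K :: "'a::euclidean_space \<Rightarrow> 'c \<Rightarrow> 'b::{banach, second_countable_topology}"
  assumes K: "\<And>x. K x \<in> borel_measurable M" and cont: "\<And>y. continuous_on UNIV (\<lambda>x. K x y)"
    and bound: "\<And>x y. norm (K x y) \<le> g y" and g: "integrable M g"
  shows "continuous_on UNIV (\<lambda>x. LINT y|M. K x y)"
proof (unfold continuous_on_sequentially, clarsimp simp: o_def)
  fix X :: "nat \<Rightarrow> 'a" and x
  assume X: "X \<longlonglongrightarrow> x"
  show "(\<lambda>n. LINT y|M. K (X n) y) \<longlonglongrightarrow> (LINT y|M. K x y)"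
  proof (rule integral_dominated_convergence[where w=g])
    show "AE y in M. (\<lambda>n. K (X n) y) \<longlonglongrightarrow> K x y"
    proof (rule AE_I2)
      fix y
      have "isCont (\<lambda>x. K x y) x"
        using cont by (simp add: continuous_on_eq_continuous_at)
      then show "(\<lambda>n. K (X n) y) \<longlonglongrightarrow> K x y"
        using X by (rule isCont_tendsto_compose)
    qed
  qed (use K bound g in auto)
qed

lemma has_derivative_integral_parameter:
  fixes K :: "'a::euclidean_space \<Rightarrow> 'c \<Rightarrow> real" and G :: "'a \<Rightarrow> 'c \<Rightarrow> 'a"
  assumes K: "\<And>x. integrable M (K x)" and G: "\<And>x. G x \<in> borel_measurable M"
    and deriv: "\<And>x y. ((\<lambda>x. K x y) has_derivative (\<lambda>h. G x y \<bullet> h)) (at x)"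
    and bound: "\<And>x y. norm (G x y) \<le> g y" and g: "integrable M g"
  shows "((\<lambda>x. LINT y|M. K x y) has_derivative (\<lambda>h. (LINT y|M. G x y) \<bullet> h)) (at x)"
proof -
  have iG: "integrable M (G x)"
  proof (rule Bochner_Integration.integrable_bound[OF g G])
    show "AE y in M. norm (G x y) \<le> norm (g y)"
      using order_trans[OF bound abs_ge_self] by simp
  qed
  define q where "q z y = (K z y - K x y - G x y \<bullet> (z - x)) / norm (z - x)" for z y
  have q_bound: "norm (q z y) \<le> 2 * g y" for z y
  proof (cases "z = x")
    case False
    have "norm (K z y - K x y) \<le> g y * norm (z - x)"
    proof (rule differentiable_bound[of UNIV "\<lambda>x. K x y" "\<lambda>x h. G x y \<bullet> h"])
      show "onorm (\<lambda>h. G x y \<bullet> h) \<le> g y" for x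
      proof (rule onorm_le)
        fix h
        have "norm (G x y \<bullet> h) \<le> norm (G x y) * norm h"
          by (simp add: Cauchy_Schwarz_ineq2)
        also have "\<dots> \<le> g y * norm h"
          by (intro mult_right_mono bound) auto
        finally show "norm (G x y \<bullet> h) \<le> g y * norm h" .
      qed
    qed (use deriv in auto)
    moreover have "norm (G x y \<bullet> (z - x)) \<le> g y * norm (z - x)"
      using Cauchy_Schwarz_ineq2[of "G x y" "z - x"] mult_right_mono[OF bound[of x y], of "norm (z - x)"]
      by simp
    ultimately have "norm (K z y - K x y - G x y \<bullet> (z - x)) \<le> 2 * g y * norm (z - x)"
      by (simp add: abs_le_iff)
    then show ?thesis
      using False by (simp add: q_def divide_simps)
  next
    case True
    then show ?thesis
      using order_trans[OF norm_ge_zero bound[of x y]] by (simp add: q_def)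
  qed
  have q_int: "((LINT y|M. K z y) - (LINT y|M. K x y) - (LINT y|M. G x y) \<bullet> (z - x)) / norm (z - x)
      = (LINT y|M. q z y)" for z
    unfolding q_def using K iG by simp
  have "((\<lambda>z. LINT y|M. q z y) \<longlongrightarrow> 0) (at x)"
    unfolding tendsto_at_iff_sequentially
  proof (intro allI impI)
    fix X :: "nat \<Rightarrow> 'a"
    assume X: "\<forall>i. X i \<in> UNIV - {x}" "X \<longlonglongrightarrow> x"
    have "(\<lambda>n. LINT y|M. q (X n) y) \<longlonglongrightarrow> (LINT y|M. 0)"
    proof (rule integral_dominated_convergence[where w="\<lambda>y. 2 * g y"])
      show "q (X n) \<in> borel_measurable M" for n
        unfolding q_def using borel_measurable_integrable[OF K] G by measurable
      show "AE y in M. (\<lambda>n. q (X n) y) \<longlonglongrightarrow> 0"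
      proof (rule AE_I2)
        fix y
        have "((\<lambda>z. q z y) \<longlongrightarrow> 0) (at x)"
          using deriv[of y x] unfolding has_derivative_def q_def by (simp add: divide_inverse_commute Lim_ident_at)
        then show "(\<lambda>n. q (X n) y) \<longlonglongrightarrow> 0"
          using X unfolding tendsto_at_iff_sequentially by (auto simp: o_def)
      qed
    qed (use q_bound g in auto)
    then show "((\<lambda>z. LINT y|M. q z y) \<circ> X) \<longlonglongrightarrow> 0"
      by (simp add: o_def)
  qed
  then show ?thesis
    unfolding has_derivative_def q_int[symmetric]
    by (auto simp: bounded_linear_inner_right divide_inverse_commute Lim_ident_at)
qed

section \<open>Mollifier kernels and the mollification operator\<close>

definition mollifier :: "real \<Rightarrow> ('a::euclidean_space \<Rightarrow> real) \<Rightarrow> ('a \<Rightarrow> 'a) \<Rightarrow> bool" where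
  "mollifier d \<rho> D\<rho> \<longleftrightarrow> test_fn UNIV \<rho> D\<rho> \<and> (\<forall>x. 0 \<le> \<rho> x) \<and> (\<forall>x. d < norm x \<longrightarrow> \<rho> x = 0) \<and>
     (\<forall>x. \<rho> (- x) = \<rho> x) \<and> integrable lborel \<rho> \<and> (LINT x|lborel. \<rho> x) = 1"

text \<open>The kernel is the normalised square of the positive part of
  \<open>d ^ 2 - x \<bullet> x\<close>. It is only C^1, which suffices because mollifications are
  differentiated once.\<close>

lemma mollifier_exists:
  fixes d :: real
  assumes d: "0 < d"
  shows "\<exists>(\<rho> :: 'a::euclidean_space \<Rightarrow> real) D\<rho>. mollifier d \<rho> D\<rho>"
proof -
  define \<rho>0 where "\<rho>0 x = max 0 (d\<^sup>2 - x \<bullet> x) ^ 2" for x :: 'a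
  define D0 where "D0 x = (- 4 * max 0 (d\<^sup>2 - x \<bullet> x)) *\<^sub>R x" for x :: 'a
  have pos_iff: "0 < d\<^sup>2 - x \<bullet> x \<longleftrightarrow> norm x < d" for x :: 'a
    using d norm_lt_square by (metis diff_gt_0_iff_gt power2_norm_eq_inner abs_norm_cancel abs_of_pos abs_square_less_1 real_sqrt_less_iff real_sqrt_abs)
  have zero: "\<rho>0 x = 0" if "d \<le> norm x" for x
    using pos_iff[of x] that by (simp add: \<rho>0_def)
  have supp: "{x. \<rho>0 x \<noteq> 0} \<subseteq> cball 0 d"
    using zero by force
  have deriv: "(\<rho>0 has_derivative (\<lambda>h. D0 x \<bullet> h)) (at x)" for x
  proof -
    have "((\<lambda>t::real. max 0 t ^ 2) has_real_derivative 2 * max 0 t) (at t)" for t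
      using has_real_derivative_max_0_power[of 0 t] by (simp add: numeral_2_eq_2)
    then have "((\<lambda>t::real. max 0 t ^ 2) has_derivative (*) (2 * max 0 t)) (at t)" for t
      by (simp add: has_field_derivative_def)
    then have "(\<rho>0 has_derivative (\<lambda>h. 2 * max 0 (d\<^sup>2 - x \<bullet> x) * (- (x \<bullet> h + h \<bullet> x)))) (at x)"
      unfolding \<rho>0_def
      by (rule has_derivative_compose[rotated]) (auto intro!: derivative_eq_intros)
    then show ?thesis
      by (rule has_derivative_eq_rhs) (auto simp: D0_def inner_commute)
  qed
  have cont: "continuous_on UNIV \<rho>0" "continuous_on UNIV D0"
    unfolding \<rho>0_def D0_def by (auto intro!: continuous_intros)
  have int: "integrable lborel \<rho>0"
    by (rule integrable_continuous_compact_support[OF cont(1), of "cball 0 d"]) (use zero in auto)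
  define c where "c = (LINT x|lborel. \<rho>0 x)"
  have "c \<noteq> 0"
  proof
    assume "c = 0"
    then have "AE x in lborel. \<rho>0 x = 0"
      using integral_nonneg_eq_0_iff_AE[OF int AE_I2] unfolding c_def by (simp add: \<rho>0_def[abs_def])
    then have "AE x in lborel. x \<notin> ball (0::'a) d"
    proof eventually_elim
      fix x assume "\<rho>0 x = 0"
      then show "x \<notin> ball 0 d"
        using pos_iff[of x] by (auto simp: \<rho>0_def max_def split: if_splits)
    qed
    then have "emeasure lborel (ball (0::'a) d) = 0"
      by (subst (asm) AE_iff_measurable[OF _ refl]) (auto simp: ball_def)
    then show False
      using content_ball_pos[OF d, of "0::'a"] by (simp add: measure_def)
  qed
  moreover have "0 \<le> c"
    unfolding c_def by (intro integral_nonneg_AE) (simp add: \<rho>0_def)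
  ultimately have c: "0 < c" by simp
  have cl: "compact (closure {x. \<rho>0 x / c \<noteq> 0})"
    using supp c by (intro compact_closure[THEN iffD2] bounded_subset[OF bounded_cball[of 0 d]]) auto
  have "mollifier d (\<lambda>x. \<rho>0 x / c) (\<lambda>x. D0 x /\<^sub>R c)"
    unfolding mollifier_def test_fn_def
  proof (intro conjI allI impI)
    show "continuous_on UNIV (\<lambda>x. D0 x /\<^sub>R c)"
      by (intro continuous_intros cont)
    show "((\<lambda>x. \<rho>0 x / c) has_derivative (\<lambda>h. (D0 x /\<^sub>R c) \<bullet> h)) (at x)" for x
      using has_derivative_mult_right[OF deriv[of x], of "inverse c"] by (simp add: divide_inverse_commute)
    show "0 \<le> \<rho>0 x / c" for x
      using c by (simp add: \<rho>0_def)
    show "\<rho>0 (- x) / c = \<rho>0 x / c" for x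
      by (simp add: \<rho>0_def)
    show "(LINT x|lborel. \<rho>0 x / c) = 1"
      using c by (simp add: c_def)
  qed (use cl zero int in auto)
  then show ?thesis by blast
qed

text \<open>The argument is \<open>y - x\<close> rather than \<open>x - y\<close>, so that the
  kernel is literally a translate of \<open>\<rho>\<close> and can be inserted as a test function
  into \<open>weak_grad\<close>. For an even kernel this is the usual convolution.\<close>

definition mollify :: "('a::euclidean_space \<Rightarrow> real) \<Rightarrow> ('a \<Rightarrow> 'b::euclidean_space) \<Rightarrow> 'a \<Rightarrow> 'b" where
  "mollify \<rho> F x = (LINT y|lebesgue. \<rho> (y - x) *\<^sub>R F y)"

lemma mollifier_measurable:
  assumes "mollifier d \<rho> D\<rho>"
  shows "\<rho> \<in> borel_measurable borel" "D\<rho> \<in> borel_measurable borel"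
    "(\<lambda>y. \<rho> (y - x)) \<in> borel_measurable lebesgue" "(\<lambda>y. D\<rho> (y - x)) \<in> borel_measurable lebesgue"
proof -
  show [measurable]: "\<rho> \<in> borel_measurable borel" "D\<rho> \<in> borel_measurable borel"
    using assms test_fn_measurable unfolding mollifier_def by blast+
  show "(\<lambda>y. \<rho> (y - x)) \<in> borel_measurable lebesgue" "(\<lambda>y. D\<rho> (y - x)) \<in> borel_measurable lebesgue"
    by (rule measurable_completion; simp)+
qed

lemma mollifier_integral_translate:
  fixes \<rho> :: "'a::euclidean_space \<Rightarrow> real"
  assumes "mollifier d \<rho> D\<rho>"
  shows "(\<integral>\<^sup>+y. ennreal (\<rho> (y - x)) \<partial>lborel) = 1"
    "integrable lebesgue (\<lambda>y. \<rho> (y - x))" "(LINT y|lebesgue. \<rho> (y - x)) = 1"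
proof -
  note [measurable] = mollifier_measurable[OF assms]
  have pos: "\<And>x. 0 \<le> \<rho> x" and int: "integrable lborel \<rho>" "(LINT x|lborel. \<rho> x) = 1"
    using assms by (auto simp: mollifier_def)
  have "(\<integral>\<^sup>+y. ennreal (\<rho> (y - x)) \<partial>lborel) = (\<integral>\<^sup>+y. ennreal (\<rho> y) \<partial>lborel)"
    using nn_integral_lborel_translate[of "\<lambda>y. ennreal (\<rho> y)" "- x"] by simp
  also have "\<dots> = 1"
    using nn_integral_eq_integral[OF int(1)] pos int(2) by simp
  finally show nn: "(\<integral>\<^sup>+y. ennreal (\<rho> (y - x)) \<partial>lborel) = 1" .
  then have nnL: "(\<integral>\<^sup>+y. ennreal (\<rho> (y - x)) \<partial>lebesgue) = 1"
    by (simp add: nn_integral_completion)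
  show "integrable lebesgue (\<lambda>y. \<rho> (y - x))"
    by (rule integrableI_nonneg) (use pos nnL in auto)
  show "(LINT y|lebesgue. \<rho> (y - x)) = 1"
    by (rule integral_eq_nn_integral[THEN trans]) (use pos nnL in auto)
qed

lemma mollify_integrable:
  fixes F :: "'a::euclidean_space \<Rightarrow> 'b::euclidean_space"
  assumes \<rho>: "mollifier d \<rho> D\<rho>" and F: "integrable lebesgue F"
  shows "integrable lebesgue (\<lambda>y. \<rho> (y - x) *\<^sub>R F y)"
proof -
  have t: "test_fn UNIV \<rho> D\<rho>" and pos: "\<And>x. 0 \<le> \<rho> x"
    using \<rho> by (auto simp: mollifier_def)
  obtain C where C: "0 < C" "\<And>x. \<bar>\<rho> x\<bar> \<le> C"
    using test_fn_bounded[OF t] by metis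
  note [measurable] = mollifier_measurable(3)[OF \<rho>] borel_measurable_integrable[OF F]
  show ?thesis
  proof (rule Bochner_Integration.integrable_bound)
    show "integrable lebesgue (\<lambda>y. C * norm (F y))"
      using F by simp
    show "AE y in lebesgue. norm (\<rho> (y - x) *\<^sub>R F y) \<le> norm (C * norm (F y))"
      using C by (auto intro!: mult_right_mono)
  qed measurable
qed

lemma norm_mollify_le:
  fixes F :: "'a::euclidean_space \<Rightarrow> 'b::euclidean_space"
  assumes \<rho>: "mollifier d \<rho> D\<rho>" and bound: "AE y in lebesgue. norm (y - x) \<le> d \<longrightarrow> norm (F y) \<le> m"
  shows "norm (mollify \<rho> F x) \<le> m"
proof (cases "integrable lebesgue (\<lambda>y. \<rho> (y - x) *\<^sub>R F y)")
  case True
  have "norm (mollify \<rho> F x) \<le> (LINT y|lebesgue. norm (\<rho> (y - x) *\<^sub>R F y))"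
    unfolding mollify_def by (rule integral_norm_bound)
  also have "\<dots> \<le> (LINT y|lebesgue. \<rho> (y - x) * m)"
  proof (rule integral_mono_AE)
    show "AE y in lebesgue. norm (\<rho> (y - x) *\<^sub>R F y) \<le> \<rho> (y - x) * m"
      using bound
    proof eventually_elim
      fix y assume y: "norm (y - x) \<le> d \<longrightarrow> norm (F y) \<le> m"
      have "\<rho> (y - x) = 0 \<or> norm (y - x) \<le> d" "0 \<le> \<rho> (y - x)"
        using \<rho> by (auto simp: mollifier_def not_less[symmetric])
      with y show "norm (\<rho> (y - x) *\<^sub>R F y) \<le> \<rho> (y - x) * m"
        by (auto intro: mult_left_mono)
    qed
    show "integrable lebesgue (\<lambda>y. norm (\<rho> (y - x) *\<^sub>R F y))"
      using True by (rule integrable_norm)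
  qed (use mollifier_integral_translate(2)[OF \<rho>] in auto)
  also have "\<dots> = m"
    using mollifier_integral_translate[OF \<rho>, of x] by simp
  finally show ?thesis .
next
  \<comment> \<open>The integral is now 0 by default and the claim reduces to
    \<open>0 \<le> m\<close>. For negative \<open>m\<close> the bound could hold at no point within
    distance \<open>d\<close> of \<open>x\<close>, so the kernel would vanish almost everywhere,
    against its total mass 1.\<close>
  case False
  have "0 \<le> m"
  proof (rule ccontr)
    assume m: "\<not> 0 \<le> m"
    from bound have "AE y in lebesgue. \<rho> (y - x) = 0"
    proof eventually_elim
      fix y assume "norm (y - x) \<le> d \<longrightarrow> norm (F y) \<le> m"
      then have "d < norm (y - x)"
        using m norm_ge_zero[of "F y"] by linarith
      then show "\<rho> (y - x) = 0"
        using \<rho> by (simp add: mollifier_def)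
    qed
    then have "(LINT y|lebesgue. \<rho> (y - x)) = 0"
      by (rule integral_eq_zero_AE)
    then show False
      using mollifier_integral_translate(3)[OF \<rho>, of x] by simp
  qed
  then show ?thesis
    by (simp add: mollify_def not_integrable_integral_eq[OF False])
qed

text \<open>One-sided, because off the compact set the boundary condition gives only an upper bound
  for \<open>w\<close>; this is what keeps the approximations below \<open>k\<^sub>0\<close>
  there.\<close>

lemma mollify_le:
  fixes F :: "'a::euclidean_space \<Rightarrow> real"
  assumes \<rho>: "mollifier d \<rho> D\<rho>" and F: "integrable lebesgue F"
    and bound: "AE y in lebesgue. norm (y - x) \<le> d \<longrightarrow> F y \<le> m"
  shows "mollify \<rho> F x \<le> m"
proof -
  have "mollify \<rho> F x \<le> (LINT y|lebesgue. \<rho> (y - x) * m)"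
    unfolding mollify_def
  proof (rule integral_mono_AE)
    show "AE y in lebesgue. \<rho> (y - x) *\<^sub>R F y \<le> \<rho> (y - x) * m"
      using bound
    proof eventually_elim
      fix y assume y: "norm (y - x) \<le> d \<longrightarrow> F y \<le> m"
      have "\<rho> (y - x) = 0 \<or> norm (y - x) \<le> d" "0 \<le> \<rho> (y - x)"
        using \<rho> by (auto simp: mollifier_def not_less[symmetric])
      with y show "\<rho> (y - x) *\<^sub>R F y \<le> \<rho> (y - x) * m"
        by (auto intro: mult_left_mono)
    qed
  qed (use mollify_integrable[OF \<rho> F] mollifier_integral_translate(2)[OF \<rho>] in auto)
  also have "\<dots> = m"
    using mollifier_integral_translate[OF \<rho>, of x] by simp
  finally show ?thesis .
qed

lemma continuous_on_mollify:
  fixes F :: "'a::euclidean_space \<Rightarrow> 'b::euclidean_space"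
  assumes \<rho>: "mollifier d \<rho> D\<rho>" and F: "integrable lebesgue F"
  shows "continuous_on UNIV (mollify \<rho> F)"
proof -
  have t: "test_fn UNIV \<rho> D\<rho>"
    using \<rho> by (auto simp: mollifier_def)
  obtain C where C: "0 < C" "\<And>x. \<bar>\<rho> x\<bar> \<le> C"
    using test_fn_bounded[OF t] by metis
  note cont = continuous_on_compose2[OF test_fn_continuous(1)[OF t]]
  have "continuous_on UNIV (\<lambda>x. LINT y|lebesgue. \<rho> (y - x) *\<^sub>R F y)"
  proof (rule continuous_on_integral_parameter[where g="\<lambda>y. C * norm (F y)"])
    show "(\<lambda>y. \<rho> (y - x) *\<^sub>R F y) \<in> borel_measurable lebesgue" for x
      by (rule borel_measurable_integrable[OF mollify_integrable[OF \<rho> F]])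
    show "continuous_on UNIV (\<lambda>x. \<rho> (y - x) *\<^sub>R F y)" for y
      by (intro continuous_intros cont) auto
    show "norm (\<rho> (y - x) *\<^sub>R F y) \<le> C * norm (F y)" for x y
      using C by (auto intro!: mult_right_mono)
  qed (use F in simp)
  then show ?thesis
    by (simp add: mollify_def[abs_def])
qed

text \<open>The derivative falls on the kernel, so integrability of \<open>F\<close> is enough; the
  minus sign comes from differentiating \<open>\<rho> (y - x)\<close> in \<open>x\<close>. Only
  where the ball of the kernel stays in the domain is this gradient identified with a mollified weak
  gradient.\<close>

lemma mollify_has_derivative:
  fixes F :: "'a::euclidean_space \<Rightarrow> real"
  assumes \<rho>: "mollifier d \<rho> D\<rho>" and F: "integrable lebesgue F"
  shows "(mollify \<rho> F has_derivative (\<lambda>h. (LINT y|lebesgue. - F y *\<^sub>R D\<rho> (y - x)) \<bullet> h)) (at x)" (is ?deriv)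
    and "continuous_on UNIV (\<lambda>x. LINT y|lebesgue. - F y *\<^sub>R D\<rho> (y - x))" (is ?cont)
proof -
  have t: "test_fn UNIV \<rho> D\<rho>"
    using \<rho> by (auto simp: mollifier_def)
  obtain C where C: "0 < C" "\<And>x. norm (D\<rho> x) \<le> C"
    using test_fn_bounded[OF t] by metis
  note [measurable] = mollifier_measurable(4)[OF \<rho>] borel_measurable_integrable[OF F]
  have meas: "(\<lambda>y. - F y *\<^sub>R D\<rho> (y - x)) \<in> borel_measurable lebesgue" for x
    by measurable
  have bound: "norm (- F y *\<^sub>R D\<rho> (y - x)) \<le> C * \<bar>F y\<bar>" for x y
    using mult_left_mono[OF C(2)[of "y - x"], of "\<bar>F y\<bar>"] by (simp add: mult.commute)
  have int: "integrable lebesgue (\<lambda>y. C * \<bar>F y\<bar>)"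
    using F by simp
  note cont = continuous_on_compose2[OF test_fn_continuous(2)[OF t]]
  show ?cont
    by (rule continuous_on_integral_parameter[OF meas _ bound int]) (intro continuous_intros cont; simp)
  have "((\<lambda>x. \<rho> (y - x) * F y) has_derivative (\<lambda>h. (- F y *\<^sub>R D\<rho> (y - x)) \<bullet> h)) (at x)" for x y
  proof -
    have "(\<rho> has_derivative (\<lambda>h. D\<rho> (y - x) \<bullet> h)) (at (y - x))"
      using t by (simp add: test_fn_def)
    then have "((\<lambda>x. \<rho> (y - x)) has_derivative (\<lambda>h. D\<rho> (y - x) \<bullet> (- h))) (at x)"
      by (rule has_derivative_compose[rotated]) (auto intro!: derivative_eq_intros)
    then show ?thesis
      by (auto intro!: derivative_eq_intros)
  qed
  then have "((\<lambda>x. LINT y|lebesgue. \<rho> (y - x) * F y) has_derivative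
      (\<lambda>h. (LINT y|lebesgue. - F y *\<^sub>R D\<rho> (y - x)) \<bullet> h)) (at x)"
    by (intro has_derivative_integral_parameter[OF _ meas _ bound int])
      (use mollify_integrable[OF \<rho> F] in auto)
  then show ?deriv
    by (simp add: mollify_def[abs_def])
qed

section \<open>Convergence of mollifications in L1\<close>

lemma integrable_bounded_support:
  fixes F :: "'a::euclidean_space \<Rightarrow> 'b::euclidean_space"
  assumes "F \<in> borel_measurable lebesgue" "AE x in lebesgue. norm (F x) \<le> B"
    and "\<And>x. R < norm x \<Longrightarrow> F x = 0"
  shows "integrable lebesgue F"
proof (rule Bochner_Integration.integrable_bound)
  show "integrable lebesgue (\<lambda>x. B * indicator (cball 0 R :: 'a set) x)"
    using lmeasurable_cball[of 0 R] by (intro integrable_mult_right) (auto simp: fmeasurable_def)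
  show "AE x in lebesgue. norm (F x) \<le> norm (B * indicator (cball 0 R) x)"
    using assms(2)
  proof eventually_elim
    fix x assume "norm (F x) \<le> B"
    then show "norm (F x) \<le> norm (B * indicator (cball 0 R) x)"
      using assms(3)[of x] by (cases "R < norm x") auto
  qed
qed fact

text \<open>Measurability yields continuous functions converging to \<open>F\<close> almost
  everywhere, but with no control of size or support. Radial clipping at \<open>B\<close> and a
  cutoff between radii \<open>R\<close> and \<open>R + 1\<close> supply both, so that dominated
  convergence applies; neither changes the limit, since \<open>F\<close> obeys the same
  bounds.\<close>

lemma L1_approx_continuous:
  fixes F :: "'a::euclidean_space \<Rightarrow> 'b::euclidean_space"
  assumes F: "F \<in> borel_measurable lebesgue" and B: "AE x in lebesgue. norm (F x) \<le> B" "0 < B"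
    and supp: "\<And>x. R < norm x \<Longrightarrow> F x = 0" and e: "0 < e"
  obtains g where "continuous_on UNIV g" "\<And>x. norm (g x) \<le> B" "\<And>x. R + 1 < norm x \<Longrightarrow> g x = 0"
    "(LINT x|lebesgue. norm (F x - g x)) < e"
proof -
  have "F measurable_on UNIV"
    using F by (intro lebesgue_measurable_imp_measurable_on) auto
  then obtain N g where N: "negligible N" and g: "\<And>n. continuous_on UNIV (g n)"
    and lim: "\<And>x. x \<notin> N \<Longrightarrow> (\<lambda>n. g n x) \<longlonglongrightarrow> F x"
    unfolding measurable_on_def by auto
  define clip where "clip y = (B / max B (norm y)) *\<^sub>R y" for y :: 'b
  define \<psi> where "\<psi> x = max 0 (min 1 (R + 1 - norm x))" for x :: 'a
  have clip_cont: "continuous_on UNIV clip"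
    unfolding clip_def using B(2) by (intro continuous_intros) (auto simp: max_def)
  have clip_le: "norm (clip y) \<le> B" for y
    using B(2) by (auto simp: clip_def max_def divide_simps)
  have clip_id: "clip y = y" if "norm y \<le> B" for y
    using B(2) that by (simp add: clip_def max_def)
  have \<psi>: "0 \<le> \<psi> x" "\<psi> x \<le> 1" "norm x \<le> R \<Longrightarrow> \<psi> x = 1" "R + 1 < norm x \<Longrightarrow> \<psi> x = 0" for x
    by (auto simp: \<psi>_def)
  define G where "G n x = \<psi> x *\<^sub>R clip (g n x)" for n x
  have G_cont: "continuous_on UNIV (G n)" for n
    unfolding G_def \<psi>_def
    by (intro continuous_intros continuous_on_compose2[OF clip_cont] g) auto
  have G_le: "norm (G n x) \<le> B" for n x
    using mult_mono[OF \<psi>(2)[of x] clip_le[of "g n x"]] \<psi>(1)[of x] by (simp add: G_def)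
  have G_meas: "G n \<in> borel_measurable lebesgue" for n
    by (intro measurable_completion) (use borel_measurable_continuous_onI[OF G_cont] in simp)
  have "(\<lambda>n. LINT x|lebesgue. norm (F x - G n x)) \<longlonglongrightarrow> (LINT x|(lebesgue :: 'a measure). 0)"
  proof (rule integral_dominated_convergence)
    show "integrable lebesgue (\<lambda>x. 2 * B * indicator (cball 0 (R + 1) :: 'a set) x)"
      using lmeasurable_cball[of 0 "R + 1"] by (intro integrable_mult_right) (auto simp: fmeasurable_def)
    show "(\<lambda>x. norm (F x - G n x)) \<in> borel_measurable lebesgue" for n
      using F G_meas by measurable
    have "AE x in lebesgue. x \<notin> N"
      using N by (intro AE_not_in) (simp add: negligible_iff_null_sets)
    with B(1) show "AE x in lebesgue. (\<lambda>n. norm (F x - G n x)) \<longlonglongrightarrow> 0"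
    proof eventually_elim
      fix x assume x: "x \<notin> N" "norm (F x) \<le> B"
      have "isCont clip (F x)"
        using clip_cont by (simp add: continuous_on_eq_continuous_at)
      from isCont_tendsto_compose[OF this lim[OF x(1)]] have "(\<lambda>n. clip (g n x)) \<longlonglongrightarrow> F x"
        using clip_id[OF x(2)] by simp
      then have "(\<lambda>n. G n x) \<longlonglongrightarrow> \<psi> x *\<^sub>R F x"
        unfolding G_def by (intro tendsto_intros)
      also have "\<psi> x *\<^sub>R F x = F x"
        using \<psi>(3)[of x] supp[of x] by (cases "norm x \<le> R") auto
      finally have "(\<lambda>n. norm (F x - G n x)) \<longlonglongrightarrow> norm (F x - F x)"
        by (intro tendsto_intros)
      then show "(\<lambda>n. norm (F x - G n x)) \<longlonglongrightarrow> 0"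
        by simp
    qed
    show "AE x in lebesgue. norm (norm (F x - G n x)) \<le> 2 * B * indicator (cball 0 (R + 1)) x" for n
      using B(1)
    proof eventually_elim
      fix x assume x: "norm (F x) \<le> B"
      show "norm (norm (F x - G n x)) \<le> 2 * B * indicator (cball 0 (R + 1)) x"
      proof (cases "norm x \<le> R + 1")
        case True
        then show ?thesis
          using x G_le[of n x] norm_triangle_ineq4[of "F x" "G n x"] by simp
      next
        case False
        then show ?thesis
          using supp[of x] \<psi>(4)[of x] by (simp add: G_def)
      qed
    qed
  qed simp
  then have "\<forall>\<^sub>F n in sequentially. (LINT x|lebesgue. norm (F x - G n x)) < e"
    using e by (intro order_tendstoD(2)) auto
  then obtain n where "(LINT x|lebesgue. norm (F x - G n x)) < e"
    by (auto simp: eventually_sequentially)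
  then show ?thesis
    using that[of "G n"] G_cont G_le \<psi>(4) by (simp add: G_def)
qed

lemma mollify_integrable_UNIV:
  fixes F :: "'a::euclidean_space \<Rightarrow> 'b::euclidean_space"
  assumes \<rho>: "mollifier d \<rho> D\<rho>" and F: "F \<in> borel_measurable lebesgue" "AE x in lebesgue. norm (F x) \<le> B"
    and supp: "\<And>x. R < norm x \<Longrightarrow> F x = 0"
  shows "integrable lebesgue (mollify \<rho> F)"
proof (rule integrable_bounded_support)
  have "integrable lebesgue F"
    by (rule integrable_bounded_support[OF F supp])
  then show "mollify \<rho> F \<in> borel_measurable lebesgue"
    by (intro measurable_completion) (use borel_measurable_continuous_onI[OF continuous_on_mollify[OF \<rho>]] in simp)
  have "AE y in lebesgue. norm (y - x) \<le> d \<longrightarrow> norm (F y) \<le> B" for x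
    using F(2) by eventually_elim simp
  then show "AE x in lebesgue. norm (mollify \<rho> F x) \<le> B"
    by (auto intro!: norm_mollify_le[OF \<rho>])
  show "mollify \<rho> F x = 0" if x: "R + d < norm x" for x
  proof -
    have "F y = 0" if "norm (y - x) \<le> d" for y
    proof (rule supp)
      show "R < norm y"
        using x that norm_triangle_ineq4[of y "y - x"] by simp
    qed
    then have "norm (mollify \<rho> F x) \<le> 0"
      by (intro norm_mollify_le[OF \<rho>]) auto
    then show ?thesis by simp
  qed
qed

text \<open>After exchanging the integrals, evenness of the kernel turns the inner integral over
  \<open>x\<close> into its total mass 1.\<close>

lemma mollify_L1_contraction:
  fixes F :: "'a::euclidean_space \<Rightarrow> 'b::euclidean_space"
  assumes \<rho>: "mollifier d \<rho> D\<rho>" and F: "integrable lebesgue F"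
  shows "(\<integral>\<^sup>+x. ennreal (norm (mollify \<rho> F x)) \<partial>lebesgue) \<le> (\<integral>\<^sup>+x. ennreal (norm (F x)) \<partial>lebesgue)"
proof -
  note [measurable] = mollifier_measurable(1)[OF \<rho>]
  have "(\<lambda>x. ennreal (norm (F x))) \<in> borel_measurable lebesgue"
    using F by measurable
  \<comment> \<open>The exchange of integrals takes place for two copies of \<open>lborel\<close>,
    so the merely Lebesgue measurable norm of \<open>F\<close> is replaced by a Borel function that
    agrees with it almost everywhere.\<close>
  from completion_ex_borel_measurable[OF this] obtain h where
    h [measurable]: "h \<in> borel_measurable borel" and ae: "AE x in lborel. ennreal (norm (F x)) = h x"
    by auto
  have pos: "\<And>x. 0 \<le> \<rho> x" and even: "\<And>x. \<rho> (- x) = \<rho> x"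
    using \<rho> by (auto simp: mollifier_def)
  have "(\<integral>\<^sup>+x. ennreal (norm (mollify \<rho> F x)) \<partial>lebesgue) = (\<integral>\<^sup>+x. ennreal (norm (mollify \<rho> F x)) \<partial>lborel)"
    by (rule nn_integral_completion)
  also have "\<dots> \<le> (\<integral>\<^sup>+x. (\<integral>\<^sup>+y. ennreal (\<rho> (y - x)) * h y \<partial>lborel) \<partial>lborel)"
  proof (rule nn_integral_mono)
    fix x
    have "ennreal (norm (mollify \<rho> F x)) \<le> (\<integral>\<^sup>+y. ennreal (norm (\<rho> (y - x) *\<^sub>R F y)) \<partial>lebesgue)"
      unfolding mollify_def by (intro integral_norm_bound_ennreal mollify_integrable[OF \<rho> F])
    also have "\<dots> = (\<integral>\<^sup>+y. ennreal (norm (\<rho> (y - x) *\<^sub>R F y)) \<partial>lborel)"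
      by (rule nn_integral_completion)
    also have "\<dots> = (\<integral>\<^sup>+y. ennreal (\<rho> (y - x)) * h y \<partial>lborel)"
    proof (rule nn_integral_cong_AE)
      show "AE y in lborel. ennreal (norm (\<rho> (y - x) *\<^sub>R F y)) = ennreal (\<rho> (y - x)) * h y"
        using ae by eventually_elim (simp add: pos ennreal_mult)
    qed
    finally show "ennreal (norm (mollify \<rho> F x)) \<le> (\<integral>\<^sup>+y. ennreal (\<rho> (y - x)) * h y \<partial>lborel)" .
  qed
  also have "\<dots> = (\<integral>\<^sup>+y. (\<integral>\<^sup>+x. ennreal (\<rho> (y - x)) * h y \<partial>lborel) \<partial>lborel)"
    by (rule lborel_pair.Fubini'[symmetric]) simp
  also have "\<dots> = (\<integral>\<^sup>+y. h y \<partial>lborel)"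
  proof (rule nn_integral_cong)
    fix y
    have "\<rho> (y - x) = \<rho> (x - y)" for x
      using even[of "x - y"] by simp
    then show "(\<integral>\<^sup>+x. ennreal (\<rho> (y - x)) * h y \<partial>lborel) = h y"
      using mollifier_integral_translate(1)[OF \<rho>, of y] by (simp add: nn_integral_multc)
  qed
  also have "\<dots> = (\<integral>\<^sup>+x. ennreal (norm (F x)) \<partial>lborel)"
    using ae by (intro nn_integral_cong_AE) auto
  also have "\<dots> = (\<integral>\<^sup>+x. ennreal (norm (F x)) \<partial>lebesgue)"
    by (rule nn_integral_completion[symmetric])
  finally show ?thesis .
qed

lemma mollify_continuous_tendsto:
  fixes g :: "'a::euclidean_space \<Rightarrow> 'b::euclidean_space"
  assumes \<rho>: "\<And>j. mollifier (d j) (\<rho> j) (D\<rho> j)" and d: "d \<longlonglongrightarrow> 0"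
    and g: "continuous_on UNIV g" "integrable lebesgue g"
  shows "(\<lambda>j. mollify (\<rho> j) g x) \<longlonglongrightarrow> g x"
proof (rule LIMSEQ_I)
  fix e :: real assume e: "0 < e"
  have "isCont g x"
    using g by (simp add: continuous_on_eq_continuous_at)
  then obtain s where s: "0 < s" "\<And>y. dist y x < s \<Longrightarrow> dist (g y) (g x) < e / 2"
    using e unfolding continuous_at_eps_delta by (metis half_gt_zero)
  from order_tendstoD(2)[OF d s(1)] obtain n where n: "\<And>j. n \<le> j \<Longrightarrow> d j < s"
    by (auto simp: eventually_sequentially)
  show "\<exists>n. \<forall>j\<ge>n. norm (mollify (\<rho> j) g x - g x) < e"
  proof (intro exI allI impI)
    fix j assume j: "n \<le> j"
    have "mollify (\<rho> j) g x - g x = mollify (\<rho> j) (\<lambda>y. g y - g x) x"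
      unfolding mollify_def scaleR_diff_right
      using mollify_integrable[OF \<rho> g(2)] mollifier_integral_translate[OF \<rho>] by simp
    also have "norm \<dots> \<le> e / 2"
    proof (rule norm_mollify_le[OF \<rho>], rule AE_I2, rule impI)
      fix y assume "norm (y - x) \<le> d j"
      then have "dist y x < s"
        using n[OF j] by (simp add: dist_norm)
      from s(2)[OF this] show "norm (g y - g x) \<le> e / 2"
        by (simp add: dist_norm)
    qed
    finally show "norm (mollify (\<rho> j) g x - g x) < e"
      using e by simp
  qed
qed

text \<open>A three-epsilon argument: the contraction property controls the mollification of
  \<open>F - g\<close>, and for continuous \<open>g\<close> pointwise convergence is dominated.
  Radii at most 1 keep all supports in the ball of radius \<open>R + 2\<close>.\<close>

lemma mollify_tendsto_L1:
  fixes F :: "'a::euclidean_space \<Rightarrow> 'b::euclidean_space"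
  assumes \<rho>: "\<And>j. mollifier (d j) (\<rho> j) (D\<rho> j)" and d: "d \<longlonglongrightarrow> 0" "\<And>j. d j \<le> 1"
    and F: "F \<in> borel_measurable lebesgue" and B: "AE x in lebesgue. norm (F x) \<le> B"
    and supp: "\<And>x. R < norm x \<Longrightarrow> F x = 0"
  shows "(\<lambda>j. LINT x|lebesgue. norm (mollify (\<rho> j) F x - F x)) \<longlonglongrightarrow> 0"
proof (rule LIMSEQ_I)
  fix e :: real assume e: "0 < e"
  define C where "C = max 1 B"
  have C: "0 < C" "AE x in lebesgue. norm (F x) \<le> C"
    unfolding C_def using B by (auto elim: eventually_mono)
  have e3: "0 < e / 3"
    using e by simp
  obtain g where g: "continuous_on UNIV g" "\<And>x. norm (g x) \<le> C" "\<And>x. R + 1 < norm x \<Longrightarrow> g x = 0"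
    and close: "(LINT x|lebesgue. norm (F x - g x)) < e / 3"
    by (rule L1_approx_continuous[OF F C(2,1) supp e3]) auto
  have g_meas: "g \<in> borel_measurable lebesgue"
    by (intro measurable_completion) (use borel_measurable_continuous_onI[OF g(1)] in simp)
  have g_int: "integrable lebesgue g"
    by (rule integrable_bounded_support[OF g_meas _ g(3)]) (use g(2) in auto)
  have F_int: "integrable lebesgue F"
    by (rule integrable_bounded_support[OF F B supp])
  have Fg_int: "integrable lebesgue (\<lambda>x. F x - g x)"
    using F_int g_int by simp
  have mg_int: "integrable lebesgue (mollify (\<rho> j) g)" for j
    by (rule mollify_integrable_UNIV[OF \<rho> g_meas _ g(3), of C]) (use g(2) in auto)
  have mF_int: "integrable lebesgue (mollify (\<rho> j) F)" for j
    by (rule mollify_integrable_UNIV[OF \<rho> F B supp])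
  have split: "mollify (\<rho> j) (\<lambda>x. F x - g x) = (\<lambda>x. mollify (\<rho> j) F x - mollify (\<rho> j) g x)" for j
    unfolding mollify_def scaleR_diff_right
    using mollify_integrable[OF \<rho> g_int] mollify_integrable[OF \<rho> F_int] by simp
  have "(\<lambda>j. LINT x|lebesgue. norm (mollify (\<rho> j) g x - g x)) \<longlonglongrightarrow> (LINT x|(lebesgue :: 'a measure). 0)"
  proof (rule integral_dominated_convergence)
    show "integrable lebesgue (\<lambda>x. 2 * C * indicator (cball 0 (R + 2) :: 'a set) x)"
      using lmeasurable_cball[of 0 "R + 2"] by (intro integrable_mult_right) (auto simp: fmeasurable_def)
    show "(\<lambda>x. norm (mollify (\<rho> j) g x - g x)) \<in> borel_measurable lebesgue" for j
      using borel_measurable_integrable[OF mg_int] g_meas by measurable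
    show "AE x in lebesgue. (\<lambda>j. norm (mollify (\<rho> j) g x - g x)) \<longlonglongrightarrow> 0"
    proof (rule AE_I2)
      fix x
      show "(\<lambda>j. norm (mollify (\<rho> j) g x - g x)) \<longlonglongrightarrow> 0"
        using mollify_continuous_tendsto[OF \<rho> d(1) g(1) g_int, of x]
        by (intro tendsto_norm_zero) (simp add: LIM_zero)
    qed
    show "AE x in lebesgue. norm (norm (mollify (\<rho> j) g x - g x)) \<le> 2 * C * indicator (cball 0 (R + 2)) x" for j
    proof (rule AE_I2)
      fix x
      show "norm (norm (mollify (\<rho> j) g x - g x)) \<le> 2 * C * indicator (cball 0 (R + 2)) x"
      proof (cases "norm x \<le> R + 2")
        case True
        have "norm (mollify (\<rho> j) g x) \<le> C"
          by (rule norm_mollify_le[OF \<rho>]) (use g(2) in auto)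
        then show ?thesis
          using True g(2)[of x] norm_triangle_ineq4[of "mollify (\<rho> j) g x" "g x"] by simp
      next
        case False
        have "norm (mollify (\<rho> j) g x) \<le> 0"
        proof (rule norm_mollify_le[OF \<rho>], rule AE_I2, rule impI)
          fix y assume "norm (y - x) \<le> d j"
          then have "R + 1 < norm y"
            using False norm_triangle_ineq4[of y "y - x"] d(2)[of j] by simp
          then show "norm (g y) \<le> 0"
            using g(3) by simp
        qed
        then show ?thesis
          using False g(3)[of x] by simp
      qed
    qed
  qed simp
  then have "(\<lambda>j. LINT x|lebesgue. norm (mollify (\<rho> j) g x - g x)) \<longlonglongrightarrow> 0"
    by simp
  from order_tendstoD(2)[OF this, of "e / 3"] e obtain n where
    n: "\<And>j. n \<le> j \<Longrightarrow> (LINT x|lebesgue. norm (mollify (\<rho> j) g x - g x)) < e / 3"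
    by (auto simp: eventually_sequentially)
  show "\<exists>n. \<forall>j\<ge>n. norm ((LINT x|lebesgue. norm (mollify (\<rho> j) F x - F x)) - 0) < e"
  proof (intro exI allI impI)
    fix j assume j: "n \<le> j"
    have int1: "integrable lebesgue (mollify (\<rho> j) (\<lambda>x. F x - g x))"
      unfolding split using mF_int mg_int by simp
    have "ennreal (LINT x|lebesgue. norm (mollify (\<rho> j) (\<lambda>x. F x - g x) x)) \<le> ennreal (LINT x|lebesgue. norm (F x - g x))"
      using mollify_L1_contraction[OF \<rho>[of j] Fg_int] int1 Fg_int
      by (subst (1 2) nn_integral_eq_integral[symmetric]) auto
    then have c: "(LINT x|lebesgue. norm (mollify (\<rho> j) (\<lambda>x. F x - g x) x)) \<le> (LINT x|lebesgue. norm (F x - g x))"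
      by (simp add: integral_nonneg_AE)
    have "(LINT x|lebesgue. norm (mollify (\<rho> j) F x - F x)) \<le>
      (LINT x|lebesgue. norm (mollify (\<rho> j) (\<lambda>x. F x - g x) x) + (norm (mollify (\<rho> j) g x - g x) + norm (F x - g x)))"
    proof (rule integral_mono)
      show "integrable lebesgue (\<lambda>x. norm (mollify (\<rho> j) F x - F x))"
        using mF_int F_int by (intro integrable_norm) simp
      show "integrable lebesgue (\<lambda>x. norm (mollify (\<rho> j) (\<lambda>x. F x - g x) x) + (norm (mollify (\<rho> j) g x - g x) + norm (F x - g x)))"
        using int1 mg_int g_int F_int
        by (intro Bochner_Integration.integrable_add integrable_norm Bochner_Integration.integrable_diff)
      fix x
      have "mollify (\<rho> j) F x - F x = mollify (\<rho> j) (\<lambda>x. F x - g x) x + ((mollify (\<rho> j) g x - g x) - (F x - g x))"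
        by (simp add: split)
      also have "norm \<dots> \<le> norm (mollify (\<rho> j) (\<lambda>x. F x - g x) x) + (norm (mollify (\<rho> j) g x - g x) + norm (F x - g x))"
        by (intro order_trans[OF norm_triangle_ineq] add_left_mono norm_triangle_ineq4)
      finally show "norm (mollify (\<rho> j) F x - F x) \<le> norm (mollify (\<rho> j) (\<lambda>x. F x - g x) x) + (norm (mollify (\<rho> j) g x - g x) + norm (F x - g x))" .
    qed
    also have "\<dots> = (LINT x|lebesgue. norm (mollify (\<rho> j) (\<lambda>x. F x - g x) x))
        + ((LINT x|lebesgue. norm (mollify (\<rho> j) g x - g x)) + (LINT x|lebesgue. norm (F x - g x)))"
      using int1 mg_int g_int F_int by simp
    also have "\<dots> < e"
      using c close n[OF j] by linarith
    finally show "norm ((LINT x|lebesgue. norm (mollify (\<rho> j) F x - F x)) - 0) < e"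
      by (simp add: integral_nonneg_AE)
  qed
qed

section \<open>Locally bounded Sobolev functions\<close>

text \<open>Mollification integrates over the whole space, while the given functions are measurable
  only on \<open>\<Omega>\<close>; extension by zero off a compact subset bridges the gap.\<close>

lemma borel_measurable_restrict_compact:
  fixes F :: "'a::euclidean_space \<Rightarrow> 'b::euclidean_space"
  assumes F: "F \<in> borel_measurable (lebesgue_on \<Omega>)" and K: "compact K" "K \<subseteq> \<Omega>"
  shows "(\<lambda>x. if x \<in> K then F x else 0) \<in> borel_measurable lebesgue"
proof -
  have "F \<in> borel_measurable (lebesgue_on K)"
    using F K(2) by (rule measurable_restrict_mono)
  then show ?thesis
    using K(1) by (intro borel_measurable_if_I) (auto simp: fmeasurableD lmeasurable_compact)
qed

lemma loc_ess_bdd_restrict: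
  fixes F :: "'a::euclidean_space \<Rightarrow> 'b::euclidean_space"
  assumes F: "loc_ess_bdd \<Omega> F" and K: "compact K" "K \<subseteq> \<Omega>"
  obtains B where "0 < B" "AE x in lebesgue. x \<in> K \<longrightarrow> norm (F x) \<le> B"
    "AE x in lebesgue. norm (if x \<in> K then F x else 0) \<le> B"
    "(\<lambda>x. if x \<in> K then F x else 0) \<in> borel_measurable lebesgue"
    "integrable lebesgue (\<lambda>x. if x \<in> K then F x else 0)"
proof -
  obtain C where C: "AE x in lebesgue. x \<in> K \<longrightarrow> norm (F x) \<le> C"
    using F K by (auto simp: loc_ess_bdd_def)
  have C1: "AE x in lebesgue. x \<in> K \<longrightarrow> norm (F x) \<le> max 1 C"
    using C by eventually_elim auto
  have C2: "AE x in lebesgue. norm (if x \<in> K then F x else 0) \<le> max 1 C"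
    using C by eventually_elim auto
  have meas: "(\<lambda>x. if x \<in> K then F x else 0) \<in> borel_measurable lebesgue"
    using F K by (intro borel_measurable_restrict_compact) (auto simp: loc_ess_bdd_def)
  obtain R where R: "\<And>x. x \<in> K \<Longrightarrow> norm x \<le> R"
    using compact_imp_bounded[OF K(1)] by (auto simp: bounded_iff)
  have "integrable lebesgue (\<lambda>x. if x \<in> K then F x else 0)"
    by (rule integrable_bounded_support[OF meas C2, of R]) (use R in force)
  then show ?thesis
    using that[of "max 1 C"] C1 C2 meas by simp
qed

lemma test_fn_translate:
  assumes \<phi>: "test_fn UNIV \<phi> D\<phi>" and supp: "\<And>y. d < norm y \<Longrightarrow> \<phi> y = 0" and \<Omega>: "cball x d \<subseteq> \<Omega>"
  shows "test_fn \<Omega> (\<lambda>y. \<phi> (y - x)) (\<lambda>y. D\<phi> (y - x))"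
proof -
  have sub: "{y. \<phi> (y - x) \<noteq> 0} \<subseteq> cball x d"
    using supp by (force simp: dist_norm norm_minus_commute)
  then have cl: "closure {y. \<phi> (y - x) \<noteq> 0} \<subseteq> cball x d"
    by (intro closure_minimal) auto
  show ?thesis
    unfolding test_fn_def
  proof (intro conjI allI)
    show "continuous_on UNIV (\<lambda>y. D\<phi> (y - x))"
      by (intro continuous_on_compose2[OF test_fn_continuous(2)[OF \<phi>]] continuous_intros) auto
    show "((\<lambda>y. \<phi> (y - x)) has_derivative (\<lambda>h. D\<phi> (y - x) \<bullet> h)) (at y)" for y
    proof -
      have "(\<phi> has_derivative (\<lambda>h. D\<phi> (y - x) \<bullet> h)) (at (y - x))"
        using \<phi> by (simp add: test_fn_def)
      then show ?thesis
        by (rule has_derivative_compose[rotated]) (auto intro!: derivative_eq_intros)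
    qed
    show "compact (closure {y. \<phi> (y - x) \<noteq> 0})"
      using sub by (intro compact_closure[THEN iffD2] bounded_subset[OF bounded_cball[of x d]])
    show "closure {y. \<phi> (y - x) \<noteq> 0} \<subseteq> \<Omega>"
      using cl \<Omega> by blast
  qed
qed

text \<open>As long as the ball of the kernel stays in \<open>K\<close>, its translate is a test
  function on \<open>\<Omega>\<close>, and the definition of the weak gradient applies. The
  extension by zero is not seen from such points, although it may create a jump of the function
  elsewhere.\<close>

lemma weak_grad_mollify:
  fixes w :: "'a::euclidean_space \<Rightarrow> real"
  assumes W: "weak_grad \<Omega> w W" and \<rho>: "mollifier d \<rho> D\<rho>" and K: "cball x d \<subseteq> K" "K \<subseteq> \<Omega>"
  shows "(LINT y|lebesgue. - (if y \<in> K then w y else 0) *\<^sub>R D\<rho> (y - x)) = mollify \<rho> (\<lambda>y. if y \<in> K then W y else 0) x"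
proof -
  have t0: "test_fn UNIV \<rho> D\<rho>" and zero: "\<And>y. d < norm y \<Longrightarrow> \<rho> y = 0"
    using \<rho> by (auto simp: mollifier_def)
  have t: "test_fn \<Omega> (\<lambda>y. \<rho> (y - x)) (\<lambda>y. D\<rho> (y - x))"
    using K by (intro test_fn_translate[OF t0 zero]) auto
  have "closure {y. \<rho> (y - x) \<noteq> 0} \<subseteq> cball x d"
    using zero by (intro closure_minimal) (force simp: dist_norm norm_minus_commute)+
  then have out: "\<rho> (y - x) = 0 \<and> D\<rho> (y - x) = 0" if "y \<notin> K" for y
    using that K test_fn_vanishes[OF t, of y] by auto
  have "(LINT y|lebesgue. - (if y \<in> K then w y else 0) *\<^sub>R D\<rho> (y - x)) = (LINT y|lebesgue. - (w y *\<^sub>R D\<rho> (y - x)))"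
    by (intro Bochner_Integration.integral_cong) (use out in auto)
  also have "\<dots> = - (LINT y|lebesgue. w y *\<^sub>R D\<rho> (y - x))"
    by (rule integral_minus)
  also have "\<dots> = (LINT y|lebesgue. \<rho> (y - x) *\<^sub>R W y)"
    using W[unfolded weak_grad_def, rule_format, OF t] by simp
  also have "\<dots> = mollify \<rho> (\<lambda>y. if y \<in> K then W y else 0) x"
    unfolding mollify_def by (intro Bochner_Integration.integral_cong) (use out in auto)
  finally show ?thesis .
qed

lemma mollify_AE_subseq:
  fixes F :: "'a::euclidean_space \<Rightarrow> 'b::euclidean_space"
  assumes \<rho>: "\<And>j. mollifier (d j) (\<rho> j) (D\<rho> j)" and d: "d \<longlonglongrightarrow> 0" "\<And>j. d j \<le> 1"
    and F: "F \<in> borel_measurable lebesgue" and B: "AE x in lebesgue. norm (F x) \<le> B"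
    and supp: "\<And>x. R < norm x \<Longrightarrow> F x = 0"
  obtains r :: "nat \<Rightarrow> nat" where "strict_mono r" "AE x in lebesgue. (\<lambda>j. mollify (\<rho> (r j)) F x) \<longlonglongrightarrow> F x"
proof -
  have "integrable lebesgue (\<lambda>x. mollify (\<rho> j) F x - F x)" for j
    using mollify_integrable_UNIV[OF \<rho> F B supp] integrable_bounded_support[OF F B supp]
    by (rule Bochner_Integration.integrable_diff)
  from tendsto_L1_AE_subseq[OF this mollify_tendsto_L1[OF \<rho> d F B supp]] obtain r :: "nat \<Rightarrow> nat"
    where r: "strict_mono r" "AE x in lebesgue. (\<lambda>j. mollify (\<rho> (r j)) F x - F x) \<longlonglongrightarrow> 0"
    by auto
  from r(2) have "AE x in lebesgue. (\<lambda>j. mollify (\<rho> (r j)) F x) \<longlonglongrightarrow> F x"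
    by eventually_elim (rule LIM_zero_cancel)
  then show ?thesis
    using that r(1) by blast
qed

lemma loc_ess_bdd_diff:
  fixes F G :: "'a::euclidean_space \<Rightarrow> 'b::euclidean_space"
  assumes F: "loc_ess_bdd \<Omega> F" and G: "loc_ess_bdd \<Omega> G"
  shows "loc_ess_bdd \<Omega> (\<lambda>x. F x - G x)"
  unfolding loc_ess_bdd_def
proof (intro conjI allI impI)
  show "(\<lambda>x. F x - G x) \<in> borel_measurable (lebesgue_on \<Omega>)"
    using F G by (intro borel_measurable_diff) (auto simp: loc_ess_bdd_def)
  fix K assume "compact K \<and> K \<subseteq> \<Omega>"
  then obtain A B where A: "AE x in lebesgue. x \<in> K \<longrightarrow> norm (F x) \<le> A"
    and B: "AE x in lebesgue. x \<in> K \<longrightarrow> norm (G x) \<le> B"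
    using F G unfolding loc_ess_bdd_def by meson
  have "AE x in lebesgue. x \<in> K \<longrightarrow> norm (F x - G x) \<le> A + B"
    using A B
  proof eventually_elim
    fix x assume "x \<in> K \<longrightarrow> norm (F x) \<le> A" "x \<in> K \<longrightarrow> norm (G x) \<le> B"
    then show "x \<in> K \<longrightarrow> norm (F x - G x) \<le> A + B"
      using norm_triangle_ineq4[of "F x" "G x"] by linarith
  qed
  then show "\<exists>C. AE x in lebesgue. x \<in> K \<longrightarrow> norm (F x - G x) \<le> C" ..
qed

text \<open>Bochner integrals are additive only for integrable functions; this supplies
  integrability for both sides of the identity in \<open>weak_grad\<close>, so that identities can
  be subtracted.\<close>

lemma loc_ess_bdd_mult_test_fn:
  assumes t: "test_fn \<Omega> \<phi> D\<phi>"
  shows "loc_ess_bdd \<Omega> F \<Longrightarrow> integrable lebesgue (\<lambda>x. F x *\<^sub>R D\<phi> x)"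
    and "loc_ess_bdd \<Omega> G \<Longrightarrow> integrable lebesgue (\<lambda>x. \<phi> x *\<^sub>R (G x :: 'b::euclidean_space))"
proof -
  let ?K = "closure {x. \<phi> x \<noteq> 0}"
  have K: "compact ?K" "?K \<subseteq> \<Omega>"
    using t by (auto simp: test_fn_def)
  obtain C where C: "0 < C" "\<And>x. \<bar>\<phi> x\<bar> \<le> C" "\<And>x. norm (D\<phi> x) \<le> C"
    using test_fn_bounded[OF t] by metis
  have [measurable]: "\<phi> \<in> borel_measurable lebesgue" "D\<phi> \<in> borel_measurable lebesgue"
    using test_fn_measurable[OF t] by (auto intro: measurable_completion)
  show "integrable lebesgue (\<lambda>x. F x *\<^sub>R D\<phi> x)" if F: "loc_ess_bdd \<Omega> F"
  proof -
    define F' where "F' x = (if x \<in> ?K then F x else 0)" for x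
    have F' [measurable]: "F' \<in> borel_measurable lebesgue" and int: "integrable lebesgue F'"
      by (rule loc_ess_bdd_restrict[OF F K], simp add: F'_def[abs_def])+
    have "integrable lebesgue (\<lambda>x. F' x *\<^sub>R D\<phi> x)"
    proof (rule Bochner_Integration.integrable_bound)
      show "integrable lebesgue (\<lambda>x. F' x * C)"
        using int by simp
      show "AE x in lebesgue. norm (F' x *\<^sub>R D\<phi> x) \<le> norm (F' x * C)"
        using C by (auto simp: abs_mult intro!: mult_left_mono)
    qed measurable
    moreover have "(\<lambda>x. F' x *\<^sub>R D\<phi> x) = (\<lambda>x. F x *\<^sub>R D\<phi> x)"
    proof
      fix x
      show "F' x *\<^sub>R D\<phi> x = F x *\<^sub>R D\<phi> x"
        by (cases "x \<in> ?K") (simp_all add: F'_def test_fn_vanishes(2)[OF t])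
    qed
    ultimately show ?thesis by simp
  qed
  show "integrable lebesgue (\<lambda>x. \<phi> x *\<^sub>R G x)" if G: "loc_ess_bdd \<Omega> G"
  proof -
    define G' where "G' x = (if x \<in> ?K then G x else 0)" for x
    have G' [measurable]: "G' \<in> borel_measurable lebesgue" and int: "integrable lebesgue G'"
      by (rule loc_ess_bdd_restrict[OF G K], simp add: G'_def[abs_def])+
    have "integrable lebesgue (\<lambda>x. \<phi> x *\<^sub>R G' x)"
    proof (rule Bochner_Integration.integrable_bound)
      show "integrable lebesgue (\<lambda>x. C *\<^sub>R G' x)"
        using int by simp
      show "AE x in lebesgue. norm (\<phi> x *\<^sub>R G' x) \<le> norm (C *\<^sub>R G' x)"
        using C by (auto intro!: mult_right_mono)
    qed measurable
    moreover have "(\<lambda>x. \<phi> x *\<^sub>R G' x) = (\<lambda>x. \<phi> x *\<^sub>R G x)"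
    proof
      fix x
      show "\<phi> x *\<^sub>R G' x = \<phi> x *\<^sub>R G x"
      proof (cases "x \<in> ?K")
        case False
        then have "\<phi> x = 0"
          by (rule test_fn_vanishes(1)[OF t])
        then show ?thesis by simp
      qed (simp add: G'_def)
    qed
    ultimately show ?thesis by simp
  qed
qed

lemma W1inf_loc_diff:
  assumes u: "W1inf_loc \<Omega> u Du" and v: "W1inf_loc \<Omega> v Dv"
  shows "W1inf_loc \<Omega> (\<lambda>x. u x - v x) (\<lambda>x. Du x - Dv x)"
proof -
  have bd: "loc_ess_bdd \<Omega> u" "loc_ess_bdd \<Omega> Du" "loc_ess_bdd \<Omega> v" "loc_ess_bdd \<Omega> Dv"
    and wk: "weak_grad \<Omega> u Du" "weak_grad \<Omega> v Dv"
    using u v by (auto simp: W1inf_loc_def)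
  have "weak_grad \<Omega> (\<lambda>x. u x - v x) (\<lambda>x. Du x - Dv x)"
    unfolding weak_grad_def
  proof (intro allI impI)
    fix \<phi> D\<phi> assume t: "test_fn \<Omega> \<phi> D\<phi>"
    have "(LINT x|lebesgue. u x *\<^sub>R D\<phi> x) = - (LINT x|lebesgue. \<phi> x *\<^sub>R Du x)"
      "(LINT x|lebesgue. v x *\<^sub>R D\<phi> x) = - (LINT x|lebesgue. \<phi> x *\<^sub>R Dv x)"
      using wk t unfolding weak_grad_def by auto
    then show "(LINT x|lebesgue. (u x - v x) *\<^sub>R D\<phi> x) = - (LINT x|lebesgue. \<phi> x *\<^sub>R (Du x - Dv x))"
      using loc_ess_bdd_mult_test_fn(1)[OF t bd(1)] loc_ess_bdd_mult_test_fn(1)[OF t bd(3)]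
        loc_ess_bdd_mult_test_fn(2)[OF t bd(2)] loc_ess_bdd_mult_test_fn(2)[OF t bd(4)]
      by (simp add: scaleR_diff_left scaleR_diff_right)
  qed
  then show ?thesis
    using bd by (simp add: W1inf_loc_def loc_ess_bdd_diff)
qed

section \<open>Smooth approximation and truncation\<close>

text \<open>Truncation at a level that \<open>U\<close> does not exceed off \<open>L\<close> moves
  the support into \<open>L\<close>, whatever the support of \<open>U\<close> is.\<close>

lemma test_fn_truncated_power:
  assumes deriv: "\<And>x. (U has_derivative (\<lambda>h. DU x \<bullet> h)) (at x)" and cont: "continuous_on UNIV DU"
    and L: "compact L" "L \<subseteq> \<Omega>" and off: "\<And>x. x \<notin> L \<Longrightarrow> U x \<le> k"
  shows "test_fn \<Omega> (\<lambda>x. max 0 (U x - k) ^ Suc (Suc n))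
    (\<lambda>x. (real (Suc (Suc n)) * max 0 (U x - k) ^ Suc n) *\<^sub>R DU x)"
  unfolding test_fn_def
proof (intro conjI allI)
  have U: "continuous_on UNIV U"
    using deriv by (auto intro!: continuous_at_imp_continuous_on has_derivative_continuous)
  show "continuous_on UNIV (\<lambda>x. (real (Suc (Suc n)) * max 0 (U x - k) ^ Suc n) *\<^sub>R DU x)"
    by (intro continuous_intros U cont)
  show "((\<lambda>x. max 0 (U x - k) ^ Suc (Suc n)) has_derivative
      (\<lambda>h. ((real (Suc (Suc n)) * max 0 (U x - k) ^ Suc n) *\<^sub>R DU x) \<bullet> h)) (at x)" for x
  proof -
    have "((\<lambda>t::real. max 0 t ^ Suc (Suc n)) has_derivative (*) (real (Suc (Suc n)) * max 0 (U x - k) ^ Suc n)) (at (U x - k))"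
      using has_real_derivative_max_0_power by (simp only: has_field_derivative_def)
    moreover have "((\<lambda>x. U x - k) has_derivative (\<lambda>h. DU x \<bullet> h)) (at x)"
      using has_derivative_diff[OF deriv[of x] has_derivative_const[of k]] by simp
    ultimately have "((\<lambda>x. max 0 (U x - k) ^ Suc (Suc n)) has_derivative
        (\<lambda>h. real (Suc (Suc n)) * max 0 (U x - k) ^ Suc n * (DU x \<bullet> h))) (at x)"
      by (rule has_derivative_compose[rotated])
    then show ?thesis
      by (simp only: inner_scaleR_left)
  qed
  have "{x. max 0 (U x - k) ^ Suc (Suc n) \<noteq> 0} \<subseteq> L"
    using off by (force simp: max_def split: if_splits)
  then have sub: "closure {x. max 0 (U x - k) ^ Suc (Suc n) \<noteq> 0} \<subseteq> L"
    using L(1) by (intro closure_minimal compact_imp_closed)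
  then show "closure {x. max 0 (U x - k) ^ Suc (Suc n) \<noteq> 0} \<subseteq> \<Omega>"
    using L(2) by blast
  show "compact (closure {x. max 0 (U x - k) ^ Suc (Suc n) \<noteq> 0})"
    using compact_Int_closed[OF L(1) closed_closure] sub by (metis inf.absorb2)
qed

lemma integral_tendsto_bounded_compact:
  fixes F :: "nat \<Rightarrow> 'a::euclidean_space \<Rightarrow> real"
  assumes L: "compact L" and F: "\<And>j. F j \<in> borel_measurable lebesgue" "G \<in> borel_measurable lebesgue"
    and bound: "\<And>j x. x \<in> L \<Longrightarrow> \<bar>F j x\<bar> \<le> C" and off: "\<And>j x. x \<notin> L \<Longrightarrow> F j x = 0"
    and lim: "AE x in lebesgue. (\<lambda>j. F j x) \<longlonglongrightarrow> G x"
  shows "(\<lambda>j. LINT x|lebesgue. F j x) \<longlonglongrightarrow> (LINT x|lebesgue. G x)"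
proof (rule integral_dominated_convergence[OF F(2,1)])
  show "integrable lebesgue (\<lambda>x. C * indicator L x)"
    using lmeasurable_compact[OF L] by (intro integrable_mult_right) (auto simp: fmeasurable_def)
  show "AE x in lebesgue. norm (F j x) \<le> C * indicator L x" for j
    using bound[of _ j] off[of _ j] by (auto split: split_indicator)
qed (rule lim)

text \<open>Here \<open>w\<close> is already extended by zero, and \<open>W\<close> matters only on
  \<open>L\<close>. Off \<open>L\<close> the approximations need not vanish: they stay below
  \<open>k\<^sub>0\<close>, and truncation at any \<open>k \<ge> k\<^sub>0\<close> removes them.
  Gradients are controlled on \<open>L\<close> alone, because mollifying a function cut off outside
  a larger compact set may give large gradients near the cut. That \<open>W\<close> is the gradient
  of \<open>w\<close> is expressed only through the common approximation.\<close>

locale smooth_approximation =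
  fixes L :: "'a::euclidean_space set" and k\<^sub>0 B :: real
    and w :: "'a \<Rightarrow> real" and W :: "'a \<Rightarrow> 'a"
    and U :: "nat \<Rightarrow> 'a \<Rightarrow> real" and DU :: "nat \<Rightarrow> 'a \<Rightarrow> 'a"
  assumes L: "compact L" and k\<^sub>0: "0 \<le> k\<^sub>0"
    and w_meas [measurable]: "w \<in> borel_measurable lebesgue"
    and W_meas [measurable]: "W \<in> borel_measurable lebesgue"
    and w_off: "\<And>x. x \<notin> L \<Longrightarrow> w x = 0"
    and U_deriv: "\<And>j x. (U j has_derivative (\<lambda>h. DU j x \<bullet> h)) (at x)"
    and DU_cont: "\<And>j. continuous_on UNIV (DU j)"
    and U_le: "\<And>j x. \<bar>U j x\<bar> \<le> B"
    and DU_le: "\<And>j x. x \<in> L \<Longrightarrow> norm (DU j x) \<le> B"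
    and U_off: "\<And>j x. x \<notin> L \<Longrightarrow> U j x \<le> k\<^sub>0"
    and U_lim: "AE x in lebesgue. x \<in> L \<longrightarrow> (\<lambda>j. U j x) \<longlonglongrightarrow> w x"
    and DU_lim: "AE x in lebesgue. x \<in> L \<longrightarrow> (\<lambda>j. DU j x) \<longlonglongrightarrow> W x"

text \<open>Two nested compact sets are used: \<open>w\<close> is cut off outside \<open>K\<close>
  and mollified with radii at most \<open>d\<close>. From a point of \<open>L\<close> the kernel
  sees only \<open>K\<close>, so gradients are mollifications of \<open>W\<close>. From a point off
  \<open>L\<close> it sees only values at most \<open>k\<^sub>0\<close>, including the zeros of the
  extension because \<open>k\<^sub>0\<close> is non-negative.\<close>

lemma W1inf_loc_smooth_approximation:
  fixes w :: "'a::euclidean_space \<Rightarrow> real"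
  assumes w: "W1inf_loc \<Omega> w W" and K: "compact K" "K \<subseteq> \<Omega>" and k\<^sub>0: "0 \<le> k\<^sub>0"
    and d: "0 < d" and L: "compact L" "\<And>x. x \<in> L \<Longrightarrow> cball x d \<subseteq> K"
    and out: "\<And>x y. x \<notin> L \<Longrightarrow> dist x y \<le> d \<Longrightarrow> y \<in> K \<Longrightarrow> w y \<le> k\<^sub>0"
  shows "\<exists>B U DU. smooth_approximation L k\<^sub>0 B (\<lambda>x. if x \<in> L then w x else 0) (\<lambda>x. if x \<in> L then W x else 0) U DU"
proof -
  define F where "F x = (if x \<in> K then w x else 0)" for x
  define G where "G x = (if x \<in> K then W x else 0)" for x
  have bd: "loc_ess_bdd \<Omega> w" "loc_ess_bdd \<Omega> W" and weak: "weak_grad \<Omega> w W"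
    using w by (auto simp: W1inf_loc_def)
  obtain B1 where B1: "0 < B1" "AE x in lebesgue. norm (F x) \<le> B1" and F: "F \<in> borel_measurable lebesgue" "integrable lebesgue F"
    by (rule loc_ess_bdd_restrict[OF bd(1) K]) (auto simp: F_def[abs_def])
  obtain B2 where B2: "0 < B2" "AE x in lebesgue. norm (G x) \<le> B2" and G: "G \<in> borel_measurable lebesgue"
    by (rule loc_ess_bdd_restrict[OF bd(2) K]) (auto simp: G_def[abs_def])
  obtain R where "\<And>x. x \<in> K \<Longrightarrow> norm x \<le> R"
    using compact_imp_bounded[OF K(1)] by (auto simp: bounded_iff)
  then have supp: "\<And>x. R < norm x \<Longrightarrow> F x = 0" "\<And>x. R < norm x \<Longrightarrow> G x = 0"
    by (force simp: F_def G_def)+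
  define \<delta> where "\<delta> j = min d 1 / real (Suc j)" for j
  have \<delta>_pos: "0 < \<delta> j" and \<delta>_le: "\<delta> j \<le> d" "\<delta> j \<le> 1" for j
  proof -
    have "min d 1 / real (Suc j) \<le> min d 1 / 1"
      using d by (intro divide_left_mono) auto
    then show "0 < \<delta> j" "\<delta> j \<le> d" "\<delta> j \<le> 1"
      using d by (auto simp: \<delta>_def)
  qed
  have \<delta>_lim: "\<delta> \<longlonglongrightarrow> 0"
    unfolding \<delta>_def using tendsto_mult_right_zero[OF LIMSEQ_inverse_real_of_nat, of "min d 1"]
    by (simp add: divide_inverse)
  have "\<forall>j. \<exists>\<rho> D\<rho>. mollifier (\<delta> j) (\<rho> :: 'a \<Rightarrow> real) D\<rho>"
    using mollifier_exists[OF \<delta>_pos] by blast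
  then obtain \<rho> :: "nat \<Rightarrow> 'a \<Rightarrow> real" and D\<rho> where \<rho>: "\<And>j. mollifier (\<delta> j) (\<rho> j) (D\<rho> j)"
    by metis
  obtain r1 :: "nat \<Rightarrow> nat" where r1: "strict_mono r1" "AE x in lebesgue. (\<lambda>j. mollify (\<rho> (r1 j)) F x) \<longlonglongrightarrow> F x"
    by (rule mollify_AE_subseq[OF \<rho> \<delta>_lim \<delta>_le(2) F(1) B1(2) supp(1)])
  have \<rho>1: "mollifier ((\<delta> \<circ> r1) j) (\<rho> (r1 j)) (D\<rho> (r1 j))" for j
    using \<rho> by simp
  have \<delta>1: "(\<delta> \<circ> r1) \<longlonglongrightarrow> 0" "(\<delta> \<circ> r1) j \<le> 1" for j
    using LIMSEQ_subseq_LIMSEQ[OF \<delta>_lim r1(1)] \<delta>_le(2) by auto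
  \<comment> \<open>Extracted from the first subsequence, so that values and gradients converge
    along the same indices.\<close>
  obtain r2 :: "nat \<Rightarrow> nat" where r2: "strict_mono r2" "AE x in lebesgue. (\<lambda>j. mollify (\<rho> (r1 (r2 j))) G x) \<longlonglongrightarrow> G x"
    by (rule mollify_AE_subseq[OF \<rho>1 \<delta>1 G B2(2) supp(2)])
  define r where "r j = r1 (r2 j)" for j
  define U where "U j = mollify (\<rho> (r j)) F" for j
  define DU where "DU j x = (LINT y|lebesgue. - F y *\<^sub>R D\<rho> (r j) (y - x))" for j x
  have DU_eq: "DU j x = mollify (\<rho> (r j)) G x" if "x \<in> L" for j x
  proof -
    have "cball x (\<delta> (r j)) \<subseteq> K"
      using L(2)[OF that] \<delta>_le(1)[of "r j"] by (auto simp: subset_iff)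
    then show ?thesis
      unfolding DU_def F_def G_def by (rule weak_grad_mollify[OF weak \<rho> _ K(2)])
  qed
  have LK: "L \<subseteq> K"
    using L(2) d by fastforce
  have "smooth_approximation L k\<^sub>0 (max B1 B2) (\<lambda>x. if x \<in> L then w x else 0) (\<lambda>x. if x \<in> L then W x else 0) U DU"
  proof
    show "(\<lambda>x. if x \<in> L then w x else 0) \<in> borel_measurable lebesgue"
      "(\<lambda>x. if x \<in> L then W x else 0) \<in> borel_measurable lebesgue"
      using bd LK K by (auto simp: loc_ess_bdd_def intro!: borel_measurable_restrict_compact[OF _ L(1)])
    show "continuous_on UNIV (DU j)" for j
      unfolding DU_def by (rule mollify_has_derivative(2)[OF \<rho> F(2)])
    show "(U j has_derivative (\<lambda>h. DU j x \<bullet> h)) (at x)" for j x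
      unfolding U_def DU_def by (rule mollify_has_derivative(1)[OF \<rho> F(2)])
    show "\<bar>U j x\<bar> \<le> max B1 B2" for j x
    proof -
      have "AE y in lebesgue. norm (y - x) \<le> \<delta> (r j) \<longrightarrow> norm (F y) \<le> max B1 B2"
        using B1(2) by eventually_elim auto
      from norm_mollify_le[OF \<rho> this] show ?thesis
        by (simp add: U_def)
    qed
    show "norm (DU j x) \<le> max B1 B2" if "x \<in> L" for j x
    proof -
      have "AE y in lebesgue. norm (y - x) \<le> \<delta> (r j) \<longrightarrow> norm (G y) \<le> max B1 B2"
        using B2(2) by eventually_elim auto
      from norm_mollify_le[OF \<rho> this] show ?thesis
        by (simp add: DU_eq[OF that])
    qed
    show "AE x in lebesgue. x \<in> L \<longrightarrow> (\<lambda>j. U j x) \<longlonglongrightarrow> (if x \<in> L then w x else 0)"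
      using r1(2)
    proof eventually_elim
      fix x assume lim: "(\<lambda>j. mollify (\<rho> (r1 j)) F x) \<longlonglongrightarrow> F x"
      show "x \<in> L \<longrightarrow> (\<lambda>j. U j x) \<longlonglongrightarrow> (if x \<in> L then w x else 0)"
        using LIMSEQ_subseq_LIMSEQ[OF lim r2(1)] LK by (auto simp: U_def r_def o_def F_def)
    qed
    show "AE x in lebesgue. x \<in> L \<longrightarrow> (\<lambda>j. DU j x) \<longlonglongrightarrow> (if x \<in> L then W x else 0)"
      using r2(2)
    proof eventually_elim
      fix x assume lim: "(\<lambda>j. mollify (\<rho> (r1 (r2 j))) G x) \<longlonglongrightarrow> G x"
      show "x \<in> L \<longrightarrow> (\<lambda>j. DU j x) \<longlonglongrightarrow> (if x \<in> L then W x else 0)"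
      proof
        assume x: "x \<in> L"
        then have "G x = W x"
          using LK by (auto simp: G_def)
        then show "(\<lambda>j. DU j x) \<longlonglongrightarrow> (if x \<in> L then W x else 0)"
          using lim x by (simp add: DU_eq[OF x] r_def)
      qed
    qed
    show "U j x \<le> k\<^sub>0" if x: "x \<notin> L" for j x
      unfolding U_def
    proof (rule mollify_le[OF \<rho> F(2)], rule AE_I2, rule impI)
      fix y assume "norm (y - x) \<le> \<delta> (r j)"
      then have "dist x y \<le> d"
        using \<delta>_le(1)[of "r j"] by (simp add: dist_norm norm_minus_commute)
      then show "F y \<le> k\<^sub>0"
        using k\<^sub>0 out[OF x] by (simp add: F_def)
    qed
  qed (use L(1) k\<^sub>0 in auto)
  then show ?thesis by blast
qed

section \<open>Truncated approximations and the limit in the weak inequality\<close>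

context smooth_approximation
begin

abbreviation excess :: "real \<Rightarrow> 'a \<Rightarrow> real" where
  "excess k x \<equiv> max 0 (w x - k)"

abbreviation excess_approx :: "real \<Rightarrow> nat \<Rightarrow> 'a \<Rightarrow> real" where
  "excess_approx k j x \<equiv> max 0 (U j x - k)"

lemma U_meas [measurable]: "U j \<in> borel_measurable lebesgue"
proof -
  have "continuous_on UNIV (U j)"
    using U_deriv by (auto intro!: continuous_at_imp_continuous_on has_derivative_continuous)
  then show ?thesis
    by (intro measurable_completion) (simp add: borel_measurable_continuous_onI)
qed

lemma DU_meas [measurable]: "DU j \<in> borel_measurable lebesgue"
  using DU_cont by (intro measurable_completion) (simp add: borel_measurable_continuous_onI)

lemma w_le: "AE x in lebesgue. \<bar>w x\<bar> \<le> B"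
  using U_lim
proof eventually_elim
  fix x assume lim: "x \<in> L \<longrightarrow> (\<lambda>j. U j x) \<longlonglongrightarrow> w x"
  show "\<bar>w x\<bar> \<le> B"
  proof (cases "x \<in> L")
    case True
    with lim have "(\<lambda>j. \<bar>U j x\<bar>) \<longlonglongrightarrow> \<bar>w x\<bar>"
      by (intro tendsto_rabs) auto
    then show ?thesis
      by (rule LIMSEQ_le_const2) (use U_le in auto)
  next
    case False
    then show ?thesis
      using w_off[OF False] order_trans[OF abs_ge_zero U_le[of 0 x]] by simp
  qed
qed

lemma W_le: "AE x in lebesgue. x \<in> L \<longrightarrow> norm (W x) \<le> B"
  using DU_lim
proof eventually_elim
  fix x assume lim: "x \<in> L \<longrightarrow> (\<lambda>j. DU j x) \<longlonglongrightarrow> W x"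
  show "x \<in> L \<longrightarrow> norm (W x) \<le> B"
  proof
    assume x: "x \<in> L"
    with lim have "(\<lambda>j. norm (DU j x)) \<longlonglongrightarrow> norm (W x)"
      by (intro tendsto_norm) auto
    then show "norm (W x) \<le> B"
      by (rule LIMSEQ_le_const2) (use DU_le[OF x] in auto)
  qed
qed

lemma excess_off: "excess k x = 0" "excess_approx k j x = 0" if "k\<^sub>0 \<le> k" "x \<notin> L"
  using that w_off[of x] U_off[of x j] k\<^sub>0 by auto

lemma excess_approx_le: "k\<^sub>0 \<le> k \<Longrightarrow> excess_approx k j x \<le> B"
  using U_le[of j x] k\<^sub>0 by auto

lemma B_nonneg: "0 \<le> B"
  using U_le[of 0 undefined] by linarith

lemma excess_lim:
  assumes k: "k\<^sub>0 \<le> k"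
  shows "AE x in lebesgue. (\<lambda>j. excess_approx k j x) \<longlonglongrightarrow> excess k x"
  using U_lim
proof eventually_elim
  fix x assume lim: "x \<in> L \<longrightarrow> (\<lambda>j. U j x) \<longlonglongrightarrow> w x"
  show "(\<lambda>j. excess_approx k j x) \<longlonglongrightarrow> excess k x"
  proof (cases "x \<in> L")
    case True
    with lim show ?thesis
      by (intro tendsto_intros) auto
  next
    case False
    then show ?thesis
      using excess_off[OF k] by simp
  qed
qed

lemma test_fn_excess:
  assumes "k\<^sub>0 \<le> k" "L \<subseteq> \<Omega>"
  shows "test_fn \<Omega> (\<lambda>x. excess_approx k j x ^ Suc (Suc n))
    (\<lambda>x. (real (Suc (Suc n)) * excess_approx k j x ^ Suc n) *\<^sub>R DU j x)"
  by (rule test_fn_truncated_power[OF U_deriv DU_cont L assms(2)]) (use U_off assms(1) in \<open>force intro: order_trans\<close>)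

text \<open>The test function is the cube of the truncated approximation, with gradient
  \<open>3 * excess_approx k j x ^ 2\<close> times \<open>DU j x\<close>. As \<open>A\<close> and
  \<open>H\<close> are merely integrable, dominated convergence rests on the uniform bound
  \<open>B\<close> for the other factors; off \<open>L\<close> these vanish.\<close>

lemma weak_inequality_limit:
  assumes k: "k\<^sub>0 \<le> k" and \<Omega>: "L \<subseteq> \<Omega>" and A: "integrable lebesgue A" and H: "integrable lebesgue H"
    and weak: "\<And>\<phi> D\<phi>. test_fn \<Omega> \<phi> D\<phi> \<Longrightarrow> (\<And>x. 0 \<le> \<phi> x) \<Longrightarrow> (\<And>x. x \<notin> L \<Longrightarrow> \<phi> x = 0 \<and> D\<phi> x = 0) \<Longrightarrow>
       (LINT x|lebesgue. A x \<bullet> D\<phi> x) \<le> (LINT x|lebesgue. H x * \<phi> x)"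
  shows "(LINT x|lebesgue. (3 * excess k x ^ 2) * (A x \<bullet> W x)) \<le> (LINT x|lebesgue. H x * excess k x ^ 3)"
proof -
  note [measurable] = borel_measurable_integrable[OF A] borel_measurable_integrable[OF H]
  have le: "(LINT x|lebesgue. (3 * excess_approx k j x ^ 2) * (A x \<bullet> DU j x)) \<le> (LINT x|lebesgue. H x * excess_approx k j x ^ 3)" for j
  proof -
    have "test_fn \<Omega> (\<lambda>x. excess_approx k j x ^ 3) (\<lambda>x. (3 * excess_approx k j x ^ 2) *\<^sub>R DU j x)"
      using test_fn_excess[OF k \<Omega>, of j 1] by (simp add: eval_nat_numeral)
    from weak[OF this] show ?thesis
      by (simp add: excess_off[OF k])
  qed
  have pw_le: "\<bar>excess_approx k j x ^ n\<bar> \<le> B ^ n" for j x n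
    using power_mono[OF excess_approx_le[OF k]] by (simp add: power_abs)
  have "(\<lambda>j. LINT x|lebesgue. (3 * excess_approx k j x ^ 2) * (A x \<bullet> DU j x))
      \<longlonglongrightarrow> (LINT x|lebesgue. (3 * excess k x ^ 2) * (A x \<bullet> W x))"
  proof (rule integral_dominated_convergence)
    show "integrable lebesgue (\<lambda>x. 3 * B ^ 2 * B * norm (A x))"
      using A by simp
    show "AE x in lebesgue. (\<lambda>j. (3 * excess_approx k j x ^ 2) * (A x \<bullet> DU j x)) \<longlonglongrightarrow> (3 * excess k x ^ 2) * (A x \<bullet> W x)"
      using excess_lim[OF k] DU_lim
    proof eventually_elim
      fix x assume *: "(\<lambda>j. excess_approx k j x) \<longlonglongrightarrow> excess k x" "x \<in> L \<longrightarrow> (\<lambda>j. DU j x) \<longlonglongrightarrow> W x"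
      show "(\<lambda>j. (3 * excess_approx k j x ^ 2) * (A x \<bullet> DU j x)) \<longlonglongrightarrow> (3 * excess k x ^ 2) * (A x \<bullet> W x)"
      proof (cases "x \<in> L")
        case True
        then show ?thesis
          using * by (intro tendsto_mult tendsto_power tendsto_inner tendsto_norm tendsto_scaleR tendsto_const) auto
      next
        case False
        then show ?thesis
          using excess_off[OF k] by simp
      qed
    qed
    show "AE x in lebesgue. norm ((3 * excess_approx k j x ^ 2) * (A x \<bullet> DU j x)) \<le> 3 * B ^ 2 * B * norm (A x)" for j
    proof (rule AE_I2)
      fix x
      show "norm ((3 * excess_approx k j x ^ 2) * (A x \<bullet> DU j x)) \<le> 3 * B ^ 2 * B * norm (A x)"
      proof (cases "x \<in> L")
        case True
        have "\<bar>A x \<bullet> DU j x\<bar> \<le> norm (A x) * B"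
          using Cauchy_Schwarz_ineq2[of "A x" "DU j x"] mult_left_mono[OF DU_le[OF True, of j] norm_ge_zero[of "A x"]]
          by linarith
        then have "\<bar>excess_approx k j x ^ 2\<bar> * \<bar>A x \<bullet> DU j x\<bar> \<le> B ^ 2 * (norm (A x) * B)"
          using B_nonneg by (intro mult_mono pw_le) auto
        then show ?thesis
          by (simp add: abs_mult algebra_simps)
      next
        case False
        then show ?thesis
          using excess_off[OF k False] B_nonneg by simp
      qed
    qed
  qed measurable
  moreover have "(\<lambda>j. LINT x|lebesgue. H x * excess_approx k j x ^ 3) \<longlonglongrightarrow> (LINT x|lebesgue. H x * excess k x ^ 3)"
  proof (rule integral_dominated_convergence)
    show "integrable lebesgue (\<lambda>x. \<bar>H x\<bar> * B ^ 3)"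
      using H by simp
    show "AE x in lebesgue. (\<lambda>j. H x * excess_approx k j x ^ 3) \<longlonglongrightarrow> H x * excess k x ^ 3"
      using excess_lim[OF k] by eventually_elim (intro tendsto_mult tendsto_power tendsto_inner tendsto_norm tendsto_scaleR tendsto_const)
    show "AE x in lebesgue. norm (H x * excess_approx k j x ^ 3) \<le> \<bar>H x\<bar> * B ^ 3" for j
      using pw_le by (auto simp: abs_mult intro!: mult_left_mono)
  qed measurable
  ultimately show ?thesis
    by (rule LIMSEQ_le) (use le in auto)
qed

lemma excess_integrals_lim:
  assumes k: "k\<^sub>0 \<le> k" and S [measurable]: "S \<in> sets lebesgue"
  shows "(\<lambda>j. LINT x|lebesgue. indicator S x * excess_approx k j x ^ 4) \<longlonglongrightarrow> (LINT x|lebesgue. indicator S x * excess k x ^ 4)"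
    and "(\<lambda>j. LINT x|lebesgue. (norm ((2 * excess_approx k j x) *\<^sub>R DU j x))\<^sup>2)
       \<longlonglongrightarrow> (LINT x|lebesgue. (norm ((2 * excess k x) *\<^sub>R W x))\<^sup>2)"
proof -
  have pw_le: "\<bar>excess_approx k j x ^ n\<bar> \<le> B ^ n" for j x n
    using power_mono[OF excess_approx_le[OF k]] by (simp add: power_abs)
  show "(\<lambda>j. LINT x|lebesgue. indicator S x * excess_approx k j x ^ 4) \<longlonglongrightarrow> (LINT x|lebesgue. indicator S x * excess k x ^ 4)"
  proof (rule integral_tendsto_bounded_compact[OF L])
    show "\<bar>indicator S x * excess_approx k j x ^ 4\<bar> \<le> B ^ 4" for j x
      using pw_le[of j x 4] B_nonneg by (auto split: split_indicator)
    show "AE x in lebesgue. (\<lambda>j. indicator S x * excess_approx k j x ^ 4) \<longlonglongrightarrow> indicator S x * excess k x ^ 4"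
      using excess_lim[OF k] by eventually_elim (intro tendsto_mult tendsto_power tendsto_inner tendsto_norm tendsto_scaleR tendsto_const)
  qed (simp_all add: excess_off[OF k])
  show "(\<lambda>j. LINT x|lebesgue. (norm ((2 * excess_approx k j x) *\<^sub>R DU j x))\<^sup>2)
       \<longlonglongrightarrow> (LINT x|lebesgue. (norm ((2 * excess k x) *\<^sub>R W x))\<^sup>2)"
  proof (rule integral_tendsto_bounded_compact[OF L])
    show "\<bar>(norm ((2 * excess_approx k j x) *\<^sub>R DU j x))\<^sup>2\<bar> \<le> (2 * B * B)\<^sup>2" if "x \<in> L" for j x
    proof -
      have "norm ((2 * excess_approx k j x) *\<^sub>R DU j x) \<le> 2 * B * B"
        using mult_mono[OF excess_approx_le[OF k, of j x] DU_le[OF that, of j] B_nonneg] by simp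
      then show ?thesis
        by (simp only: abs_power2 power_mono norm_ge_zero)
    qed
    show "AE x in lebesgue. (\<lambda>j. (norm ((2 * excess_approx k j x) *\<^sub>R DU j x))\<^sup>2) \<longlonglongrightarrow> (norm ((2 * excess k x) *\<^sub>R W x))\<^sup>2"
      using excess_lim[OF k] DU_lim
    proof eventually_elim
      fix x assume *: "(\<lambda>j. excess_approx k j x) \<longlonglongrightarrow> excess k x" "x \<in> L \<longrightarrow> (\<lambda>j. DU j x) \<longlonglongrightarrow> W x"
      show "(\<lambda>j. (norm ((2 * excess_approx k j x) *\<^sub>R DU j x))\<^sup>2) \<longlonglongrightarrow> (norm ((2 * excess k x) *\<^sub>R W x))\<^sup>2"
      proof (cases "x \<in> L")
        case True
        then show ?thesis
          using * by (intro tendsto_mult tendsto_power tendsto_inner tendsto_norm tendsto_scaleR tendsto_const) auto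
      next
        case False
        then show ?thesis
          using excess_off[OF k] by simp
      qed
    qed
  qed (simp_all add: excess_off[OF k])
qed

end

lemma integrable_bounded_compact:
  fixes F :: "'a::euclidean_space \<Rightarrow> real"
  assumes L: "compact L" and "F \<in> borel_measurable lebesgue" "AE x in lebesgue. x \<in> L \<longrightarrow> \<bar>F x\<bar> \<le> C" "\<And>x. x \<notin> L \<Longrightarrow> F x = 0"
  shows "integrable lebesgue F"
proof -
  obtain R where R: "\<And>x. x \<in> L \<Longrightarrow> norm x \<le> R"
    using compact_imp_bounded[OF L] by (auto simp: bounded_iff)
  show ?thesis
  proof (rule integrable_bounded_support[OF assms(2)])
    show "AE x in lebesgue. norm (F x) \<le> max 0 C"
      using assms(3)
    proof eventually_elim
      fix x assume "x \<in> L \<longrightarrow> \<bar>F x\<bar> \<le> C"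
      then show "norm (F x) \<le> max 0 C"
        using assms(4)[of x] by (cases "x \<in> L") auto
    qed
    show "F x = 0" if "R < norm x" for x
      using R[of x] assms(4)[of x] that by fastforce
  qed
qed

section \<open>Functional inequalities for truncations and the argument at the essential
  supremum\<close>

context smooth_approximation
begin

lemma excess_approx_square_gradient:
  assumes k: "k\<^sub>0 \<le> k"
  shows "test_fn UNIV (\<lambda>x. excess_approx k j x ^ 2) (\<lambda>x. (2 * excess_approx k j x) *\<^sub>R DU j x)"
  using test_fn_excess[OF k subset_UNIV, of j 0] by (simp add: eval_nat_numeral)

lemma excess_approx_integrable:
  assumes k: "k\<^sub>0 \<le> k" and S [measurable]: "S \<in> sets lebesgue"
  shows "integrable lebesgue (\<lambda>x. indicator S x * excess_approx k j x ^ 4)"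
    and "integrable lebesgue (\<lambda>x. (norm ((2 * excess_approx k j x) *\<^sub>R DU j x))\<^sup>2)"
proof -
  show "integrable lebesgue (\<lambda>x. indicator S x * excess_approx k j x ^ 4)"
  proof (rule integrable_bounded_compact[OF L])
    show "AE x in lebesgue. x \<in> L \<longrightarrow> \<bar>indicator S x * excess_approx k j x ^ 4\<bar> \<le> B ^ 4"
    proof (intro AE_I2 impI)
      fix x
      have "\<bar>excess_approx k j x ^ 4\<bar> \<le> B ^ 4"
        using power_mono[OF excess_approx_le[OF k], of j x 4] by (simp add: power_abs)
      then show "\<bar>indicator S x * excess_approx k j x ^ 4\<bar> \<le> B ^ 4"
        using B_nonneg by (auto split: split_indicator)
    qed
  qed (simp_all add: excess_off[OF k])
  show "integrable lebesgue (\<lambda>x. (norm ((2 * excess_approx k j x) *\<^sub>R DU j x))\<^sup>2)"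
  proof (rule integrable_bounded_compact[OF L])
    show "AE x in lebesgue. x \<in> L \<longrightarrow> \<bar>(norm ((2 * excess_approx k j x) *\<^sub>R DU j x))\<^sup>2\<bar> \<le> (2 * B * B)\<^sup>2"
    proof (intro AE_I2 impI)
      fix x assume "x \<in> L"
      then have "norm ((2 * excess_approx k j x) *\<^sub>R DU j x) \<le> 2 * B * B"
        using mult_mono[OF excess_approx_le[OF k, of j x] DU_le[of x j] B_nonneg] by simp
      then show "\<bar>(norm ((2 * excess_approx k j x) *\<^sub>R DU j x))\<^sup>2\<bar> \<le> (2 * B * B)\<^sup>2"
        by (simp only: abs_power2 power_mono norm_ge_zero)
    qed
  qed (simp_all add: excess_off[OF k])
qed

text \<open>The inequalities for C^1 functions apply to the square of the truncated approximation
  and survive the limit, since their constants depend only on \<open>\<epsilon>\<close> and on a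
  radius enclosing \<open>L\<close>. It is essential that \<open>\<kappa>\<close> and
  \<open>P\<close> are fixed before the level \<open>k\<close>.\<close>

lemma excess_functional_inequalities:
  assumes \<epsilon>: "0 < \<epsilon>"
  obtains \<kappa> P where "0 < \<kappa>"
    "\<And>k S. k\<^sub>0 \<le> k \<Longrightarrow> S \<in> sets lebesgue \<Longrightarrow> emeasure lebesgue S \<le> ennreal \<kappa> \<Longrightarrow>
      (LINT x|lebesgue. indicator S x * excess k x ^ 4) \<le> \<epsilon> * (LINT x|lebesgue. (norm ((2 * excess k x) *\<^sub>R W x))\<^sup>2)"
    "\<And>k. k\<^sub>0 \<le> k \<Longrightarrow> (LINT x|lebesgue. excess k x ^ 4) \<le> P * (LINT x|lebesgue. (norm ((2 * excess k x) *\<^sub>R W x))\<^sup>2)"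
proof -
  obtain R where R: "0 < R" "\<And>x. x \<in> L \<Longrightarrow> norm x \<le> R"
    using compact_imp_bounded[OF L] by (auto simp: bounded_pos)
  have supp: "norm x \<le> R" if "k\<^sub>0 \<le> k" "excess_approx k j x ^ 2 \<noteq> 0" for k j x
    using that excess_off(2)[of k x j] R(2)[of x] by (cases "x \<in> L") simp_all
  have transfer: "(LINT x|lebesgue. indicator S x * excess k x ^ 4) \<le> C * (LINT x|lebesgue. (norm ((2 * excess k x) *\<^sub>R W x))\<^sup>2)"
    if k: "k\<^sub>0 \<le> k" and S: "S \<in> sets lebesgue" and C: "0 \<le> C"
      and le: "\<And>j. (\<integral>\<^sup>+x. indicator S x * ennreal ((excess_approx k j x ^ 2)\<^sup>2) \<partial>lborel)
        \<le> ennreal C * (\<integral>\<^sup>+x. ennreal ((norm ((2 * excess_approx k j x) *\<^sub>R DU j x))\<^sup>2) \<partial>lborel)"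
    for k S C
  proof (rule LIMSEQ_le[OF excess_integrals_lim(1)[OF k S] tendsto_mult[OF tendsto_const excess_integrals_lim(2)[OF k S]]])
    have "(LINT x|lebesgue. indicator S x * excess_approx k j x ^ 4)
        \<le> C * (LINT x|lebesgue. (norm ((2 * excess_approx k j x) *\<^sub>R DU j x))\<^sup>2)" for j
    proof -
      have "ennreal (LINT x|lebesgue. indicator S x * excess_approx k j x ^ 4)
          = (\<integral>\<^sup>+x. ennreal (indicator S x * excess_approx k j x ^ 4) \<partial>lebesgue)"
        by (intro nn_integral_eq_integral[symmetric] excess_approx_integrable[OF k S]) (auto split: split_indicator)
      also have "\<dots> = (\<integral>\<^sup>+x. indicator S x * ennreal ((excess_approx k j x ^ 2)\<^sup>2) \<partial>lborel)"
        unfolding nn_integral_completion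
        by (intro nn_integral_cong) (auto split: split_indicator)
      also have "\<dots> \<le> ennreal C * (\<integral>\<^sup>+x. ennreal ((norm ((2 * excess_approx k j x) *\<^sub>R DU j x))\<^sup>2) \<partial>lborel)"
        by (rule le)
      also have "(\<integral>\<^sup>+x. ennreal ((norm ((2 * excess_approx k j x) *\<^sub>R DU j x))\<^sup>2) \<partial>lborel)
          = (\<integral>\<^sup>+x. ennreal ((norm ((2 * excess_approx k j x) *\<^sub>R DU j x))\<^sup>2) \<partial>lebesgue)"
        by (rule nn_integral_completion[symmetric])
      also have "\<dots> = ennreal (LINT x|lebesgue. (norm ((2 * excess_approx k j x) *\<^sub>R DU j x))\<^sup>2)"
        by (intro nn_integral_eq_integral excess_approx_integrable(2)[OF k S]) simp
      finally show ?thesis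
        using C by (simp add: ennreal_mult[symmetric] integral_nonneg_AE)
    qed
    then show "\<exists>N. \<forall>j\<ge>N. (LINT x|lebesgue. indicator S x * excess_approx k j x ^ 4)
        \<le> C * (LINT x|lebesgue. (norm ((2 * excess_approx k j x) *\<^sub>R DU j x))\<^sup>2)"
      by blast
  qed
  obtain \<kappa> where \<kappa>: "0 < \<kappa>"
    "\<forall>S \<Omega> (z :: 'a \<Rightarrow> real) Dz.
      S \<in> sets borel \<and> emeasure lborel S \<le> ennreal \<kappa> \<and> test_fn \<Omega> z Dz \<and> (\<forall>x. z x \<noteq> 0 \<longrightarrow> norm x \<le> R) \<longrightarrow>
       (\<integral>\<^sup>+x. indicator S x * ennreal ((z x)\<^sup>2) \<partial>lborel)
         \<le> ennreal \<epsilon> * (\<integral>\<^sup>+x. ennreal ((norm (Dz x))\<^sup>2) \<partial>lborel)"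
    using L2_on_small_sets[OF R(1) \<epsilon>, where 'a='a] by (elim exE conjE)
  show ?thesis
  proof (rule that[OF \<kappa>(1), of "9 * R\<^sup>2"])
    fix k and S :: "'a set" assume k: "k\<^sub>0 \<le> k" and S: "S \<in> sets lebesgue" "emeasure lebesgue S \<le> ennreal \<kappa>"
    \<comment> \<open>The small-set estimate asks for a Borel set; a Borel superset of the same
      measure only enlarges the left-hand side.\<close>
    obtain S' where S': "S \<subseteq> S'" "S' \<in> sets lborel" "S' - S \<in> null_sets lebesgue"
      "emeasure lebesgue S = emeasure lborel S'"
      by (rule completion_upper[OF S(1)])
    show "(LINT x|lebesgue. indicator S x * excess k x ^ 4) \<le> \<epsilon> * (LINT x|lebesgue. (norm ((2 * excess k x) *\<^sub>R W x))\<^sup>2)"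
    proof (rule transfer[OF k S(1)])
      fix j
      have "(\<integral>\<^sup>+x. indicator S x * ennreal ((excess_approx k j x ^ 2)\<^sup>2) \<partial>lborel)
          \<le> (\<integral>\<^sup>+x. indicator S' x * ennreal ((excess_approx k j x ^ 2)\<^sup>2) \<partial>lborel)"
        using S'(1) by (intro nn_integral_mono mult_right_mono) (auto split: split_indicator)
      also have "\<dots> \<le> ennreal \<epsilon> * (\<integral>\<^sup>+x. ennreal ((norm ((2 * excess_approx k j x) *\<^sub>R DU j x))\<^sup>2) \<partial>lborel)"
        using S S' supp[OF k] excess_approx_square_gradient[OF k, of j]
        by (intro \<kappa>(2)[rule_format] conjI allI impI) simp_all
      finally show "(\<integral>\<^sup>+x. indicator S x * ennreal ((excess_approx k j x ^ 2)\<^sup>2) \<partial>lborel)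
          \<le> ennreal \<epsilon> * (\<integral>\<^sup>+x. ennreal ((norm ((2 * excess_approx k j x) *\<^sub>R DU j x))\<^sup>2) \<partial>lborel)" .
    qed (use \<epsilon> in simp)
  next
    fix k assume k: "k\<^sub>0 \<le> k"
    have "(LINT x|lebesgue. indicator UNIV x * excess k x ^ 4) \<le> (9 * R\<^sup>2) * (LINT x|lebesgue. (norm ((2 * excess k x) *\<^sub>R W x))\<^sup>2)"
    proof (rule transfer[OF k])
      fix j
      show "(\<integral>\<^sup>+x. indicator UNIV x * ennreal ((excess_approx k j x ^ 2)\<^sup>2) \<partial>lborel)
        \<le> ennreal (9 * R\<^sup>2) * (\<integral>\<^sup>+x. ennreal ((norm ((2 * excess_approx k j x) *\<^sub>R DU j x))\<^sup>2) \<partial>lborel)"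
        using poincare_inequality[OF excess_approx_square_gradient[OF k, of j] supp[OF k, of j] R(1)] by simp
    qed auto
    then show "(LINT x|lebesgue. excess k x ^ 4) \<le> (9 * R\<^sup>2) * (LINT x|lebesgue. (norm ((2 * excess k x) *\<^sub>R W x))\<^sup>2)"
      by simp
  qed
qed

lemma excess_le: "k\<^sub>0 \<le> k \<Longrightarrow> AE x in lebesgue. excess k x \<le> B"
  using w_le by eventually_elim (use k\<^sub>0 in auto)

text \<open>The exponent \<open>Suc m\<close> is positive so that the integrand vanishes off
  \<open>L\<close>, beyond which \<open>W\<close> has no bound.\<close>

lemma excess_weighted_integrable:
  assumes k: "k\<^sub>0 \<le> k" and S [measurable]: "S \<in> sets lebesgue"
  shows "integrable lebesgue (\<lambda>x. indicator S x * (norm (W x) ^ n * excess k x ^ Suc m))"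
proof (rule integrable_bounded_compact[OF L])
  show "AE x in lebesgue. x \<in> L \<longrightarrow> \<bar>indicator S x * (norm (W x) ^ n * excess k x ^ Suc m)\<bar> \<le> B ^ n * B ^ Suc m"
    using W_le excess_le[OF k]
  proof eventually_elim
    fix x assume *: "x \<in> L \<longrightarrow> norm (W x) \<le> B" "excess k x \<le> B"
    show "x \<in> L \<longrightarrow> \<bar>indicator S x * (norm (W x) ^ n * excess k x ^ Suc m)\<bar> \<le> B ^ n * B ^ Suc m"
    proof
      assume "x \<in> L"
      then have "norm (W x) ^ n * excess k x ^ Suc m \<le> B ^ n * B ^ Suc m"
        using * B_nonneg by (intro mult_mono power_mono) auto
      then show "\<bar>indicator S x * (norm (W x) ^ n * excess k x ^ Suc m)\<bar> \<le> B ^ n * B ^ Suc m"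
        using B_nonneg by (auto split: split_indicator simp: abs_mult power_abs)
    qed
  qed
qed (simp_all add: excess_off[OF k])

lemma AE_le_of_energy_inequality:
  assumes c: "0 < c" and C: "0 \<le> C"
    and energy: "\<And>k. k\<^sub>0 \<le> k \<Longrightarrow>
      3 * c * (LINT x|lebesgue. norm (W x) ^ 2 * excess k x ^ 2) \<le> C * (LINT x|lebesgue. norm (W x) * excess k x ^ 3)"
  shows "AE x in lebesgue. w x \<le> k\<^sub>0"
proof (rule ccontr)
  assume not: "\<not> (AE x in lebesgue. w x \<le> k\<^sub>0)"
  \<comment> \<open>\<open>T\<close> consists of the essential upper bounds, so \<open>M\<close> is
    the essential supremum. The contradiction will be an essential upper bound below
    \<open>M\<close>.\<close>
  define T where "T = {t. AE x in lebesgue. w x \<le> t}"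
  define M where "M = Inf T"
  have "B \<in> T"
    unfolding T_def using w_le by (auto elim: eventually_mono)
  have T_ge: "k\<^sub>0 < t" if "t \<in> T" for t
  proof (rule ccontr)
    assume "\<not> k\<^sub>0 < t"
    then have "AE x in lebesgue. w x \<le> k\<^sub>0"
      using that unfolding T_def by (auto elim: eventually_mono)
    with not show False ..
  qed
  then have bdd: "bdd_below T"
    by (intro bdd_belowI[of _ k\<^sub>0]) (auto intro: less_imp_le)
  have not_le: "\<not> (AE x in lebesgue. w x \<le> k)" if "k < M" for k
    using cInf_lower[OF _ bdd, of k] that by (auto simp: M_def T_def)
  have M: "AE x in lebesgue. w x \<le> M"
  proof -
    have "AE x in lebesgue. w x \<le> M + 1 / real (Suc n)" for n
    proof -
      obtain t where "t \<in> T" "t < M + 1 / real (Suc n)"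
        using cInf_lessD[of T "M + 1 / real (Suc n)"] \<open>B \<in> T\<close> by (auto simp: M_def)
      then show ?thesis
        unfolding T_def by (auto elim!: eventually_mono)
    qed
    then have "AE x in lebesgue. \<forall>n. w x \<le> M + 1 / real (Suc n)"
      by (simp add: AE_all_countable)
    then show ?thesis
    proof eventually_elim
      fix x assume le: "\<forall>n. w x \<le> M + 1 / real (Suc n)"
      show "w x \<le> M"
      proof (rule field_le_epsilon)
        fix e :: real assume "0 < e"
        then obtain n where "1 / real (Suc n) < e"
          using nat_approx_posE by blast
        with le[rule_format, of n] show "w x \<le> M + e"
          by linarith
      qed
    qed
  qed
  have k0M: "k\<^sub>0 < M"
    using M T_ge by (simp add: T_def)

  let ?E = "{x. w x = M}"
  define V where "V = measure lebesgue L"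
  have V: "0 \<le> V"
    by (simp add: V_def)
  have LV: "integrable lebesgue (indicator L :: 'a \<Rightarrow> real)" "(LINT x|lebesgue. indicator L x) = V"
    using lmeasurable_compact[OF L] by (auto simp: fmeasurable_def V_def)
  have "{x \<in> space lebesgue. w x = M} \<in> sets lebesgue"
    by measurable
  then have [measurable]: "?E \<in> sets lebesgue"
    by simp
  \<comment> \<open>On \<open>?E\<close> the excess over the level \<open>M - d\<close> is exactly
    \<open>d\<close>, so the left side of the energy inequality is at least \<open>d ^ 2\<close>
    times the integral considered here. The right side is of order \<open>d ^ 3\<close>, because the
    excess is at most \<open>d\<close> almost everywhere. Dividing by \<open>d ^ 2\<close> and
    letting \<open>d\<close> tend to 0 forces \<open>W = 0\<close> almost everywhere on
    \<open>?E\<close>.\<close>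
  have J_le: "3 * c * (LINT x|lebesgue. indicator ?E x * norm (W x) ^ 2) \<le> C * B * V * d"
    if d: "0 < d" "d \<le> M - k\<^sub>0" for d
  proof -
    define k where "k = M - d"
    have k: "k\<^sub>0 \<le> k"
      using d by (simp add: k_def)
    have "(3 * c * (LINT x|lebesgue. indicator ?E x * norm (W x) ^ 2)) * d\<^sup>2
        = 3 * c * (LINT x|lebesgue. indicator ?E x * (norm (W x) ^ 2 * excess k x ^ 2))"
    proof -
      have "(\<lambda>x. indicator ?E x * (norm (W x) ^ 2 * excess k x ^ 2)) = (\<lambda>x. (indicator ?E x * norm (W x) ^ 2) * d\<^sup>2)"
        using d by (auto simp: fun_eq_iff k_def split: split_indicator)
      then show ?thesis by simp
    qed
    also have "\<dots> \<le> 3 * c * (LINT x|lebesgue. norm (W x) ^ 2 * excess k x ^ 2)"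
    proof (intro mult_left_mono integral_mono)
      show "integrable lebesgue (\<lambda>x. indicator ?E x * (norm (W x) ^ 2 * excess k x ^ 2))"
        using excess_weighted_integrable[OF k, of ?E 2 1] by (simp add: numeral_2_eq_2)
      show "integrable lebesgue (\<lambda>x. norm (W x) ^ 2 * excess k x ^ 2)"
        using excess_weighted_integrable[OF k, of UNIV 2 1] by (simp add: numeral_2_eq_2)
    qed (use c in \<open>auto split: split_indicator\<close>)
    also have "\<dots> \<le> C * (LINT x|lebesgue. norm (W x) * excess k x ^ 3)"
      by (rule energy[OF k])
    also have "\<dots> \<le> C * (LINT x|lebesgue. (B * d ^ 3) * indicator L x)"
    proof (intro mult_left_mono integral_mono_AE)
      show "integrable lebesgue (\<lambda>x. norm (W x) * excess k x ^ 3)"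
        using excess_weighted_integrable[OF k, of UNIV 1 2] by (simp add: eval_nat_numeral)
      show "integrable lebesgue (\<lambda>x. (B * d ^ 3) * indicator L x)"
        using LV(1) by simp
      show "AE x in lebesgue. norm (W x) * excess k x ^ 3 \<le> (B * d ^ 3) * indicator L x"
        using W_le M
      proof eventually_elim
        fix x assume *: "x \<in> L \<longrightarrow> norm (W x) \<le> B" "w x \<le> M"
        show "norm (W x) * excess k x ^ 3 \<le> (B * d ^ 3) * indicator L x"
        proof (cases "x \<in> L")
          case True
          have "norm (W x) * excess k x ^ 3 \<le> B * d ^ 3"
            using * True d B_nonneg by (intro mult_mono power_mono) (auto simp: k_def)
          then show ?thesis
            using True by simp
        next
          case False
          then show ?thesis
            using excess_off(1)[OF k False] by simp
        qed
      qed
    qed (use C in auto)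
    also have "\<dots> = (C * B * V * d) * d\<^sup>2"
      using LV by (simp add: power3_eq_cube power2_eq_square)
    finally show ?thesis
      using d by simp
  qed
  have WE_int: "integrable lebesgue (\<lambda>x. indicator ?E x * norm (W x) ^ 2)"
  proof (rule integrable_bounded_compact[OF L])
    show "AE x in lebesgue. x \<in> L \<longrightarrow> \<bar>indicator ?E x * norm (W x) ^ 2\<bar> \<le> B ^ 2"
      using W_le
    proof eventually_elim
      fix x assume "x \<in> L \<longrightarrow> norm (W x) \<le> B"
      then show "x \<in> L \<longrightarrow> \<bar>indicator ?E x * norm (W x) ^ 2\<bar> \<le> B ^ 2"
        using power_mono[of "norm (W x)" B 2] by (auto split: split_indicator)
    qed
    show "indicator ?E x * norm (W x) ^ 2 = 0" if "x \<notin> L" for x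
      using w_off[OF that] k0M k\<^sub>0 by simp
  qed simp
  have "3 * c * (LINT x|lebesgue. indicator ?E x * norm (W x) ^ 2) \<le> 0"
  proof (rule field_le_epsilon)
    fix e :: real assume e: "0 < e"
    define d where "d = min (M - k\<^sub>0) (e / (C * B * V + 1))"
    have CBV: "0 \<le> C * B * V"
      using C B_nonneg V by simp
    have d: "0 < d" "d \<le> M - k\<^sub>0" "d \<le> e / (C * B * V + 1)"
      using k0M e CBV by (auto simp: d_def)
    have "C * B * V * d \<le> (C * B * V + 1) * (e / (C * B * V + 1))"
      using d CBV by (intro mult_mono) auto
    also have "\<dots> = e"
      using CBV by simp
    finally show "3 * c * (LINT x|lebesgue. indicator ?E x * norm (W x) ^ 2) \<le> 0 + e"
      using J_le[OF d(1,2)] by linarith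
  qed
  then have "(LINT x|lebesgue. indicator ?E x * norm (W x) ^ 2) = 0"
    using c by (intro antisym integral_nonneg_AE) (auto simp: mult_le_0_iff)
  then have WE: "AE x in lebesgue. indicator ?E x * norm (W x) ^ 2 = 0"
    using integral_nonneg_eq_0_iff_AE[OF WE_int] by simp

  \<comment> \<open>Makes the last term of Young's inequality at most \<open>c * X\<close>, since
    \<open>C ^ 2 / (4 * c) * (\<epsilon> * (4 * X))\<close> equals
    \<open>C ^ 2 / (C ^ 2 + 1) * (c * X)\<close>.\<close>
  define \<epsilon> where "\<epsilon> = c\<^sup>2 / (C\<^sup>2 + 1)"
  have \<epsilon>: "0 < \<epsilon>"
    using c by (simp add: \<epsilon>_def add_nonneg_pos)
  obtain \<kappa> P where \<kappa>: "0 < \<kappa>"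
    "\<And>k S. k\<^sub>0 \<le> k \<Longrightarrow> S \<in> sets lebesgue \<Longrightarrow> emeasure lebesgue S \<le> ennreal \<kappa> \<Longrightarrow>
      (LINT x|lebesgue. indicator S x * excess k x ^ 4) \<le> \<epsilon> * (LINT x|lebesgue. (norm ((2 * excess k x) *\<^sub>R W x))\<^sup>2)"
    and P: "\<And>k. k\<^sub>0 \<le> k \<Longrightarrow> (LINT x|lebesgue. excess k x ^ 4) \<le> P * (LINT x|lebesgue. (norm ((2 * excess k x) *\<^sub>R W x))\<^sup>2)"
    using excess_functional_inequalities[OF \<epsilon>] by blast

  \<comment> \<open>Levels that start at \<open>kn 0 = k\<^sub>0\<close> and increase to
    \<open>M\<close>.\<close>
  define kn where "kn n = M - (M - k\<^sub>0) / real (Suc n)" for n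
  define S where "S n = {x. kn n < w x \<and> W x \<noteq> 0}" for n
  have kn: "k\<^sub>0 \<le> kn n" "kn n < M" for n
  proof -
    have "(M - k\<^sub>0) / real (Suc n) \<le> (M - k\<^sub>0) / 1"
      using k0M by (intro divide_left_mono) auto
    then show "k\<^sub>0 \<le> kn n" "kn n < M"
      using k0M by (auto simp: kn_def)
  qed
  have "{x \<in> space lebesgue. kn n < w x \<and> W x \<noteq> 0} \<in> sets lebesgue" for n
    by measurable
  then have S_meas [measurable]: "S n \<in> sets lebesgue" for n
    by (simp add: S_def)
  have "(\<lambda>n. emeasure lebesgue (S n)) \<longlonglongrightarrow> emeasure lebesgue (\<Inter>n. S n)"
  proof (rule Lim_emeasure_decseq)
    show "range S \<subseteq> sets lebesgue"
      using S_meas by auto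
    have "kn m \<le> kn n" if "m \<le> n" for m n
      unfolding kn_def using k0M that by (intro diff_left_mono divide_left_mono) auto
    then show "decseq S"
      by (auto simp: decseq_def S_def intro: le_less_trans)
    show "emeasure lebesgue (S n) \<noteq> \<infinity>" for n
    proof -
      have "S n \<subseteq> L"
        using w_off kn(1)[of n] k\<^sub>0 by (force simp: S_def)
      then have "emeasure lebesgue (S n) \<le> emeasure lebesgue L"
        using lmeasurable_compact[OF L] by (intro emeasure_mono) (auto simp: fmeasurable_def)
      also have "\<dots> < \<infinity>"
        using lmeasurable_compact[OF L] by (auto simp: fmeasurable_def)
      finally show ?thesis by simp
    qed
  qed
  moreover have "emeasure lebesgue (\<Inter>n. S n) = 0"
  proof -
    \<comment> \<open>A point of every \<open>S n\<close> satisfies \<open>w x \<ge> M\<close> and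
      \<open>W x \<noteq> 0\<close>; almost every such point lies in \<open>?E\<close>, where the
      gradient has just been shown to vanish almost everywhere.\<close>
    have "AE x in lebesgue. x \<notin> (\<Inter>n. S n)"
      using WE M
    proof eventually_elim
      fix x assume x: "indicator ?E x * norm (W x) ^ 2 = 0" "w x \<le> M"
      show "x \<notin> (\<Inter>n. S n)"
      proof
        assume "x \<in> (\<Inter>n. S n)"
        then have "kn n < w x" "W x \<noteq> 0" for n
          by (auto simp: S_def)
        moreover have "kn \<longlonglongrightarrow> M - (M - k\<^sub>0) * 0"
          unfolding kn_def divide_inverse
          by (intro tendsto_diff tendsto_mult tendsto_const LIMSEQ_inverse_real_of_nat)
        ultimately have "M \<le> w x"
          by (intro LIMSEQ_le_const2[of kn M "w x"]) (auto intro: less_imp_le)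
        with x \<open>W x \<noteq> 0\<close> show False
          by simp
      qed
    qed
    moreover have "(\<Inter>n. S n) \<in> sets lebesgue"
      using S_meas by (intro sets.countable_INT) auto
    ultimately show ?thesis
      by (simp only: AE_iff_null_sets[symmetric] null_setsD1)
  qed
  ultimately have "(\<lambda>n. emeasure lebesgue (S n)) \<longlonglongrightarrow> 0"
    by simp
  then have "\<forall>\<^sub>F n in sequentially. emeasure lebesgue (S n) < ennreal \<kappa>"
    by (rule order_tendstoD(2)) (use \<kappa> in simp)
  then obtain n where n: "emeasure lebesgue (S n) < ennreal \<kappa>"
    by (auto simp: eventually_sequentially)
  define k where "k = kn n"
  have k: "k\<^sub>0 \<le> k" "k < M"
    using kn by (auto simp: k_def)
  define X where "X = (LINT x|lebesgue. norm (W x) ^ 2 * excess k x ^ 2)"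
  define Y where "Y = (LINT x|lebesgue. indicator (S n) x * excess k x ^ 4)"
  have X4: "(LINT x|lebesgue. (norm ((2 * excess k x) *\<^sub>R W x))\<^sup>2) = 4 * X"
    unfolding X_def integral_mult_right_zero[symmetric]
    by (intro Bochner_Integration.integral_cong) (simp_all add: power_mult_distrib)
  have X0: "0 \<le> X"
    unfolding X_def by (intro integral_nonneg_AE) simp
  have YX: "Y \<le> \<epsilon> * (4 * X)"
    unfolding Y_def X4[symmetric] using n by (intro \<kappa>(2) k S_meas) simp
  have int2: "integrable lebesgue (\<lambda>x. norm (W x) ^ 2 * excess k x ^ 2)"
    using excess_weighted_integrable[OF k(1), of UNIV 2 1] by (simp add: numeral_2_eq_2)
  have int3: "integrable lebesgue (\<lambda>x. norm (W x) * excess k x ^ 3)"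
    using excess_weighted_integrable[OF k(1), of UNIV 1 2] by (simp add: eval_nat_numeral)
  have int4: "integrable lebesgue (\<lambda>x. indicator (S n) x * excess k x ^ 4)"
    using excess_weighted_integrable[OF k(1), of "S n" 0 3] by (simp add: eval_nat_numeral)
  have int4': "integrable lebesgue (\<lambda>x. excess k x ^ 4)"
    using excess_weighted_integrable[OF k(1), of UNIV 0 3] by (simp add: eval_nat_numeral)
  have "3 * c * X \<le> (LINT x|lebesgue. C * (norm (W x) * excess k x ^ 3))"
    using energy[OF k(1)] by (simp add: X_def)
  also have "\<dots> \<le> (LINT x|lebesgue. c * (norm (W x) ^ 2 * excess k x ^ 2) + (C\<^sup>2 / (4 * c)) * (indicator (S n) x * excess k x ^ 4))"
  proof (rule integral_mono)
    fix x
    let ?s = "excess k x" and ?N = "norm (W x)"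
    \<comment> \<open>Young's inequality by completing a square, weighted so that the gradient term
      costs only one of the three copies of \<open>c * X\<close> on the left.\<close>
    have amgm: "C * (?N * ?s ^ 3) \<le> c * (?N ^ 2 * ?s ^ 2) + (C\<^sup>2 / (4 * c)) * ?s ^ 4"
    proof -
      have "0 \<le> (2 * c * ?N * ?s - C * ?s ^ 2)\<^sup>2 / (4 * c)"
        using c by simp
      also have "\<dots> = c * (?N ^ 2 * ?s ^ 2) + (C\<^sup>2 / (4 * c)) * ?s ^ 4 - C * (?N * ?s ^ 3)"
        using c by (simp add: field_simps power2_eq_square power3_eq_cube power4_eq_xxxx)
      finally show ?thesis by simp
    qed
    show "C * (?N * ?s ^ 3) \<le> c * (?N ^ 2 * ?s ^ 2) + (C\<^sup>2 / (4 * c)) * (indicator (S n) x * ?s ^ 4)"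
    proof (cases "x \<in> S n")
      case True
      then show ?thesis
        using amgm by simp
    next
      case False
      \<comment> \<open>Outside \<open>S n\<close> the left side is zero. This restriction to
        \<open>S n\<close> is possible because every term of the energy inequality carries a factor
        \<open>norm (W x)\<close>.\<close>
      then have "?s = 0 \<or> ?N = 0"
        by (auto simp: S_def k_def)
      then show ?thesis
        using False by auto
    qed
  qed (use int2 int3 int4 in auto)
  also have "\<dots> = c * X + (C\<^sup>2 / (4 * c)) * Y"
    unfolding X_def Y_def using int2 int4 by simp
  also have "\<dots> \<le> c * X + (C\<^sup>2 / (4 * c)) * (\<epsilon> * (4 * X))"
    using YX c by (intro add_left_mono mult_left_mono) auto
  also have "(C\<^sup>2 / (4 * c)) * (\<epsilon> * (4 * X)) = (C\<^sup>2 / (C\<^sup>2 + 1)) * (c * X)"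
    using c by (simp add: \<epsilon>_def power2_eq_square)
  also have "\<dots> \<le> 1 * (c * X)"
    using c X0 by (intro mult_right_mono) (auto simp: divide_le_eq add_nonneg_pos)
  finally have "c * X \<le> 0"
    by (simp add: mult.commute)
  with c X0 have "X = 0"
    by (simp add: mult_le_0_iff)
  \<comment> \<open>Poincare's inequality turns the vanishing gradient energy into vanishing excess,
    so \<open>k\<close> is an essential upper bound although \<open>k < M\<close>.\<close>
  then have "(LINT x|lebesgue. excess k x ^ 4) = 0"
    using P[OF k(1)] unfolding X4 by (intro antisym integral_nonneg_AE) auto
  then have "AE x in lebesgue. excess k x ^ 4 = 0"
    using integral_nonneg_eq_0_iff_AE[OF int4'] by simp
  then have "AE x in lebesgue. w x \<le> k"
    by eventually_elim auto
  with not_le[OF k(2)] show False ..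
qed

end

section \<open>Structure of the equation\<close>

text \<open>Points of the frontier have distance 0 to it, so \<open>\<Omega>\<close> may be replaced
  by its closure, and the set is closed and bounded.\<close>

lemma compact_inner_parallel_set:
  fixes \<Omega> :: "'a::euclidean_space set"
  assumes "open \<Omega>" "bounded \<Omega>" "0 < r"
  shows "compact {x \<in> \<Omega>. r \<le> infdist x (frontier \<Omega>)}"
proof -
  have "{x \<in> \<Omega>. r \<le> infdist x (frontier \<Omega>)} = closure \<Omega> \<inter> {x. r \<le> infdist x (frontier \<Omega>)}"
  proof (intro equalityI subsetI)
    fix x assume x: "x \<in> closure \<Omega> \<inter> {x. r \<le> infdist x (frontier \<Omega>)}"
    then have "x \<notin> frontier \<Omega>"
      using assms(3) infdist_zero[of x "frontier \<Omega>"] by auto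
    then show "x \<in> {x \<in> \<Omega>. r \<le> infdist x (frontier \<Omega>)}"
      using x assms(1) by (auto simp: frontier_def interior_open)
  qed (use closure_subset in auto)
  moreover have "closed {x. r \<le> infdist x (frontier \<Omega>)}"
    by (intro closed_Collect_le continuous_intros)
  ultimately show ?thesis
    using assms(2) by (auto intro: compact_Int_closed)
qed

text \<open>A segment of length at most \<open>s\<close> from \<open>x\<close> to a point outside
  \<open>\<Omega>\<close> would meet the frontier, which is at distance at least
  \<open>r + s\<close> from \<open>x\<close>.\<close>

lemma cball_subset_inner_parallel_set:
  fixes \<Omega> :: "'a::euclidean_space set"
  assumes x: "x \<in> \<Omega>" "r + s \<le> infdist x (frontier \<Omega>)" and r: "0 < r"
  shows "cball x s \<subseteq> {y \<in> \<Omega>. r \<le> infdist y (frontier \<Omega>)}"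
proof
  fix y assume y: "y \<in> cball x s"
  have "y \<in> \<Omega>"
  proof (rule ccontr)
    assume "y \<notin> \<Omega>"
    then have "closed_segment x y \<inter> frontier \<Omega> \<noteq> {}"
      using x(1) by (intro connected_Int_frontier) (auto intro: ends_in_segment)
    then obtain p where p: "p \<in> closed_segment x y" "p \<in> frontier \<Omega>"
      by blast
    have "infdist x (frontier \<Omega>) \<le> dist x p"
      by (rule infdist_le[OF p(2)])
    also have "\<dots> \<le> dist x y"
      using p(1) segment_bound(1)[of p x y] by (simp add: dist_norm norm_minus_commute)
    finally show False
      using x(2) r y by simp
  qed
  moreover have "infdist x (frontier \<Omega>) \<le> infdist y (frontier \<Omega>) + dist x y"
    by (rule infdist_triangle)
  ultimately show "y \<in> {y \<in> \<Omega>. r \<le> infdist y (frontier \<Omega>)}"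
    using x(2) y by simp
qed

text \<open>Approximate \<open>F\<close> by simple functions: with finitely many values
  measurability in \<open>x\<close> is enough, and continuity in the second argument passes to the
  limit.\<close>

lemma caratheodory_measurable:
  fixes a :: "'a \<Rightarrow> 'b::euclidean_space \<Rightarrow> 'c::euclidean_space"
  assumes a: "\<And>\<xi>. (\<lambda>x. a x \<xi>) \<in> borel_measurable M" "\<And>x. x \<in> space M \<Longrightarrow> continuous_on UNIV (a x)"
    and F: "F \<in> borel_measurable M"
  shows "(\<lambda>x. a x (F x)) \<in> borel_measurable M"
proof -
  obtain S where S: "\<And>i. simple_function M (S i)" "\<And>x. x \<in> space M \<Longrightarrow> (\<lambda>i. S i x) \<longlonglongrightarrow> F x"
    using borel_measurable_implies_sequence_metric[OF F, of 0] by blast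
  show ?thesis
  proof (rule borel_measurable_LIMSEQ_metric)
    fix i
    have "S i \<in> M \<rightarrow>\<^sub>M count_space (S i ` space M)"
      using S(1)[of i] by (subst measurable_count_space_eq_countable)
        (auto simp: simple_function_def countable_finite)
    then show "(\<lambda>x. a x (S i x)) \<in> borel_measurable M"
      by (rule measurable_compose_countable'[where f="\<lambda>\<xi> x. a x \<xi>", OF a(1)])
        (use S(1)[of i] in \<open>auto simp: simple_function_def countable_finite\<close>)
  next
    fix x assume x: "x \<in> space M"
    then have "isCont (a x) (F x)"
      using a(2) by (simp add: continuous_on_eq_continuous_at)
    then show "(\<lambda>i. a x (S i x)) \<longlonglongrightarrow> a x (F x)"
      using S(2)[OF x] by (rule isCont_tendsto_compose)
  qed
qed

lemma borel_measurable_continuous_superposition: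
  fixes g :: "'a::euclidean_space \<Rightarrow> real \<Rightarrow> real"
  assumes g: "continuous_on (\<Omega> \<times> UNIV) (\<lambda>(x, t). g x t)" and v: "v \<in> borel_measurable (lebesgue_on \<Omega>)"
  shows "(\<lambda>x. g x (v x)) \<in> borel_measurable (lebesgue_on \<Omega>)"
proof -
  have "(\<lambda>x. x) \<in> lebesgue_on \<Omega> \<rightarrow>\<^sub>M borel"
    by (intro measurable_restrict_space1 measurable_completion) simp
  then have "(\<lambda>x. (x, v x)) \<in> borel_measurable (lebesgue_on \<Omega>)"
    using v by (rule borel_measurable_Pair)
  then have "(\<lambda>x. (x, v x)) \<in> lebesgue_on \<Omega> \<rightarrow>\<^sub>M restrict_space borel (\<Omega> \<times> UNIV)"
    by (intro measurable_restrict_space2) auto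
  from measurable_compose[OF this borel_measurable_continuous_on_restrict[OF g]] show ?thesis
    by simp
qed

section \<open>Moduli of continuity of the power function and the lower order terms\<close>

lemma powr_lipschitz:
  fixes \<sigma> b s t :: real
  assumes \<sigma>: "1 \<le> \<sigma>" and s: "0 \<le> s" "s \<le> b" and t: "0 \<le> t" "t \<le> b"
  shows "\<bar>s powr \<sigma> - t powr \<sigma>\<bar> \<le> \<sigma> * b powr (\<sigma> - 1) * \<bar>s - t\<bar>"
proof -
  have main: "y powr \<sigma> - x powr \<sigma> \<le> \<sigma> * b powr (\<sigma> - 1) * (y - x)" if xy: "0 \<le> x" "x < y" "y \<le> b" for x y
  proof -
    have "continuous_on {x..y} (\<lambda>t. t powr \<sigma>)"
      using \<sigma> xy by (intro continuous_on_powr') (auto intro: continuous_intros)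
    moreover have deriv: "((\<lambda>t. t powr \<sigma>) has_real_derivative \<sigma> * z powr (\<sigma> - 1)) (at z)" if "x < z" for z
      using that xy by (intro has_real_derivative_powr) auto
    then have "(\<lambda>t. t powr \<sigma>) differentiable (at z)" if "x < z" for z
      using that by (auto simp: real_differentiable_def)
    ultimately obtain l z where z: "x < z" "z < y" "((\<lambda>t. t powr \<sigma>) has_real_derivative l) (at z)"
      and l: "y powr \<sigma> - x powr \<sigma> = (y - x) * l"
      using MVT[OF xy(2), of "\<lambda>t. t powr \<sigma>"] by blast
    have l_eq: "l = \<sigma> * z powr (\<sigma> - 1)"
      using DERIV_unique[OF z(3) deriv[OF z(1)]] .
    have "z powr (\<sigma> - 1) \<le> b powr (\<sigma> - 1)"
      using z xy \<sigma> by (intro powr_mono2) auto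
    then have "(y - x) * (\<sigma> * z powr (\<sigma> - 1)) \<le> (y - x) * (\<sigma> * b powr (\<sigma> - 1))"
      using xy \<sigma> by (intro mult_left_mono) auto
    then show ?thesis
      using l l_eq by (simp add: mult.commute mult.left_commute)
  qed
  consider "s < t" | "t < s" | "s = t" by linarith
  then show ?thesis
  proof cases
    case 1
    then show ?thesis
      using main[OF s(1) 1 t(2)] powr_mono2[of \<sigma> s t] \<sigma> s by simp
  next
    case 2
    then show ?thesis
      using main[OF t(1) 2 s(2)] powr_mono2[of \<sigma> t s] \<sigma> t by simp
  qed simp
qed

text \<open>Uniform continuity handles arguments closer than some \<open>d\<close> at the cost
  \<open>e\<close>; for the others the slope \<open>b powr \<sigma> / d\<close> suffices. The
  additive error may thus be prescribed, at the expense of \<open>C\<close>.\<close>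

lemma powr_almost_lipschitz:
  fixes \<sigma> b e :: real
  assumes \<sigma>: "0 < \<sigma>" and e: "0 < e"
  obtains C where "0 \<le> C" "\<And>s t. 0 \<le> s \<Longrightarrow> s \<le> b \<Longrightarrow> 0 \<le> t \<Longrightarrow> t \<le> b \<Longrightarrow> \<bar>s powr \<sigma> - t powr \<sigma>\<bar> \<le> e + C * \<bar>s - t\<bar>"
proof -
  have "continuous_on {0..b} (\<lambda>t. t powr \<sigma>)"
    using \<sigma> by (intro continuous_on_powr') (auto intro: continuous_intros)
  then have "uniformly_continuous_on {0..b} (\<lambda>t. t powr \<sigma>)"
    by (intro compact_uniformly_continuous) auto
  then obtain d where d: "0 < d" "\<And>s t. s \<in> {0..b} \<Longrightarrow> t \<in> {0..b} \<Longrightarrow> dist t s < d \<Longrightarrow> dist (t powr \<sigma>) (s powr \<sigma>) < e"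
    using e unfolding uniformly_continuous_on_def by metis
  show ?thesis
  proof (rule that[of "b powr \<sigma> / d"])
    show "0 \<le> b powr \<sigma> / d"
      using d by simp
    fix s t assume st: "0 \<le> s" "s \<le> b" "0 \<le> t" "t \<le> b"
    show "\<bar>s powr \<sigma> - t powr \<sigma>\<bar> \<le> e + b powr \<sigma> / d * \<bar>s - t\<bar>"
    proof (cases "\<bar>s - t\<bar> < d")
      case True
      then have "\<bar>s powr \<sigma> - t powr \<sigma>\<bar> < e"
        using d(2)[of t s] st by (simp add: dist_real_def)
      moreover have "0 \<le> b powr \<sigma> / d * \<bar>s - t\<bar>"
        using d by simp
      ultimately show ?thesis by linarith
    next
      case False
      have "s powr \<sigma> \<le> b powr \<sigma>" "t powr \<sigma> \<le> b powr \<sigma>" "0 \<le> s powr \<sigma>" "0 \<le> t powr \<sigma>"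
        using st \<sigma> by (auto intro: powr_mono2)
      then have "\<bar>s powr \<sigma> - t powr \<sigma>\<bar> \<le> b powr \<sigma>"
        by linarith
      also have "\<dots> = b powr \<sigma> / d * d"
        using d(1) by simp
      also have "\<dots> \<le> b powr \<sigma> / d * \<bar>s - t\<bar>"
        using False d by (intro mult_left_mono) auto
      finally show ?thesis
        using e by simp
    qed
  qed
qed

text \<open>For \<open>\<sigma> < 1\<close> the map \<open>t \<mapsto> t powr \<sigma>\<close> is not Lipschitz at \<open>0\<close>; there the strict monotonicity of \<open>f\<close>
  yields a gap \<open>\<delta> > 0\<close> that absorbs the error.\<close>

lemma lower_order_terms_le:
  fixes f g :: "'a::euclidean_space \<Rightarrow> real \<Rightarrow> real"
  assumes L: "compact L" "L \<subseteq> \<Omega>" and k: "0 < k" and b: "0 < b" and \<sigma>: "0 < \<sigma>"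
    and f: "continuous_on (\<Omega> \<times> UNIV) (\<lambda>(x, t). f x t)" "\<And>x. x \<in> \<Omega> \<Longrightarrow> mono (f x)"
    and g: "continuous_on (\<Omega> \<times> UNIV) (\<lambda>(x, t). g x t)" "\<And>x. x \<in> \<Omega> \<Longrightarrow> mono (g x)"
    and cases: "(\<sigma> < 1 \<and> (\<forall>x\<in>\<Omega>. strict_mono (f x))) \<or> 1 \<le> \<sigma>"
  shows "\<exists>C\<ge>0. \<forall>x s t (\<xi> :: 'b::euclidean_space) \<eta>. x \<in> L \<and> \<bar>s\<bar> \<le> b \<and> \<bar>t\<bar> \<le> b \<and> norm \<xi> \<le> b \<and> norm \<eta> \<le> b \<and> k \<le> s - t \<longrightarrow>
    f x t + g x t * norm \<eta> powr \<sigma> - f x s - g x s * norm \<xi> powr \<sigma> \<le> C * norm (\<xi> - \<eta>)"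
proof -
  have "compact (L \<times> {-b..b})"
    using L by (intro compact_Times) auto
  then have "bounded ((\<lambda>(x, t). g x t) ` (L \<times> {-b..b}))"
    by (intro compact_imp_bounded compact_continuous_image continuous_on_subset[OF g(1)]) (use L in auto)
  then obtain \<Gamma> where "0 < \<Gamma>" "\<forall>x\<in>L. \<forall>t\<in>{-b..b}. \<bar>g x t\<bar> \<le> \<Gamma>"
    by (auto simp: bounded_pos)
  then have \<Gamma>: "0 < \<Gamma>" "\<And>x t. x \<in> L \<Longrightarrow> \<bar>t\<bar> \<le> b \<Longrightarrow> \<bar>g x t\<bar> \<le> \<Gamma>"
    by (auto simp: abs_le_iff)
  \<comment> \<open>Both cases are brought to one form: a gap \<open>\<delta>\<close> in
    \<open>f\<close>, equal to 0 when \<open>1 \<le> \<sigma>\<close>, that pays for the additive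
    error in the modulus of continuity of the power.\<close>
  have "\<exists>\<delta> C. 0 \<le> \<delta> \<and> 0 \<le> C \<and> (\<forall>x s t. x \<in> L \<and> \<bar>s\<bar> \<le> b \<and> \<bar>t\<bar> \<le> b \<and> k \<le> s - t \<longrightarrow> f x t - f x s \<le> - \<delta>) \<and>
     (\<forall>s t. 0 \<le> s \<and> s \<le> b \<and> 0 \<le> t \<and> t \<le> b \<longrightarrow> \<Gamma> * \<bar>s powr \<sigma> - t powr \<sigma>\<bar> \<le> \<delta> + C * \<bar>s - t\<bar>)"
    using cases
  proof
    assume \<sigma>1: "1 \<le> \<sigma>"
    show ?thesis
    proof (rule exI[of _ 0], rule exI[of _ "\<Gamma> * (\<sigma> * b powr (\<sigma> - 1))"], intro conjI allI impI)
      show "f x t - f x s \<le> - 0" if "x \<in> L \<and> \<bar>s\<bar> \<le> b \<and> \<bar>t\<bar> \<le> b \<and> k \<le> s - t" for x s t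
        using that k L monoD[OF f(2), of x t s] by auto
      show "\<Gamma> * \<bar>s powr \<sigma> - t powr \<sigma>\<bar> \<le> 0 + \<Gamma> * (\<sigma> * b powr (\<sigma> - 1)) * \<bar>s - t\<bar>"
        if "0 \<le> s \<and> s \<le> b \<and> 0 \<le> t \<and> t \<le> b" for s t
        using mult_left_mono[OF powr_lipschitz[OF \<sigma>1, of s b t], of \<Gamma>] that \<Gamma>(1) by (simp add: mult.assoc)
    qed (use \<Gamma> \<sigma> in auto)
  next
    assume "\<sigma> < 1 \<and> (\<forall>x\<in>\<Omega>. strict_mono (f x))"
    then have sm: "\<And>x. x \<in> \<Omega> \<Longrightarrow> strict_mono (f x)"
      by blast
    \<comment> \<open>Pointwise strict monotonicity becomes a uniform gap: the continuous positive
      function \<open>f x (t + k) - f x t\<close> attains its minimum on a compact set. That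
      \<open>t + k\<close> may exceed \<open>b\<close> is harmless, as \<open>f\<close> is
      continuous for all real arguments.\<close>
    obtain \<delta> where \<delta>: "0 < \<delta>" "\<And>x t. x \<in> L \<Longrightarrow> \<bar>t\<bar> \<le> b \<Longrightarrow> \<delta> \<le> f x (t + k) - f x t"
    proof (cases "L = {}")
      case True
      then show ?thesis
        using that[of 1] by simp
    next
      case False
      have c1: "continuous_on (L \<times> {-b..b}) (\<lambda>q. f (fst q) (snd q + k))"
      proof -
        have "continuous_on (L \<times> {-b..b}) (\<lambda>q. (fst q, snd q + k))"
          by (intro continuous_intros)
        moreover have "(\<lambda>q. (fst q, snd q + k)) ` (L \<times> {-b..b}) \<subseteq> \<Omega> \<times> UNIV"
          using L by auto
        ultimately show ?thesis
          using continuous_on_compose2[OF f(1)] by fastforce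
      qed
      have c2: "continuous_on (L \<times> {-b..b}) (\<lambda>q. f (fst q) (snd q))"
        using continuous_on_subset[OF f(1), of "L \<times> {-b..b}"] L by (auto simp: case_prod_beta')
      have "L \<times> {-b..b} \<noteq> {}"
        using False b by auto
      from continuous_attains_inf[OF \<open>compact (L \<times> {-b..b})\<close> this continuous_on_diff[OF c1 c2]]
      obtain q where q: "q \<in> L \<times> {-b..b}"
        "\<And>p. p \<in> L \<times> {-b..b} \<Longrightarrow> f (fst q) (snd q + k) - f (fst q) (snd q) \<le> f (fst p) (snd p + k) - f (fst p) (snd p)"
        by blast
      show ?thesis
      proof (rule that)
        have "fst q \<in> \<Omega>"
          using q(1) L by auto
        then show "0 < f (fst q) (snd q + k) - f (fst q) (snd q)"
          using strict_monoD[OF sm, of "fst q" "snd q" "snd q + k"] k by simp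
        show "f (fst q) (snd q + k) - f (fst q) (snd q) \<le> f x (t + k) - f x t" if "x \<in> L" "\<bar>t\<bar> \<le> b" for x t
          using q(2)[of "(x, t)"] that by (simp add: abs_le_iff)
      qed
    qed
    \<comment> \<open>The error is \<open>\<delta> / \<Gamma>\<close> because the difference of
      powers will be multiplied by \<open>\<Gamma>\<close>, the bound for \<open>g\<close>.\<close>
    obtain C where C: "0 \<le> C" "\<And>s t. 0 \<le> s \<Longrightarrow> s \<le> b \<Longrightarrow> 0 \<le> t \<Longrightarrow> t \<le> b \<Longrightarrow> \<bar>s powr \<sigma> - t powr \<sigma>\<bar> \<le> \<delta> / \<Gamma> + C * \<bar>s - t\<bar>"
      using powr_almost_lipschitz[OF \<sigma> divide_pos_pos[OF \<delta>(1) \<Gamma>(1)]] by metis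
    show ?thesis
    proof (rule exI[of _ \<delta>], rule exI[of _ "\<Gamma> * C"], intro conjI allI impI)
      show "f x t - f x s \<le> - \<delta>" if "x \<in> L \<and> \<bar>s\<bar> \<le> b \<and> \<bar>t\<bar> \<le> b \<and> k \<le> s - t" for x s t
      proof -
        have "f x (t + k) \<le> f x s"
          using that L by (intro monoD[OF f(2)]) auto
        then show ?thesis
          using \<delta>(2)[of x t] that by linarith
      qed
      show "\<Gamma> * \<bar>s powr \<sigma> - t powr \<sigma>\<bar> \<le> \<delta> + \<Gamma> * C * \<bar>s - t\<bar>"
        if "0 \<le> s \<and> s \<le> b \<and> 0 \<le> t \<and> t \<le> b" for s t
        using mult_left_mono[OF C(2)[of s t], of \<Gamma>] that \<Gamma>(1) by (simp add: distrib_left mult.assoc)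
    qed (use \<delta> \<Gamma> C in auto)
  qed
  then obtain \<delta> C where \<delta>C: "0 \<le> C"
    "\<And>x s t. x \<in> L \<Longrightarrow> \<bar>s\<bar> \<le> b \<Longrightarrow> \<bar>t\<bar> \<le> b \<Longrightarrow> k \<le> s - t \<Longrightarrow> f x t - f x s \<le> - \<delta>"
    "\<And>s t. 0 \<le> s \<Longrightarrow> s \<le> b \<Longrightarrow> 0 \<le> t \<Longrightarrow> t \<le> b \<Longrightarrow> \<Gamma> * \<bar>s powr \<sigma> - t powr \<sigma>\<bar> \<le> \<delta> + C * \<bar>s - t\<bar>"
    by metis
  show ?thesis
  proof (intro exI[of _ C] conjI allI impI \<delta>C(1))
    fix x s t and \<xi> \<eta> :: 'b
    assume as: "x \<in> L \<and> \<bar>s\<bar> \<le> b \<and> \<bar>t\<bar> \<le> b \<and> norm \<xi> \<le> b \<and> norm \<eta> \<le> b \<and> k \<le> s - t"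
    then have x: "x \<in> L" "x \<in> \<Omega>" and ts: "t \<le> s"
      using L k by auto
    \<comment> \<open>Monotonicity of \<open>g\<close> gives both powers the same coefficient
      \<open>g x s\<close>; from here on only the size of \<open>g\<close> counts, not its
      sign.\<close>
    have "g x t * norm \<eta> powr \<sigma> \<le> g x s * norm \<eta> powr \<sigma>"
      using monoD[OF g(2)[OF x(2)] ts] by (intro mult_right_mono) auto
    moreover have "g x s * (norm \<eta> powr \<sigma> - norm \<xi> powr \<sigma>) \<le> \<Gamma> * \<bar>norm \<xi> powr \<sigma> - norm \<eta> powr \<sigma>\<bar>"
    proof -
      have "g x s * (norm \<eta> powr \<sigma> - norm \<xi> powr \<sigma>) \<le> \<bar>g x s\<bar> * \<bar>norm \<eta> powr \<sigma> - norm \<xi> powr \<sigma>\<bar>"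
        by (metis abs_ge_self abs_mult)
      also have "\<dots> \<le> \<Gamma> * \<bar>norm \<eta> powr \<sigma> - norm \<xi> powr \<sigma>\<bar>"
        using \<Gamma>(2)[OF x(1)] as by (intro mult_right_mono) auto
      finally show ?thesis
        by (simp add: abs_minus_commute)
    qed
    moreover have "\<Gamma> * \<bar>norm \<xi> powr \<sigma> - norm \<eta> powr \<sigma>\<bar> \<le> \<delta> + C * \<bar>norm \<xi> - norm \<eta>\<bar>"
      using as by (intro \<delta>C(3)) auto
    moreover have "C * \<bar>norm \<xi> - norm \<eta>\<bar> \<le> C * norm (\<xi> - \<eta>)"
      using \<delta>C(1) by (intro mult_left_mono norm_triangle_ineq3)
    moreover have "f x t - f x s \<le> - \<delta>"
      using as by (intro \<delta>C(2)) auto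
    ultimately show "f x t + g x t * norm \<eta> powr \<sigma> - f x s - g x s * norm \<xi> powr \<sigma> \<le> C * norm (\<xi> - \<eta>)"
      by (simp add: right_diff_distrib)
  qed
qed

section \<open>Comparison principle\<close>

lemma set_integrable_restrict:
  fixes F :: "'a::euclidean_space \<Rightarrow> 'b::euclidean_space"
  assumes "set_integrable lebesgue L F"
  shows "integrable lebesgue (\<lambda>x. if x \<in> L then F x else 0)"
proof -
  have "(\<lambda>x. indicator L x *\<^sub>R F x) = (\<lambda>x. if x \<in> L then F x else 0)"
    by (auto simp: indicator_def)
  then show ?thesis
    using assms by (simp add: set_integrable_def)
qed

text \<open>Integrability of the norm says nothing about measurability of the vector field itself,
  which therefore enters separately.\<close>

lemma integrable_restrict_norm:
  fixes F :: "'a::euclidean_space \<Rightarrow> 'b::euclidean_space"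
  assumes L: "compact L" "L \<subseteq> \<Omega>" and F: "F \<in> borel_measurable (lebesgue_on \<Omega>)"
    and int: "loc_integrable \<Omega> (\<lambda>x. norm (F x))"
  shows "integrable lebesgue (\<lambda>x. if x \<in> L then F x else 0)"
proof (rule Bochner_Integration.integrable_bound)
  show "integrable lebesgue (\<lambda>x. if x \<in> L then norm (F x) else 0)"
    using int L by (intro set_integrable_restrict) (auto simp: loc_integrable_def)
  show "(\<lambda>x. if x \<in> L then F x else 0) \<in> borel_measurable lebesgue"
    by (rule borel_measurable_restrict_compact[OF F L])
qed auto

lemma gradient_term_integrable:
  fixes g :: "'a::euclidean_space \<Rightarrow> real \<Rightarrow> real" and Dv :: "'a \<Rightarrow> 'b::euclidean_space"
  assumes L: "compact L" "L \<subseteq> \<Omega>" and g: "continuous_on (\<Omega> \<times> UNIV) (\<lambda>(x, t). g x t)"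
    and v: "loc_ess_bdd \<Omega> v" "loc_ess_bdd \<Omega> Dv" and \<sigma>: "0 < \<sigma>"
  shows "integrable lebesgue (\<lambda>x. if x \<in> L then g x (v x) * norm (Dv x) powr \<sigma> else 0)"
proof -
  have v_meas: "v \<in> borel_measurable (lebesgue_on \<Omega>)" and Dv_meas: "Dv \<in> borel_measurable (lebesgue_on \<Omega>)"
    using v by (auto simp: loc_ess_bdd_def)
  obtain b1 where b1: "AE x in lebesgue. x \<in> L \<longrightarrow> norm (v x) \<le> b1"
    using v(1) L by (auto simp: loc_ess_bdd_def)
  obtain b2 where b2: "AE x in lebesgue. x \<in> L \<longrightarrow> norm (Dv x) \<le> b2"
    using v(2) L by (auto simp: loc_ess_bdd_def)
  have "compact (L \<times> {-b1..b1})"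
    using L by (intro compact_Times) auto
  then have "bounded ((\<lambda>(x, t). g x t) ` (L \<times> {-b1..b1}))"
    by (intro compact_imp_bounded compact_continuous_image continuous_on_subset[OF g]) (use L in auto)
  then obtain \<Gamma> where \<Gamma>: "0 < \<Gamma>" "\<forall>x\<in>L. \<forall>t\<in>{-b1..b1}. \<bar>g x t\<bar> \<le> \<Gamma>"
    by (auto simp: bounded_pos)
  show ?thesis
  proof (rule integrable_bounded_compact[OF L(1)])
    have "(\<lambda>x. g x (v x) * norm (Dv x) powr \<sigma>) \<in> borel_measurable (lebesgue_on \<Omega>)"
      using Dv_meas borel_measurable_continuous_superposition[OF g v_meas] by measurable
    then show "(\<lambda>x. if x \<in> L then g x (v x) * norm (Dv x) powr \<sigma> else 0) \<in> borel_measurable lebesgue"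
      by (rule borel_measurable_restrict_compact[OF _ L])
    show "AE x in lebesgue. x \<in> L \<longrightarrow> \<bar>if x \<in> L then g x (v x) * norm (Dv x) powr \<sigma> else 0\<bar> \<le> \<Gamma> * b2 powr \<sigma>"
      using b1 b2
    proof eventually_elim
      fix x assume *: "x \<in> L \<longrightarrow> norm (v x) \<le> b1" "x \<in> L \<longrightarrow> norm (Dv x) \<le> b2"
      show "x \<in> L \<longrightarrow> \<bar>if x \<in> L then g x (v x) * norm (Dv x) powr \<sigma> else 0\<bar> \<le> \<Gamma> * b2 powr \<sigma>"
      proof
        assume x: "x \<in> L"
        then have "\<bar>g x (v x)\<bar> * norm (Dv x) powr \<sigma> \<le> \<Gamma> * b2 powr \<sigma>"
          using * \<Gamma> \<sigma> by (intro mult_mono powr_mono2) (auto simp: abs_le_iff)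
        then show "\<bar>if x \<in> L then g x (v x) * norm (Dv x) powr \<sigma> else 0\<bar> \<le> \<Gamma> * b2 powr \<sigma>"
          using x by (simp add: abs_mult)
      qed
    qed
  qed simp
qed

theorem theorem1p4:
  fixes \<Omega> :: "(real ^ 'n) set"
    and a :: "real ^ 'n \<Rightarrow> real ^ 'n \<Rightarrow> real ^ 'n"
    and f g :: "real ^ 'n \<Rightarrow> real \<Rightarrow> real"
    and u v :: "real ^ 'n \<Rightarrow> real"
    and Du Dv :: "real ^ 'n \<Rightarrow> real ^ 'n"
    and p \<sigma> \<gamma> :: real
  assumes dom: "open \<Omega>" "connected \<Omega>" "bounded \<Omega>"
    and p: "1 < p" "p < 2"
    and sigma: "0 < \<sigma>"
    and a_meas: "\<And>\<xi>. (\<lambda>x. a x \<xi>) \<in> borel_measurable (lebesgue_on \<Omega>)"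
    and a_cont: "\<And>x. x \<in> \<Omega> \<Longrightarrow> continuous_on UNIV (a x)"
    and gamma: "0 < \<gamma>"
    and a_mono: "\<And>x \<xi> \<eta>. x \<in> \<Omega> \<Longrightarrow>
         (a x \<xi> - a x \<eta>) \<bullet> (\<xi> - \<eta>) \<ge> \<gamma> * (1 + norm \<xi> + norm \<eta>) powr (p - 2) * (norm (\<xi> - \<eta>))\<^sup>2"
    and f_cont: "continuous_on (\<Omega> \<times> UNIV) (\<lambda>(x, t). f x t)"
    and g_cont: "continuous_on (\<Omega> \<times> UNIV) (\<lambda>(x, t). g x t)"
    and f_mono: "\<And>x. x \<in> \<Omega> \<Longrightarrow> mono (f x)"
    and g_mono: "\<And>x. x \<in> \<Omega> \<Longrightarrow> mono (g x)"
    and u_W: "W1inf_loc \<Omega> u Du"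
    and v_W: "W1inf_loc \<Omega> v Dv"
    and cases: "(\<sigma> < 1 \<and> (\<forall>x\<in>\<Omega>. strict_mono (f x))) \<or> 1 \<le> \<sigma>"
    and Q: "Qstar_le \<Omega> a f g \<sigma> u Du v Dv"
    and bdry: "bdry_le \<Omega> u v"
  shows "AE x in lebesgue. x \<in> \<Omega> \<longrightarrow> u x \<le> v x"
proof -
  have bd: "loc_ess_bdd \<Omega> u" "loc_ess_bdd \<Omega> Du" "loc_ess_bdd \<Omega> v" "loc_ess_bdd \<Omega> Dv"
    using u_W v_W by (auto simp: W1inf_loc_def)
  \<comment> \<open>At a positive level the set \<open>{u - v > k\<^sub>0}\<close> keeps a positive
    distance from the frontier, which level 0 would not guarantee.\<close>
  have level: "AE x in lebesgue. x \<in> \<Omega> \<longrightarrow> u x - v x \<le> k\<^sub>0" if k0: "0 < k\<^sub>0" for k\<^sub>0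
  proof -
    obtain \<delta> where \<delta>: "0 < \<delta>" "\<And>x. x \<in> \<Omega> \<Longrightarrow> infdist x (frontier \<Omega>) < \<delta> \<Longrightarrow> u x - v x \<le> k\<^sub>0"
      using bdry k0 unfolding bdry_le_def by blast
    \<comment> \<open>Three layers of width \<open>d\<close>: \<open>K\<close> has depth
      \<open>d\<close>, \<open>L\<close> has depth \<open>2 * d\<close>, and a point of depth at
      least \<open>3 * d = \<delta>\<close> has its ball of radius \<open>d\<close> inside
      \<open>L\<close>. Hence points within \<open>d\<close> of the complement of \<open>L\<close>
      have depth below \<open>\<delta>\<close> if they lie in \<open>\<Omega>\<close>, and there
      \<open>u - v\<close> is at most \<open>k\<^sub>0\<close>.\<close>
    define d where "d = \<delta> / 3"
    have d: "0 < d"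
      using \<delta> by (simp add: d_def)
    define K where "K = {x \<in> \<Omega>. d \<le> infdist x (frontier \<Omega>)}"
    define L where "L = {x \<in> \<Omega>. 2 * d \<le> infdist x (frontier \<Omega>)}"
    have K: "compact K" "K \<subseteq> \<Omega>" and compL: "compact L" "L \<subseteq> \<Omega>"
      using compact_inner_parallel_set[OF dom(1,3)] d by (auto simp: K_def L_def)
    have LK: "cball x d \<subseteq> K" if "x \<in> L" for x
      using that d unfolding K_def L_def by (intro cball_subset_inner_parallel_set) auto
    have w_out: "u y - v y \<le> k\<^sub>0" if "x \<notin> L" "dist x y \<le> d" "y \<in> K" for x y
    proof (rule \<delta>(2))
      show "y \<in> \<Omega>"
        using that K by auto
      show "infdist y (frontier \<Omega>) < \<delta>"
      proof (rule ccontr)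
        assume "\<not> infdist y (frontier \<Omega>) < \<delta>"
        then have "cball y d \<subseteq> L"
          unfolding L_def using d \<open>y \<in> \<Omega>\<close> by (intro cball_subset_inner_parallel_set) (auto simp: d_def)
        moreover have "x \<in> cball y d"
          using that(2) by (simp add: dist_commute)
        ultimately show False
          using that(1) by blast
      qed
    qed
    define w where "w x = (if x \<in> L then u x - v x else 0)" for x
    define W where "W x = (if x \<in> L then Du x - Dv x else 0)" for x
    have "\<exists>B U DU. smooth_approximation L k\<^sub>0 B w W U DU"
      unfolding w_def W_def
      using W1inf_loc_diff[OF u_W v_W] K less_imp_le[OF k0] d compL(1) LK w_out
      by (rule W1inf_loc_smooth_approximation)
    then obtain B U DU where "smooth_approximation L k\<^sub>0 B w W U DU"
      by blast
    then interpret smooth_approximation L k\<^sub>0 B w W U DU .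

    obtain b1 b2 b3 b4 where ess:
      "AE x in lebesgue. x \<in> L \<longrightarrow> norm (u x) \<le> b1" "AE x in lebesgue. x \<in> L \<longrightarrow> norm (Du x) \<le> b2"
      "AE x in lebesgue. x \<in> L \<longrightarrow> norm (v x) \<le> b3" "AE x in lebesgue. x \<in> L \<longrightarrow> norm (Dv x) \<le> b4"
      using bd compL unfolding loc_ess_bdd_def by meson
    define b where "b = 1 + \<bar>b1\<bar> + \<bar>b2\<bar> + \<bar>b3\<bar> + \<bar>b4\<bar>"
    have b: "0 < b"
      by (simp add: b_def)
    have bounds: "AE x in lebesgue. x \<in> L \<longrightarrow> \<bar>u x\<bar> \<le> b \<and> \<bar>v x\<bar> \<le> b \<and> norm (Du x) \<le> b \<and> norm (Dv x) \<le> b"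
      using ess
    proof eventually_elim
      fix x assume "x \<in> L \<longrightarrow> norm (u x) \<le> b1" "x \<in> L \<longrightarrow> norm (Du x) \<le> b2"
        "x \<in> L \<longrightarrow> norm (v x) \<le> b3" "x \<in> L \<longrightarrow> norm (Dv x) \<le> b4"
      then show "x \<in> L \<longrightarrow> \<bar>u x\<bar> \<le> b \<and> \<bar>v x\<bar> \<le> b \<and> norm (Du x) \<le> b \<and> norm (Dv x) \<le> b"
        by (auto simp: b_def)
    qed
    obtain C where C: "0 \<le> C" and lower: "\<forall>x s t (\<xi> :: real ^ 'n) \<eta>. x \<in> L \<and> \<bar>s\<bar> \<le> b \<and> \<bar>t\<bar> \<le> b \<and> norm \<xi> \<le> b \<and> norm \<eta> \<le> b \<and> k\<^sub>0 \<le> s - t \<longrightarrow>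
      f x t + g x t * norm \<eta> powr \<sigma> - f x s - g x s * norm \<xi> powr \<sigma> \<le> C * norm (\<xi> - \<eta>)"
      using lower_order_terms_le[OF compL k0 b sigma f_cont f_mono g_cont g_mono cases, where 'b="real ^ 'n"] by blast
    \<comment> \<open>The ellipticity constant on \<open>L\<close>: since \<open>p < 2\<close> the
      weight decreases in both gradients, and these are almost everywhere bounded by
      \<open>b\<close>.\<close>
    define c where "c = \<gamma> * (1 + b + b) powr (p - 2)"
    have c: "0 < c"
      using gamma b by (simp add: c_def)

    \<comment> \<open>Cutting off at \<open>L\<close> makes the coefficients integrable over the
      whole space, and test functions that vanish off \<open>L\<close> together with their gradients
      do not notice it.\<close>
    define A where "A x = (if x \<in> L then a x (Du x) - a x (Dv x) else 0)" for x
    define H where "H x = (if x \<in> L then f x (v x) + g x (v x) * norm (Dv x) powr \<sigma>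
        - f x (u x) - g x (u x) * norm (Du x) powr \<sigma> else 0)" for x
    have loc: "loc_integrable \<Omega> (\<lambda>x. norm (a x (Du x)))" "loc_integrable \<Omega> (\<lambda>x. norm (a x (Dv x)))"
      "loc_integrable \<Omega> (\<lambda>x. f x (u x))" "loc_integrable \<Omega> (\<lambda>x. f x (v x))"
      and weak: "\<And>\<phi> D\<phi>. test_fn \<Omega> \<phi> D\<phi> \<Longrightarrow> (\<And>x. 0 \<le> \<phi> x) \<Longrightarrow>
        (LINT x|lebesgue. (a x (Du x) - a x (Dv x)) \<bullet> D\<phi> x)
        \<le> (LINT x|lebesgue. (f x (v x) + g x (v x) * norm (Dv x) powr \<sigma>
                              - f x (u x) - g x (u x) * norm (Du x) powr \<sigma>) * \<phi> x)"
      using Q unfolding Qstar_le_def by auto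
    have A_int: "integrable lebesgue A"
    proof -
      have "Du \<in> borel_measurable (lebesgue_on \<Omega>)" "Dv \<in> borel_measurable (lebesgue_on \<Omega>)"
        using bd by (simp_all add: loc_ess_bdd_def)
      then have "(\<lambda>x. a x (Du x)) \<in> borel_measurable (lebesgue_on \<Omega>)"
        "(\<lambda>x. a x (Dv x)) \<in> borel_measurable (lebesgue_on \<Omega>)"
        by (intro caratheodory_measurable[OF a_meas a_cont]; simp)+
      then have "integrable lebesgue (\<lambda>x. if x \<in> L then a x (Du x) else 0)"
        "integrable lebesgue (\<lambda>x. if x \<in> L then a x (Dv x) else 0)"
        using integrable_restrict_norm[OF compL _ loc(1)] integrable_restrict_norm[OF compL _ loc(2)] by blast+
      from Bochner_Integration.integrable_diff[OF this] show ?thesis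
        by (rule Bochner_Integration.integrable_cong[THEN iffD1, rotated 2]) (auto simp: A_def)
    qed
    have H_int: "integrable lebesgue H"
    proof -
      have f_int: "integrable lebesgue (\<lambda>x. if x \<in> L then f x (u x) else 0)"
        "integrable lebesgue (\<lambda>x. if x \<in> L then f x (v x) else 0)"
        using loc(3,4) compL by (auto simp: loc_integrable_def intro!: set_integrable_restrict)
      have "integrable lebesgue (\<lambda>x. (if x \<in> L then f x (v x) else 0)
          + (if x \<in> L then g x (v x) * norm (Dv x) powr \<sigma> else 0)
          - (if x \<in> L then f x (u x) else 0) - (if x \<in> L then g x (u x) * norm (Du x) powr \<sigma> else 0))"
        by (intro Bochner_Integration.integrable_diff Bochner_Integration.integrable_add f_int
            gradient_term_integrable[OF compL g_cont _ _ sigma] bd)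
      then show ?thesis
        by (rule Bochner_Integration.integrable_cong[THEN iffD1, rotated 2]) (auto simp: H_def)
    qed
    have energy: "3 * c * (LINT x|lebesgue. norm (W x) ^ 2 * excess k x ^ 2) \<le> C * (LINT x|lebesgue. norm (W x) * excess k x ^ 3)"
      if k: "k\<^sub>0 \<le> k" for k
    proof -
      have "(LINT x|lebesgue. (3 * excess k x ^ 2) * (A x \<bullet> W x)) \<le> (LINT x|lebesgue. H x * excess k x ^ 3)"
      proof (rule weak_inequality_limit[OF k compL(2) A_int H_int])
        fix \<phi> D\<phi>
        assume t: "test_fn \<Omega> \<phi> D\<phi>" "\<And>x. 0 \<le> \<phi> x" and off: "\<And>x. x \<notin> L \<Longrightarrow> \<phi> x = 0 \<and> D\<phi> x = 0"
        have "(\<lambda>x. A x \<bullet> D\<phi> x) = (\<lambda>x. (a x (Du x) - a x (Dv x)) \<bullet> D\<phi> x)"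
          "(\<lambda>x. H x * \<phi> x) = (\<lambda>x. (f x (v x) + g x (v x) * norm (Dv x) powr \<sigma>
                              - f x (u x) - g x (u x) * norm (Du x) powr \<sigma>) * \<phi> x)"
          using off by (auto simp: A_def H_def fun_eq_iff)
        then show "(LINT x|lebesgue. A x \<bullet> D\<phi> x) \<le> (LINT x|lebesgue. H x * \<phi> x)"
          using weak[OF t] by simp
      qed
      moreover have "3 * c * (LINT x|lebesgue. norm (W x) ^ 2 * excess k x ^ 2) \<le> (LINT x|lebesgue. (3 * excess k x ^ 2) * (A x \<bullet> W x))"
        unfolding integral_mult_right_zero[symmetric]
      proof (rule integral_mono_AE)
        show "integrable lebesgue (\<lambda>x. 3 * c * (norm (W x) ^ 2 * excess k x ^ 2))"
          using excess_weighted_integrable[OF k, of UNIV 2 1] by (simp add: numeral_2_eq_2)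
        show "integrable lebesgue (\<lambda>x. (3 * excess k x ^ 2) * (A x \<bullet> W x))"
        proof (rule Bochner_Integration.integrable_bound)
          show "integrable lebesgue (\<lambda>x. 3 * B ^ 2 * (norm (A x) * B))"
            using A_int by simp
          show "(\<lambda>x. (3 * excess k x ^ 2) * (A x \<bullet> W x)) \<in> borel_measurable lebesgue"
            using borel_measurable_integrable[OF A_int] by measurable
          show "AE x in lebesgue. norm ((3 * excess k x ^ 2) * (A x \<bullet> W x)) \<le> norm (3 * B ^ 2 * (norm (A x) * B))"
            using excess_le[OF k] W_le
          proof eventually_elim
            fix x assume *: "excess k x \<le> B" "x \<in> L \<longrightarrow> norm (W x) \<le> B"
            have "norm (W x) \<le> B"
              using * B_nonneg by (cases "x \<in> L") (auto simp: W_def)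
            then have "\<bar>A x \<bullet> W x\<bar> \<le> norm (A x) * B"
              using Cauchy_Schwarz_ineq2[of "A x" "W x"] mult_left_mono[of "norm (W x)" B "norm (A x)"] by simp
            moreover have "excess k x ^ 2 \<le> B ^ 2"
              using *(1) by (intro power_mono) auto
            ultimately have "excess k x ^ 2 * \<bar>A x \<bullet> W x\<bar> \<le> B ^ 2 * (norm (A x) * B)"
              by (intro mult_mono) auto
            then show "norm ((3 * excess k x ^ 2) * (A x \<bullet> W x)) \<le> norm (3 * B ^ 2 * (norm (A x) * B))"
              using B_nonneg by (simp add: abs_mult)
          qed
        qed
        show "AE x in lebesgue. 3 * c * (norm (W x) ^ 2 * excess k x ^ 2) \<le> (3 * excess k x ^ 2) * (A x \<bullet> W x)"
          using bounds
        proof eventually_elim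
          fix x assume bx: "x \<in> L \<longrightarrow> \<bar>u x\<bar> \<le> b \<and> \<bar>v x\<bar> \<le> b \<and> norm (Du x) \<le> b \<and> norm (Dv x) \<le> b"
          have "c * norm (W x) ^ 2 \<le> A x \<bullet> W x"
          proof (cases "x \<in> L")
            case True
            have "(1 + b + b) powr (p - 2) \<le> (1 + norm (Du x) + norm (Dv x)) powr (p - 2)"
              using p bx True by (intro powr_mono2') (auto simp: add_pos_nonneg)
            then have "c * norm (W x) ^ 2 \<le> \<gamma> * (1 + norm (Du x) + norm (Dv x)) powr (p - 2) * norm (W x) ^ 2"
              unfolding c_def using gamma by (intro mult_right_mono mult_left_mono) auto
            also have "\<dots> \<le> A x \<bullet> W x"
              using a_mono[of x "Du x" "Dv x"] True compL by (auto simp: A_def W_def)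
            finally show ?thesis .
          qed (simp add: W_def)
          then have "3 * excess k x ^ 2 * (c * norm (W x) ^ 2) \<le> 3 * excess k x ^ 2 * (A x \<bullet> W x)"
            by (intro mult_left_mono) auto
          then show "3 * c * (norm (W x) ^ 2 * excess k x ^ 2) \<le> (3 * excess k x ^ 2) * (A x \<bullet> W x)"
            by (simp add: mult_ac)
        qed
      qed
      moreover have "(LINT x|lebesgue. H x * excess k x ^ 3) \<le> C * (LINT x|lebesgue. norm (W x) * excess k x ^ 3)"
        unfolding integral_mult_right_zero[symmetric]
      proof (rule integral_mono_AE)
        show "integrable lebesgue (\<lambda>x. C * (norm (W x) * excess k x ^ 3))"
          using excess_weighted_integrable[OF k, of UNIV 1 2] by (simp add: eval_nat_numeral)
        show "integrable lebesgue (\<lambda>x. H x * excess k x ^ 3)"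
        proof (rule Bochner_Integration.integrable_bound)
          show "integrable lebesgue (\<lambda>x. H x * B ^ 3)"
            using H_int by simp
          show "(\<lambda>x. H x * excess k x ^ 3) \<in> borel_measurable lebesgue"
            using borel_measurable_integrable[OF H_int] by measurable
          show "AE x in lebesgue. norm (H x * excess k x ^ 3) \<le> norm (H x * B ^ 3)"
            using excess_le[OF k]
          proof eventually_elim
            fix x assume "excess k x \<le> B"
            then have "excess k x ^ 3 \<le> B ^ 3"
              by (intro power_mono) auto
            then show "norm (H x * excess k x ^ 3) \<le> norm (H x * B ^ 3)"
              using B_nonneg by (simp add: abs_mult power_abs mult_left_mono)
          qed
        qed
        show "AE x in lebesgue. H x * excess k x ^ 3 \<le> C * (norm (W x) * excess k x ^ 3)"
          using bounds
        proof eventually_elim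
          fix x assume bx: "x \<in> L \<longrightarrow> \<bar>u x\<bar> \<le> b \<and> \<bar>v x\<bar> \<le> b \<and> norm (Du x) \<le> b \<and> norm (Dv x) \<le> b"
          show "H x * excess k x ^ 3 \<le> C * (norm (W x) * excess k x ^ 3)"
          proof (cases "excess k x = 0")
            \<comment> \<open>Non-zero excess means \<open>w x > k \<ge> k\<^sub>0\<close>, the
              range in which the lower order terms are controlled.\<close>
            case False
            then have xL: "x \<in> L"
              using excess_off(1)[OF k, of x] by blast
            have "k\<^sub>0 \<le> u x - v x"
              using False k xL by (auto simp: w_def max_def split: if_splits)
            then have "H x \<le> C * norm (W x)"
              using lower[rule_format, of x "u x" "v x" "Du x" "Dv x"] bx xL by (simp add: H_def W_def)
            then have "H x * excess k x ^ 3 \<le> (C * norm (W x)) * excess k x ^ 3"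
              by (intro mult_right_mono) auto
            then show ?thesis
              by (simp add: mult.assoc)
          qed simp
        qed
      qed
      ultimately show ?thesis
        by linarith
    qed
    have "AE x in lebesgue. w x \<le> k\<^sub>0"
      by (rule AE_le_of_energy_inequality[OF c C energy])
    then show ?thesis
    proof eventually_elim
      fix x assume x: "w x \<le> k\<^sub>0"
      show "x \<in> \<Omega> \<longrightarrow> u x - v x \<le> k\<^sub>0"
      proof
        assume "x \<in> \<Omega>"
        show "u x - v x \<le> k\<^sub>0"
        proof (cases "x \<in> L")
          case True
          then show ?thesis
            using x by (simp add: w_def)
        next
          case False
          then have "infdist x (frontier \<Omega>) < \<delta>"
            using \<open>x \<in> \<Omega>\<close> d by (simp add: L_def d_def)
          then show ?thesis
            using \<delta>(2) \<open>x \<in> \<Omega>\<close> by blast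
        qed
      qed
    qed
  qed
  have "AE x in lebesgue. \<forall>n. x \<in> \<Omega> \<longrightarrow> u x - v x \<le> 1 / real (Suc n)"
    unfolding AE_all_countable by (intro allI level) simp
  then show ?thesis
  proof eventually_elim
    fix x assume le: "\<forall>n. x \<in> \<Omega> \<longrightarrow> u x - v x \<le> 1 / real (Suc n)"
    show "x \<in> \<Omega> \<longrightarrow> u x \<le> v x"
    proof
      assume "x \<in> \<Omega>"
      show "u x \<le> v x"
      proof (rule field_le_epsilon)
        fix e :: real assume "0 < e"
        then obtain n where "1 / real (Suc n) < e"
          using nat_approx_posE by blast
        with le[rule_format, of n] \<open>x \<in> \<Omega>\<close> show "u x \<le> v x + e"
          by linarith
      qed
    qed
  qed
qed

end
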